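(* Let $\sigma$ be a countable signature. For all sets $\Gamma\subseteq\mathrm{Sent}_\sigma$ and $\Delta\subseteq\mathrm{Form}_\sigma$: $\Gamma\vdash_\sharp\Delta$ if and only if $\Gamma\vDash_\sharp\Delta$.
   Context: Syntax. A signature $\sigma$ is a set of predicate symbols (each with an arity) and constant symbols; no function symbols. $\mathrm{Var}$ is a fixed countable set of variables; $\sigma$-terms are variables and constants of $\sigma$. $\sigma$-formulas ($\mathrm{Form}_\sigma$) are built from atomic formulas $P(t_1,\dots,t_n)$ and $\bot$ using $\rightarrow,\wedge,\vee$, strong negation $\sim$, modal operators $\Box,\Diamond$, and quantifiers $\forall x,\exists x$; $\mathrm{Sent}_\sigma$ is the set of sentences. Abbreviations: $\neg\Phi:=\Phi\rightarrow\bot$, $\Phi\leftrightarrow\Psi:=(\Phi\rightarrow\Psi)\wedge(\Psi\rightarrow\Phi)$, $\Phi\Leftrightarrow\Psi:=(\Phi\leftrightarrow\Psi)\wedge({\sim\Phi}\leftrightarrow{\sim\Psi})$; $\Phi(x/t)$ is substitution of $t$ for free occurrences of $x$. Calculus. $\mathsf{QBK}_\sigma$ is the smallest set of $\sigma$-formulas containing all instances of the following schemes and closed under the rules below. Axioms: $\Phi\rightarrow(\Psi\rightarrow\Phi)$; $(\Phi\rightarrow(\Psi\rightarrow\Theta))\rightarrow((\Phi\rightarrow\Psi)\rightarrow(\Phi\rightarrow\Theta))$; $\Phi\wedge\Psi\rightarrow\Phi$; $\Phi\wedge\Psi\rightarrow\Psi$; $\Phi\rightarrow(\Psi\rightarrow\Phi\wedge\Psi)$;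 $\Phi\rightarrow\Phi\vee\Psi$; $\Psi\rightarrow\Phi\vee\Psi$; $(\Phi\rightarrow\Theta)\rightarrow((\Psi\rightarrow\Theta)\rightarrow(\Phi\vee\Psi\rightarrow\Theta))$; $\Phi\vee(\Phi\rightarrow\bot)$; $\bot\rightarrow\Phi$; ${\sim\sim\Phi}\leftrightarrow\Phi$; ${\sim(\Phi\rightarrow\Psi)}\leftrightarrow(\Phi\wedge{\sim\Psi})$; ${\sim(\Phi\vee\Psi)}\leftrightarrow({\sim\Phi}\wedge{\sim\Psi})$; ${\sim(\Phi\wedge\Psi)}\leftrightarrow({\sim\Phi}\vee{\sim\Psi})$; ${\sim\bot}$; $(\Box\Phi\wedge\Box\Psi)\rightarrow\Box(\Phi\wedge\Psi)$; $\Box(\Phi\rightarrow\Phi)$; $\neg\Box\Phi\leftrightarrow\Diamond\neg\Phi$; $\neg\Diamond\Phi\leftrightarrow\Box\neg\Phi$; $\Box\Phi\Leftrightarrow{\sim\Diamond{\sim\Phi}}$; $\Diamond\Phi\Leftrightarrow{\sim\Box{\sim\Phi}}$; $\forall x\Phi\rightarrow\Phi(x/t)$ and $\Phi(x/t)\rightarrow\exists x\Phi$ ($t$ free for $x$ in $\Phi$); ${\sim\forall x\Phi}\leftrightarrow\exists x{\sim\Phi}$; ${\sim\exists x\Phi}\leftrightarrow\forall x{\sim\Phi}$. Rules: MP (from $\Phi$, $\Phi\rightarrow\Psi$ infer $\Psi$); MB (from $\Phi\rightarrow\Psi$ infer $\Box\Phi\rightarrow\Box\Psi$); MD (from $\Phi\rightarrow\Psi$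 infer $\Diamond\Phi\rightarrow\Diamond\Psi$); BR1 (from $\Phi\rightarrow\Psi$ infer $\Phi\rightarrow\forall x\Psi$, $x$ not free in $\Phi$); BR2 (from $\Phi\rightarrow\Psi$ infer $\exists x\Phi\rightarrow\Psi$, $x$ not free in $\Psi$). $\mathsf{QBK}^\sharp_\sigma$ is the smallest set of $\sigma$-formulas containing $\mathsf{QBK}_\sigma$ and all instances of the Barcan scheme $\Diamond\exists x\Phi\rightarrow\exists x\Diamond\Phi$, closed under MP, MB, MD, BR1, BR2. Derivability. $\mathrm{Disj}(\Delta)$ is the set of disjunctions $\Phi_1\vee\dots\vee\Phi_n$ with $\{\Phi_1,\dots,\Phi_n\}\subseteq\Delta$, $n\ge0$ (empty disjunction $=\bot$). For $\Gamma\subseteq\mathrm{Sent}_\sigma$, $\Delta\subseteq\mathrm{Form}_\sigma$: $\Gamma\vdash_\sharp\Delta$ iff some element of $\mathrm{Disj}(\Delta)$ is obtainable from elements of $\Gamma\cup\mathsf{QBK}^\sharp_\sigma$ using only MP, BR1, BR2. Semantics. A $\mathsf{QBK}_\sigma$-model is $\mathcal M=\langle\langle W,R\rangle,(\mathfrak A^+_w),(\mathfrak A^-_w)\rangle$ ($W\ne\emptyset$, $R\subseteq W\times W$), where $\mathfrak A^\pm_w$ are $\sigma$-structures with common domain $A_w$ and same interpretation of constants, and $uRv$ implies $A_u\subseteq A_v$ and each constant of $\sigma$ is interpreted the same in $\mathfrak A^+_u,\mathfrak A^+_v$. A $\mathsf{QBK}^\sharp_\sigma$-model is a $\mathsf{QBK}_\sigma$-model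 in which $A_u=A_v$ for all worlds $u,v$. For a set $A$, $\sigma_A$ adds new constants $\underline a$ ($a\in A$) interpreted as $a$; $A$-sentences are $\sigma_A$-sentences; a ground $A$-substitution $\lambda$ maps each variable to a constant of $\sigma_A$, and $\lambda\Phi$ is the simultaneous substitution. Verification $\Vdash^+$ / falsification $\Vdash^-$ of $A_w$-sentences at $w$: atomic $\Theta$: $\Vdash^+$ iff $\mathfrak A^+_w\models\Theta$, $\Vdash^-$ iff $\mathfrak A^-_w\models\Theta$; $\bot$ never verified, always falsified; $\wedge$: verified iff both verified, falsified iff one falsified; $\vee$: verified iff one verified, falsified iff both falsified; $\Phi\rightarrow\Psi$: verified iff $\Phi$ not verified or $\Psi$ verified, falsified iff $\Phi$ verified and $\Psi$ falsified; ${\sim\Phi}$: verified iff $\Phi$ falsified, falsified iff $\Phi$ verified; $\Box\Phi$: verified iff $\Phi$ verified at all $u$ with $wRu$, falsified iff $\Phi$ falsified at some $u$ with $wRu$; $\Diamond\Phi$: verified iff $\Phi$ verified at some $u$ with $wRu$, falsified iff $\Phi$ falsified at all $u$ with $wRu$; $\forall x\Phi$: verified iff $\Phi(x/\underline a)$ verified for all $a\in A_w$, falsified iff falsified for some $a\in A_w$; $\exists x\Phi$: verified iff verified for some $a\in A_w$, falsified iff falsified for all $a\in A_w$. $\Gamma\vDash_\sharp\Delta$ iff for every $\mathsf{QBK}^\sharp_\sigma$-model $\mathcal M$, world $w$ and ground $A_w$-substitution $\lambda$: if $\mathcal M,w\Vdash^+\Phi$ for all $\Phi\in\Gamma$, then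 $\mathcal M,w\Vdash^+\lambda\Psi$ for some $\Psi\in\Delta$. *)

theory Defs
  imports Main "HOL-Library.Countable_Set"
begin

subsection \<open>Syntax\<close>

record ('p, 'c) signature =
  preds :: "'p set"
  arity :: "'p \<Rightarrow> nat"
  consts_of :: "'c set"

definition countable_signature :: "('p, 'c) signature \<Rightarrow> bool" where
  "countable_signature \<sigma> \<longleftrightarrow> countable (preds \<sigma>) \<and> countable (consts_of \<sigma>)"

type_synonym var = nat

datatype 'c tm = Var var | Const 'c

datatype ('p, 'c) fm =
    Atom 'p "'c tm list"
  | Falsum ("\<^bold>\<bottom>")
  | Imp "('p, 'c) fm" "('p, 'c) fm" (infixr "\<^bold>\<rightarrow>" 60)
  | Conj "('p, 'c) fm" "('p, 'c) fm" (infixr "\<^bold>\<and>" 64)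
  | Disj "('p, 'c) fm" "('p, 'c) fm" (infixr "\<^bold>\<or>" 62)
  | SNeg "('p, 'c) fm" ("\<^bold>\<sim> _" [70] 70)
  | Box "('p, 'c) fm" ("\<^bold>\<box> _" [70] 70)
  | Dia "('p, 'c) fm" ("\<^bold>\<diamond> _" [70] 70)
  | Forall var "('p, 'c) fm"
  | Exists var "('p, 'c) fm"

abbreviation Neg :: "('p, 'c) fm \<Rightarrow> ('p, 'c) fm" ("\<^bold>\<not> _" [70] 70) where
  "\<^bold>\<not> \<Phi> \<equiv> \<Phi> \<^bold>\<rightarrow> \<^bold>\<bottom>"

abbreviation Iff :: "('p, 'c) fm \<Rightarrow> ('p, 'c) fm \<Rightarrow> ('p, 'c) fm" (infix "\<^bold>\<leftrightarrow>" 58) where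
  "\<Phi> \<^bold>\<leftrightarrow> \<Psi> \<equiv> (\<Phi> \<^bold>\<rightarrow> \<Psi>) \<^bold>\<and> (\<Psi> \<^bold>\<rightarrow> \<Phi>)"

abbreviation SIff :: "('p, 'c) fm \<Rightarrow> ('p, 'c) fm \<Rightarrow> ('p, 'c) fm" (infix "\<^bold>\<Leftrightarrow>" 58) where
  "\<Phi> \<^bold>\<Leftrightarrow> \<Psi> \<equiv> (\<Phi> \<^bold>\<leftrightarrow> \<Psi>) \<^bold>\<and> (\<^bold>\<sim> \<Phi> \<^bold>\<leftrightarrow> \<^bold>\<sim> \<Psi>)"

fun is_term :: "('p, 'c) signature \<Rightarrow> 'c tm \<Rightarrow> bool" where
  "is_term \<sigma> (Var x) \<longleftrightarrow> True"
| "is_term \<sigma> (Const c) \<longleftrightarrow> c \<in> consts_of \<sigma>"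

fun is_form :: "('p, 'c) signature \<Rightarrow> ('p, 'c) fm \<Rightarrow> bool" where
  "is_form \<sigma> (Atom P ts) \<longleftrightarrow>
     P \<in> preds \<sigma> \<and> length ts = arity \<sigma> P \<and> (\<forall>t \<in> set ts. is_term \<sigma> t)"
| "is_form \<sigma> \<^bold>\<bottom> \<longleftrightarrow> True"
| "is_form \<sigma> (\<Phi> \<^bold>\<rightarrow> \<Psi>) \<longleftrightarrow> is_form \<sigma> \<Phi> \<and> is_form \<sigma> \<Psi>"
| "is_form \<sigma> (\<Phi> \<^bold>\<and> \<Psi>) \<longleftrightarrow> is_form \<sigma> \<Phi> \<and> is_form \<sigma> \<Psi>"
| "is_form \<sigma> (\<Phi> \<^bold>\<or> \<Psi>) \<longleftrightarrow> is_form \<sigma> \<Phi> \<and> is_form \<sigma> \<Psi>"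
| "is_form \<sigma> (\<^bold>\<sim> \<Phi>) \<longleftrightarrow> is_form \<sigma> \<Phi>"
| "is_form \<sigma> (\<^bold>\<box> \<Phi>) \<longleftrightarrow> is_form \<sigma> \<Phi>"
| "is_form \<sigma> (\<^bold>\<diamond> \<Phi>) \<longleftrightarrow> is_form \<sigma> \<Phi>"
| "is_form \<sigma> (Forall x \<Phi>) \<longleftrightarrow> is_form \<sigma> \<Phi>"
| "is_form \<sigma> (Exists x \<Phi>) \<longleftrightarrow> is_form \<sigma> \<Phi>"

fun fv_tm :: "'c tm \<Rightarrow> var set" where
  "fv_tm (Var x) = {x}"
| "fv_tm (Const c) = {}"

fun fv :: "('p, 'c) fm \<Rightarrow> var set" where
  "fv (Atom P ts) = (\<Union>t \<in> set ts. fv_tm t)"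
| "fv \<^bold>\<bottom> = {}"
| "fv (\<Phi> \<^bold>\<rightarrow> \<Psi>) = fv \<Phi> \<union> fv \<Psi>"
| "fv (\<Phi> \<^bold>\<and> \<Psi>) = fv \<Phi> \<union> fv \<Psi>"
| "fv (\<Phi> \<^bold>\<or> \<Psi>) = fv \<Phi> \<union> fv \<Psi>"
| "fv (\<^bold>\<sim> \<Phi>) = fv \<Phi>"
| "fv (\<^bold>\<box> \<Phi>) = fv \<Phi>"
| "fv (\<^bold>\<diamond> \<Phi>) = fv \<Phi>"
| "fv (Forall x \<Phi>) = fv \<Phi> - {x}"
| "fv (Exists x \<Phi>) = fv \<Phi> - {x}"

definition Form :: "('p, 'c) signature \<Rightarrow> ('p, 'c) fm set" where
  "Form \<sigma> = {\<Phi>. is_form \<sigma> \<Phi>}"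

definition Sent :: "('p, 'c) signature \<Rightarrow> ('p, 'c) fm set" where
  "Sent \<sigma> = {\<Phi> \<in> Form \<sigma>. fv \<Phi> = {}}"

fun subst_tm :: "(var \<Rightarrow> 'c tm) \<Rightarrow> 'c tm \<Rightarrow> 'c tm" where
  "subst_tm \<theta> (Var x) = \<theta> x"
| "subst_tm \<theta> (Const c) = Const c"

text \<open>
  Simultaneous replacement of the free occurrences of variables. Bound variables are not
  renamed, so capture is possible; it is excluded by \<open>free_for\<close> in the calculus, and it cannot
  happen in the semantics, where only constants are substituted.
\<close>

fun msubst :: "(var \<Rightarrow> 'c tm) \<Rightarrow> ('p, 'c) fm \<Rightarrow> ('p, 'c) fm" where
  "msubst \<theta> (Atom P ts) = Atom P (map (subst_tm \<theta>) ts)"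
| "msubst \<theta> \<^bold>\<bottom> = \<^bold>\<bottom>"
| "msubst \<theta> (\<Phi> \<^bold>\<rightarrow> \<Psi>) = msubst \<theta> \<Phi> \<^bold>\<rightarrow> msubst \<theta> \<Psi>"
| "msubst \<theta> (\<Phi> \<^bold>\<and> \<Psi>) = msubst \<theta> \<Phi> \<^bold>\<and> msubst \<theta> \<Psi>"
| "msubst \<theta> (\<Phi> \<^bold>\<or> \<Psi>) = msubst \<theta> \<Phi> \<^bold>\<or> msubst \<theta> \<Psi>"
| "msubst \<theta> (\<^bold>\<sim> \<Phi>) = \<^bold>\<sim> (msubst \<theta> \<Phi>)"
| "msubst \<theta> (\<^bold>\<box> \<Phi>) = \<^bold>\<box> (msubst \<theta> \<Phi>)"
| "msubst \<theta> (\<^bold>\<diamond> \<Phi>) = \<^bold>\<diamond> (msubst \<theta> \<Phi>)"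
| "msubst \<theta> (Forall x \<Phi>) = Forall x (msubst (\<theta>(x := Var x)) \<Phi>)"
| "msubst \<theta> (Exists x \<Phi>) = Exists x (msubst (\<theta>(x := Var x)) \<Phi>)"

definition subst :: "('p, 'c) fm \<Rightarrow> var \<Rightarrow> 'c tm \<Rightarrow> ('p, 'c) fm" where
  "subst \<Phi> x t = msubst (Var(x := t)) \<Phi>"

fun free_for :: "'c tm \<Rightarrow> var \<Rightarrow> ('p, 'c) fm \<Rightarrow> bool" where
  "free_for t x (Atom P ts) \<longleftrightarrow> True"
| "free_for t x \<^bold>\<bottom> \<longleftrightarrow> True"
| "free_for t x (\<Phi> \<^bold>\<rightarrow> \<Psi>) \<longleftrightarrow> free_for t x \<Phi> \<and> free_for t x \<Psi>"
| "free_for t x (\<Phi> \<^bold>\<and> \<Psi>) \<longleftrightarrow> free_for t x \<Phi> \<and> free_for t x \<Psi>"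
| "free_for t x (\<Phi> \<^bold>\<or> \<Psi>) \<longleftrightarrow> free_for t x \<Phi> \<and> free_for t x \<Psi>"
| "free_for t x (\<^bold>\<sim> \<Phi>) \<longleftrightarrow> free_for t x \<Phi>"
| "free_for t x (\<^bold>\<box> \<Phi>) \<longleftrightarrow> free_for t x \<Phi>"
| "free_for t x (\<^bold>\<diamond> \<Phi>) \<longleftrightarrow> free_for t x \<Phi>"
| "free_for t x (Forall y \<Phi>) \<longleftrightarrow> x \<notin> fv (Forall y \<Phi>) \<or> (y \<notin> fv_tm t \<and> free_for t x \<Phi>)"
| "free_for t x (Exists y \<Phi>) \<longleftrightarrow> x \<notin> fv (Exists y \<Phi>) \<or> (y \<notin> fv_tm t \<and> free_for t x \<Phi>)"

subsection \<open>The calculi\<close>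

inductive_set QBK_axioms :: "('p, 'c) signature \<Rightarrow> ('p, 'c) fm set" for \<sigma> where
  I1: "\<lbrakk>\<Phi> \<in> Form \<sigma>; \<Psi> \<in> Form \<sigma>\<rbrakk> \<Longrightarrow> \<Phi> \<^bold>\<rightarrow> (\<Psi> \<^bold>\<rightarrow> \<Phi>) \<in> QBK_axioms \<sigma>"
| I2: "\<lbrakk>\<Phi> \<in> Form \<sigma>; \<Psi> \<in> Form \<sigma>; \<Theta> \<in> Form \<sigma>\<rbrakk> \<Longrightarrow>
    (\<Phi> \<^bold>\<rightarrow> (\<Psi> \<^bold>\<rightarrow> \<Theta>)) \<^bold>\<rightarrow> ((\<Phi> \<^bold>\<rightarrow> \<Psi>) \<^bold>\<rightarrow> (\<Phi> \<^bold>\<rightarrow> \<Theta>)) \<in> QBK_axioms \<sigma>"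
| C1: "\<lbrakk>\<Phi> \<in> Form \<sigma>; \<Psi> \<in> Form \<sigma>\<rbrakk> \<Longrightarrow> (\<Phi> \<^bold>\<and> \<Psi>) \<^bold>\<rightarrow> \<Phi> \<in> QBK_axioms \<sigma>"
| C2: "\<lbrakk>\<Phi> \<in> Form \<sigma>; \<Psi> \<in> Form \<sigma>\<rbrakk> \<Longrightarrow> (\<Phi> \<^bold>\<and> \<Psi>) \<^bold>\<rightarrow> \<Psi> \<in> QBK_axioms \<sigma>"
| C3: "\<lbrakk>\<Phi> \<in> Form \<sigma>; \<Psi> \<in> Form \<sigma>\<rbrakk> \<Longrightarrow> \<Phi> \<^bold>\<rightarrow> (\<Psi> \<^bold>\<rightarrow> (\<Phi> \<^bold>\<and> \<Psi>)) \<in> QBK_axioms \<sigma>"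
| D1: "\<lbrakk>\<Phi> \<in> Form \<sigma>; \<Psi> \<in> Form \<sigma>\<rbrakk> \<Longrightarrow> \<Phi> \<^bold>\<rightarrow> (\<Phi> \<^bold>\<or> \<Psi>) \<in> QBK_axioms \<sigma>"
| D2: "\<lbrakk>\<Phi> \<in> Form \<sigma>; \<Psi> \<in> Form \<sigma>\<rbrakk> \<Longrightarrow> \<Psi> \<^bold>\<rightarrow> (\<Phi> \<^bold>\<or> \<Psi>) \<in> QBK_axioms \<sigma>"
| D3: "\<lbrakk>\<Phi> \<in> Form \<sigma>; \<Psi> \<in> Form \<sigma>; \<Theta> \<in> Form \<sigma>\<rbrakk> \<Longrightarrow>
    (\<Phi> \<^bold>\<rightarrow> \<Theta>) \<^bold>\<rightarrow> ((\<Psi> \<^bold>\<rightarrow> \<Theta>) \<^bold>\<rightarrow> ((\<Phi> \<^bold>\<or> \<Psi>) \<^bold>\<rightarrow> \<Theta>)) \<in> QBK_axioms \<sigma>"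
| N1: "\<Phi> \<in> Form \<sigma> \<Longrightarrow> \<Phi> \<^bold>\<or> (\<Phi> \<^bold>\<rightarrow> \<^bold>\<bottom>) \<in> QBK_axioms \<sigma>"
| N2: "\<Phi> \<in> Form \<sigma> \<Longrightarrow> \<^bold>\<bottom> \<^bold>\<rightarrow> \<Phi> \<in> QBK_axioms \<sigma>"
| SN1: "\<Phi> \<in> Form \<sigma> \<Longrightarrow> \<^bold>\<sim> (\<^bold>\<sim> \<Phi>) \<^bold>\<leftrightarrow> \<Phi> \<in> QBK_axioms \<sigma>"
| SN2: "\<lbrakk>\<Phi> \<in> Form \<sigma>; \<Psi> \<in> Form \<sigma>\<rbrakk> \<Longrightarrow>
    \<^bold>\<sim> (\<Phi> \<^bold>\<rightarrow> \<Psi>) \<^bold>\<leftrightarrow> (\<Phi> \<^bold>\<and> \<^bold>\<sim> \<Psi>) \<in> QBK_axioms \<sigma>"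
| SN3: "\<lbrakk>\<Phi> \<in> Form \<sigma>; \<Psi> \<in> Form \<sigma>\<rbrakk> \<Longrightarrow>
    \<^bold>\<sim> (\<Phi> \<^bold>\<or> \<Psi>) \<^bold>\<leftrightarrow> (\<^bold>\<sim> \<Phi> \<^bold>\<and> \<^bold>\<sim> \<Psi>) \<in> QBK_axioms \<sigma>"
| SN4: "\<lbrakk>\<Phi> \<in> Form \<sigma>; \<Psi> \<in> Form \<sigma>\<rbrakk> \<Longrightarrow>
    \<^bold>\<sim> (\<Phi> \<^bold>\<and> \<Psi>) \<^bold>\<leftrightarrow> (\<^bold>\<sim> \<Phi> \<^bold>\<or> \<^bold>\<sim> \<Psi>) \<in> QBK_axioms \<sigma>"
| SN5: "\<^bold>\<sim> \<^bold>\<bottom> \<in> QBK_axioms \<sigma>"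
| M1: "\<lbrakk>\<Phi> \<in> Form \<sigma>; \<Psi> \<in> Form \<sigma>\<rbrakk> \<Longrightarrow>
    (\<^bold>\<box> \<Phi> \<^bold>\<and> \<^bold>\<box> \<Psi>) \<^bold>\<rightarrow> \<^bold>\<box> (\<Phi> \<^bold>\<and> \<Psi>) \<in> QBK_axioms \<sigma>"
| M2: "\<Phi> \<in> Form \<sigma> \<Longrightarrow> \<^bold>\<box> (\<Phi> \<^bold>\<rightarrow> \<Phi>) \<in> QBK_axioms \<sigma>"
| M3: "\<Phi> \<in> Form \<sigma> \<Longrightarrow> \<^bold>\<not> (\<^bold>\<box> \<Phi>) \<^bold>\<leftrightarrow> \<^bold>\<diamond> (\<^bold>\<not> \<Phi>) \<in> QBK_axioms \<sigma>"
| M4: "\<Phi> \<in> Form \<sigma> \<Longrightarrow> \<^bold>\<not> (\<^bold>\<diamond> \<Phi>) \<^bold>\<leftrightarrow> \<^bold>\<box> (\<^bold>\<not> \<Phi>) \<in> QBK_axioms \<sigma>"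
| M5: "\<Phi> \<in> Form \<sigma> \<Longrightarrow> \<^bold>\<box> \<Phi> \<^bold>\<Leftrightarrow> \<^bold>\<sim> (\<^bold>\<diamond> (\<^bold>\<sim> \<Phi>)) \<in> QBK_axioms \<sigma>"
| M6: "\<Phi> \<in> Form \<sigma> \<Longrightarrow> \<^bold>\<diamond> \<Phi> \<^bold>\<Leftrightarrow> \<^bold>\<sim> (\<^bold>\<box> (\<^bold>\<sim> \<Phi>)) \<in> QBK_axioms \<sigma>"
| Q1: "\<lbrakk>\<Phi> \<in> Form \<sigma>; is_term \<sigma> t; free_for t x \<Phi>\<rbrakk> \<Longrightarrow>
    Forall x \<Phi> \<^bold>\<rightarrow> subst \<Phi> x t \<in> QBK_axioms \<sigma>"
| Q2: "\<lbrakk>\<Phi> \<in> Form \<sigma>; is_term \<sigma> t; free_for t x \<Phi>\<rbrakk> \<Longrightarrow>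
    subst \<Phi> x t \<^bold>\<rightarrow> Exists x \<Phi> \<in> QBK_axioms \<sigma>"
| Q3: "\<Phi> \<in> Form \<sigma> \<Longrightarrow> \<^bold>\<sim> (Forall x \<Phi>) \<^bold>\<leftrightarrow> Exists x (\<^bold>\<sim> \<Phi>) \<in> QBK_axioms \<sigma>"
| Q4: "\<Phi> \<in> Form \<sigma> \<Longrightarrow> \<^bold>\<sim> (Exists x \<Phi>) \<^bold>\<leftrightarrow> Forall x (\<^bold>\<sim> \<Phi>) \<in> QBK_axioms \<sigma>"

inductive_set QBK :: "('p, 'c) signature \<Rightarrow> ('p, 'c) fm set" for \<sigma> where
  Ax: "\<Phi> \<in> QBK_axioms \<sigma> \<Longrightarrow> \<Phi> \<in> QBK \<sigma>"
| MP: "\<lbrakk>\<Phi> \<in> QBK \<sigma>; \<Phi> \<^bold>\<rightarrow> \<Psi> \<in> QBK \<sigma>\<rbrakk> \<Longrightarrow> \<Psi> \<in> QBK \<sigma>"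
| MB: "\<Phi> \<^bold>\<rightarrow> \<Psi> \<in> QBK \<sigma> \<Longrightarrow> \<^bold>\<box> \<Phi> \<^bold>\<rightarrow> \<^bold>\<box> \<Psi> \<in> QBK \<sigma>"
| MD: "\<Phi> \<^bold>\<rightarrow> \<Psi> \<in> QBK \<sigma> \<Longrightarrow> \<^bold>\<diamond> \<Phi> \<^bold>\<rightarrow> \<^bold>\<diamond> \<Psi> \<in> QBK \<sigma>"
| BR1: "\<lbrakk>\<Phi> \<^bold>\<rightarrow> \<Psi> \<in> QBK \<sigma>; x \<notin> fv \<Phi>\<rbrakk> \<Longrightarrow> \<Phi> \<^bold>\<rightarrow> Forall x \<Psi> \<in> QBK \<sigma>"
| BR2: "\<lbrakk>\<Phi> \<^bold>\<rightarrow> \<Psi> \<in> QBK \<sigma>; x \<notin> fv \<Psi>\<rbrakk> \<Longrightarrow> Exists x \<Phi> \<^bold>\<rightarrow> \<Psi> \<in> QBK \<sigma>"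

inductive_set QBKs :: "('p, 'c) signature \<Rightarrow> ('p, 'c) fm set" for \<sigma> where
  Base: "\<Phi> \<in> QBK \<sigma> \<Longrightarrow> \<Phi> \<in> QBKs \<sigma>"
| Barcan: "\<Phi> \<in> Form \<sigma> \<Longrightarrow> \<^bold>\<diamond> (Exists x \<Phi>) \<^bold>\<rightarrow> Exists x (\<^bold>\<diamond> \<Phi>) \<in> QBKs \<sigma>"
| MP: "\<lbrakk>\<Phi> \<in> QBKs \<sigma>; \<Phi> \<^bold>\<rightarrow> \<Psi> \<in> QBKs \<sigma>\<rbrakk> \<Longrightarrow> \<Psi> \<in> QBKs \<sigma>"
| MB: "\<Phi> \<^bold>\<rightarrow> \<Psi> \<in> QBKs \<sigma> \<Longrightarrow> \<^bold>\<box> \<Phi> \<^bold>\<rightarrow> \<^bold>\<box> \<Psi> \<in> QBKs \<sigma>"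
| MD: "\<Phi> \<^bold>\<rightarrow> \<Psi> \<in> QBKs \<sigma> \<Longrightarrow> \<^bold>\<diamond> \<Phi> \<^bold>\<rightarrow> \<^bold>\<diamond> \<Psi> \<in> QBKs \<sigma>"
| BR1: "\<lbrakk>\<Phi> \<^bold>\<rightarrow> \<Psi> \<in> QBKs \<sigma>; x \<notin> fv \<Phi>\<rbrakk> \<Longrightarrow> \<Phi> \<^bold>\<rightarrow> Forall x \<Psi> \<in> QBKs \<sigma>"
| BR2: "\<lbrakk>\<Phi> \<^bold>\<rightarrow> \<Psi> \<in> QBKs \<sigma>; x \<notin> fv \<Psi>\<rbrakk> \<Longrightarrow> Exists x \<Phi> \<^bold>\<rightarrow> \<Psi> \<in> QBKs \<sigma>"

inductive_set consequences ::
  "('p, 'c) signature \<Rightarrow> ('p, 'c) fm set \<Rightarrow> ('p, 'c) fm set" for \<sigma> \<Gamma> where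
  Prem: "\<Phi> \<in> \<Gamma> \<Longrightarrow> \<Phi> \<in> consequences \<sigma> \<Gamma>"
| Logic: "\<Phi> \<in> QBKs \<sigma> \<Longrightarrow> \<Phi> \<in> consequences \<sigma> \<Gamma>"
| MP: "\<lbrakk>\<Phi> \<in> consequences \<sigma> \<Gamma>; \<Phi> \<^bold>\<rightarrow> \<Psi> \<in> consequences \<sigma> \<Gamma>\<rbrakk> \<Longrightarrow> \<Psi> \<in> consequences \<sigma> \<Gamma>"
| BR1: "\<lbrakk>\<Phi> \<^bold>\<rightarrow> \<Psi> \<in> consequences \<sigma> \<Gamma>; x \<notin> fv \<Phi>\<rbrakk> \<Longrightarrow>
    \<Phi> \<^bold>\<rightarrow> Forall x \<Psi> \<in> consequences \<sigma> \<Gamma>"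
| BR2: "\<lbrakk>\<Phi> \<^bold>\<rightarrow> \<Psi> \<in> consequences \<sigma> \<Gamma>; x \<notin> fv \<Psi>\<rbrakk> \<Longrightarrow>
    Exists x \<Phi> \<^bold>\<rightarrow> \<Psi> \<in> consequences \<sigma> \<Gamma>"

text \<open>Iterated disjunctions associate to the left; the empty one is \<open>\<^bold>\<bottom>\<close>.\<close>

fun big_disj :: "('p, 'c) fm list \<Rightarrow> ('p, 'c) fm" where
  "big_disj [] = \<^bold>\<bottom>"
| "big_disj (\<Phi> # \<Phi>s) = foldl Disj \<Phi> \<Phi>s"

definition Disjs :: "('p, 'c) fm set \<Rightarrow> ('p, 'c) fm set" where
  "Disjs \<Delta> = {big_disj \<Phi>s | \<Phi>s. set \<Phi>s \<subseteq> \<Delta>}"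

definition derives ::
  "('p, 'c) signature \<Rightarrow> ('p, 'c) fm set \<Rightarrow> ('p, 'c) fm set \<Rightarrow> bool" where
  "derives \<sigma> \<Gamma> \<Delta> \<longleftrightarrow> (\<exists>\<Phi> \<in> Disjs \<Delta>. \<Phi> \<in> consequences \<sigma> \<Gamma>)"

subsection \<open>Semantics\<close>

record ('p, 'c, 'a) struct =
  univ :: "'a set"
  pred_int :: "'p \<Rightarrow> 'a list set"
  const_int :: "'c \<Rightarrow> 'a"

definition is_struct :: "('p, 'c) signature \<Rightarrow> ('p, 'c, 'a) struct \<Rightarrow> bool" where
  "is_struct \<sigma> \<AA> \<longleftrightarrow>
     univ \<AA> \<noteq> {} \<and>
     (\<forall>P \<in> preds \<sigma>. pred_int \<AA> P \<subseteq> {as. length as = arity \<sigma> P \<and> set as \<subseteq> univ \<AA>}) \<and>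
     (\<forall>c \<in> consts_of \<sigma>. const_int \<AA> c \<in> univ \<AA>)"

record ('w, 'p, 'c, 'a) model =
  worlds :: "'w set"
  acc :: "'w rel"
  pos :: "'w \<Rightarrow> ('p, 'c, 'a) struct"
  neg :: "'w \<Rightarrow> ('p, 'c, 'a) struct"

definition world_dom :: "('w, 'p, 'c, 'a) model \<Rightarrow> 'w \<Rightarrow> 'a set" where
  "world_dom \<M> w = univ (pos \<M> w)"

definition QBK_model :: "('p, 'c) signature \<Rightarrow> ('w, 'p, 'c, 'a) model \<Rightarrow> bool" where
  "QBK_model \<sigma> \<M> \<longleftrightarrow>
     worlds \<M> \<noteq> {} \<and> acc \<M> \<subseteq> worlds \<M> \<times> worlds \<M> \<and>
     (\<forall>w \<in> worlds \<M>.
        is_struct \<sigma> (pos \<M> w) \<and> is_struct \<sigma> (neg \<M> w) \<and>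
        univ (pos \<M> w) = univ (neg \<M> w) \<and>
        (\<forall>c \<in> consts_of \<sigma>. const_int (pos \<M> w) c = const_int (neg \<M> w) c)) \<and>
     (\<forall>(u, v) \<in> acc \<M>.
        world_dom \<M> u \<subseteq> world_dom \<M> v \<and>
        (\<forall>c \<in> consts_of \<sigma>. const_int (pos \<M> u) c = const_int (pos \<M> v) c))"

definition QBKs_model :: "('p, 'c) signature \<Rightarrow> ('w, 'p, 'c, 'a) model \<Rightarrow> bool" where
  "QBKs_model \<sigma> \<M> \<longleftrightarrow>
     QBK_model \<sigma> \<M> \<and> (\<forall>u \<in> worlds \<M>. \<forall>v \<in> worlds \<M>. world_dom \<M> u = world_dom \<M> v)"

text \<open>
  Constants of the expanded signature have type \<open>'c + 'a\<close>: \<open>Inl c\<close> is the original constant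
  \<open>c\<close>, and \<open>Inr a\<close> is the new constant naming the element \<open>a\<close>.
\<close>

definition expand :: "('p, 'c) signature \<Rightarrow> 'a set \<Rightarrow> ('p, 'c + 'a) signature" where
  "expand \<sigma> A = \<lparr>preds = preds \<sigma>, arity = arity \<sigma>, consts_of = Inl ` consts_of \<sigma> \<union> Inr ` A\<rparr>"

definition lift :: "('p, 'c) fm \<Rightarrow> ('p, 'c + 'a) fm" where
  "lift \<Phi> = map_fm id Inl \<Phi>"

text \<open>Only closed terms are ever evaluated; the value at a variable is irrelevant.\<close>

fun tm_val :: "('p, 'c, 'a) struct \<Rightarrow> ('c + 'a) tm \<Rightarrow> 'a" where
  "tm_val \<AA> (Const (Inl c)) = const_int \<AA> c"
| "tm_val \<AA> (Const (Inr a)) = a"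
| "tm_val \<AA> (Var x) = undefined"

fun rank :: "('p, 'c) fm \<Rightarrow> nat" where
  "rank (Atom P ts) = 0"
| "rank \<^bold>\<bottom> = 0"
| "rank (\<Phi> \<^bold>\<rightarrow> \<Psi>) = Suc (rank \<Phi> + rank \<Psi>)"
| "rank (\<Phi> \<^bold>\<and> \<Psi>) = Suc (rank \<Phi> + rank \<Psi>)"
| "rank (\<Phi> \<^bold>\<or> \<Psi>) = Suc (rank \<Phi> + rank \<Psi>)"
| "rank (\<^bold>\<sim> \<Phi>) = Suc (rank \<Phi>)"
| "rank (\<^bold>\<box> \<Phi>) = Suc (rank \<Phi>)"
| "rank (\<^bold>\<diamond> \<Phi>) = Suc (rank \<Phi>)"
| "rank (Forall x \<Phi>) = Suc (rank \<Phi>)"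
| "rank (Exists x \<Phi>) = Suc (rank \<Phi>)"

lemma rank_msubst [simp]: "rank (msubst \<theta> \<Phi>) = rank \<Phi>"
  by (induction \<Phi> arbitrary: \<theta>) auto

lemma rank_subst [simp]: "rank (subst \<Phi> x t) = rank \<Phi>"
  by (simp add: subst_def)

function verifies :: "('w, 'p, 'c, 'a) model \<Rightarrow> 'w \<Rightarrow> ('p, 'c + 'a) fm \<Rightarrow> bool"
  and falsifies :: "('w, 'p, 'c, 'a) model \<Rightarrow> 'w \<Rightarrow> ('p, 'c + 'a) fm \<Rightarrow> bool" where
  "verifies \<M> w (Atom P ts) \<longleftrightarrow> map (tm_val (pos \<M> w)) ts \<in> pred_int (pos \<M> w) P"
| "verifies \<M> w \<^bold>\<bottom> \<longleftrightarrow> False"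
| "verifies \<M> w (\<Phi> \<^bold>\<rightarrow> \<Psi>) \<longleftrightarrow> \<not> verifies \<M> w \<Phi> \<or> verifies \<M> w \<Psi>"
| "verifies \<M> w (\<Phi> \<^bold>\<and> \<Psi>) \<longleftrightarrow> verifies \<M> w \<Phi> \<and> verifies \<M> w \<Psi>"
| "verifies \<M> w (\<Phi> \<^bold>\<or> \<Psi>) \<longleftrightarrow> verifies \<M> w \<Phi> \<or> verifies \<M> w \<Psi>"
| "verifies \<M> w (\<^bold>\<sim> \<Phi>) \<longleftrightarrow> falsifies \<M> w \<Phi>"
| "verifies \<M> w (\<^bold>\<box> \<Phi>) \<longleftrightarrow> (\<forall>u. (w, u) \<in> acc \<M> \<longrightarrow> verifies \<M> u \<Phi>)"
| "verifies \<M> w (\<^bold>\<diamond> \<Phi>) \<longleftrightarrow> (\<exists>u. (w, u) \<in> acc \<M> \<and> verifies \<M> u \<Phi>)"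
| "verifies \<M> w (Forall x \<Phi>) \<longleftrightarrow>
     (\<forall>a \<in> world_dom \<M> w. verifies \<M> w (subst \<Phi> x (Const (Inr a))))"
| "verifies \<M> w (Exists x \<Phi>) \<longleftrightarrow>
     (\<exists>a \<in> world_dom \<M> w. verifies \<M> w (subst \<Phi> x (Const (Inr a))))"
| "falsifies \<M> w (Atom P ts) \<longleftrightarrow> map (tm_val (neg \<M> w)) ts \<in> pred_int (neg \<M> w) P"
| "falsifies \<M> w \<^bold>\<bottom> \<longleftrightarrow> True"
| "falsifies \<M> w (\<Phi> \<^bold>\<rightarrow> \<Psi>) \<longleftrightarrow> verifies \<M> w \<Phi> \<and> falsifies \<M> w \<Psi>"
| "falsifies \<M> w (\<Phi> \<^bold>\<and> \<Psi>) \<longleftrightarrow> falsifies \<M> w \<Phi> \<or> falsifies \<M> w \<Psi>"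
| "falsifies \<M> w (\<Phi> \<^bold>\<or> \<Psi>) \<longleftrightarrow> falsifies \<M> w \<Phi> \<and> falsifies \<M> w \<Psi>"
| "falsifies \<M> w (\<^bold>\<sim> \<Phi>) \<longleftrightarrow> verifies \<M> w \<Phi>"
| "falsifies \<M> w (\<^bold>\<box> \<Phi>) \<longleftrightarrow> (\<exists>u. (w, u) \<in> acc \<M> \<and> falsifies \<M> u \<Phi>)"
| "falsifies \<M> w (\<^bold>\<diamond> \<Phi>) \<longleftrightarrow> (\<forall>u. (w, u) \<in> acc \<M> \<longrightarrow> falsifies \<M> u \<Phi>)"
| "falsifies \<M> w (Forall x \<Phi>) \<longleftrightarrow>
     (\<exists>a \<in> world_dom \<M> w. falsifies \<M> w (subst \<Phi> x (Const (Inr a))))"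
| "falsifies \<M> w (Exists x \<Phi>) \<longleftrightarrow>
     (\<forall>a \<in> world_dom \<M> w. falsifies \<M> w (subst \<Phi> x (Const (Inr a))))"
  by pat_completeness auto
termination
  by (relation "measure (\<lambda>z. case z of Inl (\<M>, w, \<Phi>) \<Rightarrow> rank \<Phi> | Inr (\<M>, w, \<Phi>) \<Rightarrow> rank \<Phi>)") auto

definition ground_subst :: "('p, 'c) signature \<Rightarrow> 'a set \<Rightarrow> (var \<Rightarrow> 'c + 'a) \<Rightarrow> bool" where
  "ground_subst \<sigma> A \<rho> \<longleftrightarrow> (\<forall>x. \<rho> x \<in> consts_of (expand \<sigma> A))"

text \<open>
  A proposition cannot quantify over types, so consequence is relative to a type \<open>'w\<close> from
  which worlds are drawn and a type \<open>'a\<close> from which individuals are drawn. Worlds and domains are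
  arbitrary subsets of these types, so a model over smaller types has an isomorphic copy over
  larger ones.
\<close>

definition entails ::
  "'w itself \<Rightarrow> 'a itself \<Rightarrow> ('p, 'c) signature \<Rightarrow> ('p, 'c) fm set \<Rightarrow> ('p, 'c) fm set \<Rightarrow> bool" where
  "entails _ _ \<sigma> \<Gamma> \<Delta> \<longleftrightarrow>
     (\<forall>(\<M> :: ('w, 'p, 'c, 'a) model) w \<rho>.
        QBKs_model \<sigma> \<M> \<longrightarrow> w \<in> worlds \<M> \<longrightarrow> ground_subst \<sigma> (world_dom \<M> w) \<rho> \<longrightarrow>
        (\<forall>\<Phi> \<in> \<Gamma>. verifies \<M> w (lift \<Phi>)) \<longrightarrow>
        (\<exists>\<Psi> \<in> \<Delta>. verifies \<M> w (msubst (Const \<circ> \<rho>) (lift \<Psi>))))"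

end

theory Submission
  imports Defs
begin

text \<open>
  Apart from \<open>\<^bold>\<sim>\<close>, which the axioms drive down to the atoms, the calculus is classical quantified K
  with the Barcan scheme, so a canonical model of saturated complete theories over one fixed set of
  constants works. To stay inside arbitrary infinite types of worlds and individuals, only a
  countable tree of theories is used. A theory is built along an enumeration of the sentences,
  accepting a sentence as long as its conjunction with those already accepted is admissible. For the
  root, admissible means that no disjunction of members of \<open>\<Delta>\<close> becomes derivable; witnesses are fresh
  constants, which can be replaced by fresh variables in a derivation. For a successor of \<open>w\<close>,
  \<open>\<Phi>\<close> is admissible if \<open>\<^bold>\<diamond> \<Phi> \<in> w\<close>; here a witness for \<open>Exists x \<Phi>\<close> exists because the Barcan scheme
  turns \<open>\<^bold>\<diamond> (Exists x \<Phi>) \<in> w\<close> into \<open>Exists x (\<^bold>\<diamond> \<Phi>) \<in> w\<close> and \<open>w\<close> is saturated.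
\<close>

subsection \<open>Derivability of tautologies\<close>

text \<open>All worlds of a model share one domain, so a successor world cannot bring new constants
  for its own witnesses, as a Henkin construction with growing languages would do; hence the
  constants are fixed beforehand and a witness is chosen at the moment an existential sentence is
  accepted. In \<open>consequences\<close> the rules \<open>BR1\<close> and \<open>BR2\<close> act
  on formulas derived from premises, so the deduction theorem would fail for open premises; the
  construction is therefore stated with implications from a single sentence. The members of \<Delta>
  may together use every variable, so no variable need be fresh for \<Delta>; naming all free
  variables by new constants at the start leaves only sentences to decide. An atom and its strong
  negation are read off two unrelated relations, so a theory may contain both or neither, and the
  truth lemma treats verification and falsification together. For soundness, the official semantics
  evaluates sentences over a signature that depends on the model, while derivations pass through
  open formulas; a semantics with environments connects the two.\<close>

fun tv :: "(('p, 'c) fm \<Rightarrow> bool) \<Rightarrow> ('p, 'c) fm \<Rightarrow> bool" where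
  "tv v \<^bold>\<bottom> \<longleftrightarrow> False"
| "tv v (\<Phi> \<^bold>\<rightarrow> \<Psi>) \<longleftrightarrow> (tv v \<Phi> \<longrightarrow> tv v \<Psi>)"
| "tv v (\<Phi> \<^bold>\<and> \<Psi>) \<longleftrightarrow> tv v \<Phi> \<and> tv v \<Psi>"
| "tv v (\<Phi> \<^bold>\<or> \<Psi>) \<longleftrightarrow> tv v \<Phi> \<or> tv v \<Psi>"
| "tv v \<Phi> \<longleftrightarrow> v \<Phi>"

text \<open>The propositional atoms of \<open>tv\<close>: a formula headed by \<open>SNeg\<close>, a
  modality or a quantifier is opaque, just like an atomic one.\<close>

fun primes :: "('p, 'c) fm \<Rightarrow> ('p, 'c) fm set" where
  "primes \<^bold>\<bottom> = {}"
| "primes (\<Phi> \<^bold>\<rightarrow> \<Psi>) = primes \<Phi> \<union> primes \<Psi>"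
| "primes (\<Phi> \<^bold>\<and> \<Psi>) = primes \<Phi> \<union> primes \<Psi>"
| "primes (\<Phi> \<^bold>\<or> \<Psi>) = primes \<Phi> \<union> primes \<Psi>"
| "primes \<Phi> = {\<Phi>}"

lemma finite_primes: "finite (primes \<Phi>)"
  by (induction \<Phi>) auto

lemma primes_Form: "\<Phi> \<in> Form \<sigma> \<Longrightarrow> primes \<Phi> \<subseteq> Form \<sigma>"
  by (induction \<Phi>) (auto simp: Form_def)

text \<open>The signed formulas of Kalmar's completeness proof.\<close>

definition literal :: "(('p, 'c) fm \<Rightarrow> bool) \<Rightarrow> ('p, 'c) fm \<Rightarrow> ('p, 'c) fm" where
  "literal v \<Phi> = (if tv v \<Phi> then \<Phi> else \<^bold>\<not> \<Phi>)"

lemma Form_simps [simp]: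
  "\<^bold>\<bottom> \<in> Form \<sigma>"
  "\<Phi> \<^bold>\<rightarrow> \<Psi> \<in> Form \<sigma> \<longleftrightarrow> \<Phi> \<in> Form \<sigma> \<and> \<Psi> \<in> Form \<sigma>"
  "\<Phi> \<^bold>\<and> \<Psi> \<in> Form \<sigma> \<longleftrightarrow> \<Phi> \<in> Form \<sigma> \<and> \<Psi> \<in> Form \<sigma>"
  "\<Phi> \<^bold>\<or> \<Psi> \<in> Form \<sigma> \<longleftrightarrow> \<Phi> \<in> Form \<sigma> \<and> \<Psi> \<in> Form \<sigma>"
  "\<^bold>\<sim> \<Phi> \<in> Form \<sigma> \<longleftrightarrow> \<Phi> \<in> Form \<sigma>"
  "\<^bold>\<box> \<Phi> \<in> Form \<sigma> \<longleftrightarrow> \<Phi> \<in> Form \<sigma>"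
  "\<^bold>\<diamond> \<Phi> \<in> Form \<sigma> \<longleftrightarrow> \<Phi> \<in> Form \<sigma>"
  "Forall x \<Phi> \<in> Form \<sigma> \<longleftrightarrow> \<Phi> \<in> Form \<sigma>"
  "Exists x \<Phi> \<in> Form \<sigma> \<longleftrightarrow> \<Phi> \<in> Form \<sigma>"
  by (auto simp: Form_def)

section \<open>Propositional derivations from hypotheses\<close>

text \<open>Modus ponens is the only rule here, whatever rules produced \<open>L\<close>. As no
  quantifier rule acts on the hypotheses \<open>X\<close>, the deduction theorem holds even for open
  ones.\<close>

inductive_set mp_closure :: "('p, 'c) fm set \<Rightarrow> ('p, 'c) fm set \<Rightarrow> ('p, 'c) fm set" for L X where
  Base: "\<Phi> \<in> L \<Longrightarrow> \<Phi> \<in> mp_closure L X"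
| Hyp: "\<Phi> \<in> X \<Longrightarrow> \<Phi> \<in> mp_closure L X"
| MP: "\<lbrakk>\<Phi> \<in> mp_closure L X; \<Phi> \<^bold>\<rightarrow> \<Psi> \<in> mp_closure L X\<rbrakk> \<Longrightarrow> \<Psi> \<in> mp_closure L X"

text \<open>Shared by \<open>QBKs \<sigma>\<close> and
  \<open>consequences \<sigma> \<Gamma>\<close>, so that propositional reasoning is developed once
  for theorems and for derivations from premises.\<close>

locale logic =
  fixes \<sigma> :: "('p, 'c) signature" and L :: "('p, 'c) fm set"
  assumes axioms: "QBK_axioms \<sigma> \<subseteq> L" and formulas: "L \<subseteq> Form \<sigma>"
    and mp: "\<Phi> \<in> L \<Longrightarrow> \<Phi> \<^bold>\<rightarrow> \<Psi> \<in> L \<Longrightarrow> \<Psi> \<in> L"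
begin

lemmas mpc_axiom = mp_closure.Base[OF axioms[THEN subsetD]]

lemma mp_closure_Form: "X \<subseteq> Form \<sigma> \<Longrightarrow> \<Phi> \<in> mp_closure L X \<Longrightarrow> \<Phi> \<in> Form \<sigma>"
  by (erule mp_closure.induct) (use formulas in auto)

lemma mp_closure_empty: "\<Phi> \<in> mp_closure L {} \<Longrightarrow> \<Phi> \<in> L"
  by (erule mp_closure.induct) (auto intro: mp)

lemma mp_closure_I1:
  assumes "\<Phi> \<in> mp_closure L X" "\<Phi> \<in> Form \<sigma>" "\<Psi> \<in> Form \<sigma>"
  shows "\<Psi> \<^bold>\<rightarrow> \<Phi> \<in> mp_closure L X"
  using assms by (meson QBK_axioms.I1 mp_closure.MP mpc_axiom)

lemma mp_closure_deduction:
  assumes "\<Phi> \<in> mp_closure L (insert \<Theta> X)" and X: "insert \<Theta> X \<subseteq> Form \<sigma>"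
  shows "\<Theta> \<^bold>\<rightarrow> \<Phi> \<in> mp_closure L X"
  using assms(1)
proof (induction rule: mp_closure.induct)
  case (Base \<Phi>)
  then show ?case using X formulas by (intro mp_closure_I1 mp_closure.Base) auto
next
  case (Hyp \<Phi>)
  then consider "\<Phi> = \<Theta>" | "\<Phi> \<in> X" by auto
  then show ?case
  proof cases
    case 1
    have T: "\<Theta> \<in> Form \<sigma>" using X by auto
    have "\<Theta> \<^bold>\<rightarrow> (\<Theta> \<^bold>\<rightarrow> \<Theta>) \<^bold>\<rightarrow> \<Theta> \<in> mp_closure L X" "\<Theta> \<^bold>\<rightarrow> (\<Theta> \<^bold>\<rightarrow> \<Theta>) \<in> mp_closure L X"
      using T by (auto intro!: mpc_axiom QBK_axioms.I1)
    moreover have "(\<Theta> \<^bold>\<rightarrow> (\<Theta> \<^bold>\<rightarrow> \<Theta>) \<^bold>\<rightarrow> \<Theta>) \<^bold>\<rightarrow> (\<Theta> \<^bold>\<rightarrow> (\<Theta> \<^bold>\<rightarrow> \<Theta>)) \<^bold>\<rightarrow> \<Theta> \<^bold>\<rightarrow> \<Theta> \<in> mp_closure L X"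
      using T by (intro mpc_axiom QBK_axioms.I2) auto
    ultimately show ?thesis using 1 mp_closure.MP by metis
  next
    case 2
    then show ?thesis using X by (intro mp_closure_I1 mp_closure.Hyp) auto
  qed
next
  case (MP \<Phi> \<Psi>)
  have "\<Phi> \<in> Form \<sigma>" "\<Phi> \<^bold>\<rightarrow> \<Psi> \<in> Form \<sigma>"
    using MP.hyps by (blast intro: mp_closure_Form[OF X])+
  then have "(\<Theta> \<^bold>\<rightarrow> (\<Phi> \<^bold>\<rightarrow> \<Psi>)) \<^bold>\<rightarrow> ((\<Theta> \<^bold>\<rightarrow> \<Phi>) \<^bold>\<rightarrow> (\<Theta> \<^bold>\<rightarrow> \<Psi>)) \<in> mp_closure L X"
    using X by (intro mpc_axiom QBK_axioms.I2) auto
  then show ?case using MP.IH mp_closure.MP by metis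
qed

lemma mp_closure_insert:
  assumes "\<Phi> \<in> mp_closure L X" shows "\<Phi> \<in> mp_closure L (insert \<Theta> X)"
  using assms by induction (auto intro: mp_closure.intros)

text \<open>\<open>D3\<close> applied to the excluded middle \<open>N1\<close>. This is how literals
  are discharged in \<open>tautology\<close>.\<close>

lemma mp_closure_cases:
  assumes "\<Phi> \<in> mp_closure L (insert \<Theta> X)" "\<Phi> \<in> mp_closure L (insert (\<^bold>\<not> \<Theta>) X)"
    and X: "insert \<Theta> X \<subseteq> Form \<sigma>" "\<Phi> \<in> Form \<sigma>"
  shows "\<Phi> \<in> mp_closure L X"
proof -
  have "\<Theta> \<^bold>\<rightarrow> \<Phi> \<in> mp_closure L X" "\<^bold>\<not> \<Theta> \<^bold>\<rightarrow> \<Phi> \<in> mp_closure L X"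
    using assms by (auto intro: mp_closure_deduction)
  moreover have "(\<Theta> \<^bold>\<rightarrow> \<Phi>) \<^bold>\<rightarrow> ((\<^bold>\<not> \<Theta> \<^bold>\<rightarrow> \<Phi>) \<^bold>\<rightarrow> ((\<Theta> \<^bold>\<or> \<^bold>\<not> \<Theta>) \<^bold>\<rightarrow> \<Phi>)) \<in> mp_closure L X"
    using X by (intro mpc_axiom QBK_axioms.D3) auto
  moreover have "\<Theta> \<^bold>\<or> \<^bold>\<not> \<Theta> \<in> mp_closure L X"
    using X by (intro mpc_axiom QBK_axioms.N1) auto
  ultimately show ?thesis using mp_closure.MP by metis
qed

lemma mp_closure_exfalso:
  assumes "\<Theta> \<in> mp_closure L X" "\<^bold>\<not> \<Theta> \<in> mp_closure L X" "\<Phi> \<in> Form \<sigma>"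
  shows "\<Phi> \<in> mp_closure L X"
  using assms by (meson QBK_axioms.N2 mp_closure.MP mpc_axiom)

text \<open>Kalmar's lemma, by checking the rows of the truth tables; rows that call for a
  hypothetical derivation use the deduction theorem for \<open>mp_closure\<close>.\<close>

lemma mp_closure_literal:
  assumes "\<Phi> \<in> Form \<sigma>" and X: "literal v ` primes \<Phi> \<subseteq> X" "X \<subseteq> Form \<sigma>"
  shows "literal v \<Phi> \<in> mp_closure L X"
  using assms(1,2)
proof (induction \<Phi>)
  case Falsum
  have "\<^bold>\<bottom> \<^bold>\<rightarrow> \<^bold>\<bottom> \<in> mp_closure L X" by (intro mpc_axiom QBK_axioms.N2) simp
  then show ?case by (simp add: literal_def)
next
  case (Imp \<Phi> \<Psi>)
  then have F: "\<Phi> \<in> Form \<sigma>" "\<Psi> \<in> Form \<sigma>" and IH: "literal v \<Phi> \<in> mp_closure L X" "literal v \<Psi> \<in> mp_closure L X"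
    by auto
  consider "tv v \<Psi>" | "\<not> tv v \<Phi>" | "tv v \<Phi>" "\<not> tv v \<Psi>" by blast
  then show ?case
  proof cases
    case 1
    then show ?thesis using IH F by (auto simp: literal_def intro: mp_closure_I1)
  next
    case 2
    have "\<^bold>\<not> \<Phi> \<in> mp_closure L X" using IH 2 by (simp add: literal_def)
    from mp_closure_exfalso[OF mp_closure.Hyp[OF insertI1] mp_closure_insert[OF this]]
    have "\<Psi> \<in> mp_closure L (insert \<Phi> X)" using F by blast
    then have "\<Phi> \<^bold>\<rightarrow> \<Psi> \<in> mp_closure L X" using X F by (auto intro: mp_closure_deduction)
    then show ?thesis using 2 by (auto simp: literal_def)
  next
    case 3
    let ?Y = "insert (\<Phi> \<^bold>\<rightarrow> \<Psi>) X"
    have "\<Phi> \<in> mp_closure L ?Y" "\<^bold>\<not> \<Psi> \<in> mp_closure L ?Y"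
      using IH 3 by (auto simp: literal_def intro: mp_closure_insert)
    then have "\<^bold>\<bottom> \<in> mp_closure L ?Y" by (meson insertI1 mp_closure.Hyp mp_closure.MP)
    then have "\<^bold>\<not> (\<Phi> \<^bold>\<rightarrow> \<Psi>) \<in> mp_closure L X" using X F by (auto intro: mp_closure_deduction)
    then show ?thesis using 3 by (auto simp: literal_def)
  qed
next
  case (Conj \<Phi> \<Psi>)
  then have F: "\<Phi> \<in> Form \<sigma>" "\<Psi> \<in> Form \<sigma>" and IH: "literal v \<Phi> \<in> mp_closure L X" "literal v \<Psi> \<in> mp_closure L X"
    by auto
  let ?Y = "insert (\<Phi> \<^bold>\<and> \<Psi>) X"
  have Y: "\<Phi> \<in> mp_closure L ?Y" "\<Psi> \<in> mp_closure L ?Y"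
    using F by (meson insertI1 mp_closure.Hyp mp_closure.MP mpc_axiom QBK_axioms.C1 QBK_axioms.C2)+
  consider "tv v \<Phi>" "tv v \<Psi>" | "\<not> tv v \<Phi>" | "\<not> tv v \<Psi>" by blast
  then show ?case
  proof cases
    case 1
    then have "\<Phi> \<^bold>\<and> \<Psi> \<in> mp_closure L X" using IH F
      by (auto simp: literal_def) (meson mp_closure.MP mpc_axiom QBK_axioms.C3)
    then show ?thesis using 1 by (auto simp: literal_def)
  next
    case 2
    then have "\<^bold>\<not> \<Phi> \<in> mp_closure L X" using IH by (simp add: literal_def)
    then have "\<^bold>\<bottom> \<in> mp_closure L ?Y"
      using Y mp_closure_exfalso[OF _ mp_closure_insert] Form_simps(1) by blast
    then have "\<^bold>\<not> (\<Phi> \<^bold>\<and> \<Psi>) \<in> mp_closure L X" using X F by (auto intro: mp_closure_deduction)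
    then show ?thesis using 2 by (auto simp: literal_def)
  next
    case 3
    then have "\<^bold>\<not> \<Psi> \<in> mp_closure L X" using IH by (simp add: literal_def)
    then have "\<^bold>\<bottom> \<in> mp_closure L ?Y"
      using Y mp_closure_exfalso[OF _ mp_closure_insert] Form_simps(1) by blast
    then have "\<^bold>\<not> (\<Phi> \<^bold>\<and> \<Psi>) \<in> mp_closure L X" using X F by (auto intro: mp_closure_deduction)
    then show ?thesis using 3 by (auto simp: literal_def)
  qed
next
  case (Disj \<Phi> \<Psi>)
  then have F: "\<Phi> \<in> Form \<sigma>" "\<Psi> \<in> Form \<sigma>" and IH: "literal v \<Phi> \<in> mp_closure L X" "literal v \<Psi> \<in> mp_closure L X"
    by auto
  consider "tv v \<Phi>" | "tv v \<Psi>" | "\<not> tv v \<Phi>" "\<not> tv v \<Psi>" by blast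
  then show ?case
  proof cases
    case 1
    then have "\<Phi> \<^bold>\<or> \<Psi> \<in> mp_closure L X" using IH F
      by (auto simp: literal_def) (meson mp_closure.MP mpc_axiom QBK_axioms.D1)+
    then show ?thesis using 1 by (auto simp: literal_def)
  next
    case 2
    then have "\<Phi> \<^bold>\<or> \<Psi> \<in> mp_closure L X" using IH F
      by (auto simp: literal_def) (meson mp_closure.MP mpc_axiom QBK_axioms.D2)+
    then show ?thesis using 2 by (auto simp: literal_def)
  next
    case 3
    then have "\<^bold>\<not> \<Phi> \<in> mp_closure L X" "\<^bold>\<not> \<Psi> \<in> mp_closure L X" using IH by (auto simp: literal_def)
    moreover have "\<^bold>\<not> \<Phi> \<^bold>\<rightarrow> \<^bold>\<not> \<Psi> \<^bold>\<rightarrow> \<^bold>\<not> (\<Phi> \<^bold>\<or> \<Psi>) \<in> mp_closure L X"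
      using F by (intro mpc_axiom QBK_axioms.D3) auto
    ultimately show ?thesis using 3 by (simp add: literal_def) (meson mp_closure.MP)
  qed
qed (auto intro: mp_closure.Hyp)

theorem tautology:
  assumes "\<Phi> \<in> Form \<sigma>" "\<And>v. tv v \<Phi>"
  shows "\<Phi> \<in> L"
proof -
  \<comment> \<open>\<open>Q\<close> holds the primes whose literals are already discharged. The
    claim is for all \<open>v\<close> at once, because the induction step combines two valuations
    that differ in one prime. At \<open>Q = primes \<Phi>\<close> no hypothesis is left.\<close>
  have "finite Q \<Longrightarrow> Q \<subseteq> primes \<Phi> \<Longrightarrow> (\<And>v. \<Phi> \<in> mp_closure L (literal v ` (primes \<Phi> - Q)))" for Q
  proof (induction Q rule: finite_induct)
    case empty
    have "literal v ` primes \<Phi> \<subseteq> Form \<sigma>"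
      using primes_Form[OF assms(1)] by (auto simp: literal_def)
    then have "literal v \<Phi> \<in> mp_closure L (literal v ` primes \<Phi>)"
      using assms(1) by (intro mp_closure_literal) auto
    then show ?case using assms(2) by (simp add: literal_def)
  next
    case (insert \<Theta> Q)
    have prime: "tv u \<Theta>' = u \<Theta>'" if "\<Theta>' \<in> primes \<Phi>" for \<Theta>' u
      using that by (induction \<Phi>) auto
    let ?X = "literal v ` (primes \<Phi> - insert \<Theta> Q)"
    \<comment> \<open>Changing \<open>v\<close> at \<Theta> affects no other literal, since
      \<open>tv\<close> agrees with the valuation on primes.\<close>
    have eq: "literal (v(\<Theta> := b)) ` (primes \<Phi> - Q) = insert (if b then \<Theta> else \<^bold>\<not> \<Theta>) ?X" for b
    proof -
      have "primes \<Phi> - Q = insert \<Theta> (primes \<Phi> - insert \<Theta> Q)" using insert by auto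
      moreover have "literal (v(\<Theta> := b)) ` (primes \<Phi> - insert \<Theta> Q) = ?X"
        by (rule image_cong) (auto simp: literal_def prime)
      ultimately show ?thesis using insert.prems by (auto simp: literal_def prime)
    qed
    have "?X \<subseteq> Form \<sigma>" "\<Theta> \<in> Form \<sigma>"
      using primes_Form[OF assms(1)] insert.prems by (auto simp: literal_def)
    moreover have "\<Phi> \<in> mp_closure L (insert \<Theta> ?X)" "\<Phi> \<in> mp_closure L (insert (\<^bold>\<not> \<Theta>) ?X)"
      using insert.IH[of "v(\<Theta> := True)"] insert.IH[of "v(\<Theta> := False)"] insert.prems
      unfolding eq by simp_all
    ultimately show ?case
      using mp_closure_cases assms(1) by blast
  qed
  from this[OF finite_primes subset_refl] show ?thesis
    by (simp add: mp_closure_empty)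
qed

text \<open>Each premise is moved into the antecedent and later detached by \<open>mp\<close>; what
  remains is a tautology.\<close>

lemma tautological_consequence:
  assumes "set \<Theta>s \<subseteq> L" "\<Phi> \<in> Form \<sigma>" "\<And>v. (\<forall>\<Theta> \<in> set \<Theta>s. tv v \<Theta>) \<Longrightarrow> tv v \<Phi>"
  shows "\<Phi> \<in> L"
  using assms
proof (induction \<Theta>s arbitrary: \<Phi>)
  case Nil
  then show ?case by (auto intro: tautology)
next
  case (Cons \<Theta> \<Theta>s)
  then have "\<Theta> \<^bold>\<rightarrow> \<Phi> \<in> L"
    using formulas by (intro Cons.IH) auto
  then show ?case using Cons.prems(1) mp[of \<Theta> \<Phi>] by simp
qed

end

subsection \<open>Substitution and the calculus\<close>

lemma msubst_cong: "(\<And>x. x \<in> fv \<Phi> \<Longrightarrow> \<theta> x = \<theta>' x) \<Longrightarrow> msubst \<theta> \<Phi> = msubst \<theta>' \<Phi>"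
proof (induction \<Phi> arbitrary: \<theta> \<theta>')
  case (Atom P ts)
  have "subst_tm \<theta> t = subst_tm \<theta>' t" if "t \<in> set ts" for t
    using Atom[of "case t of Var x \<Rightarrow> x"] that by (cases t) force+
  then show ?case by simp
next
  case (Imp \<Phi> \<Psi>)
  then show ?case by (metis UnCI fv.simps(3) msubst.simps(3))
next
  case (Conj \<Phi> \<Psi>)
  then show ?case by (metis UnCI fv.simps(4) msubst.simps(4))
next
  case (Disj \<Phi> \<Psi>)
  then show ?case by (metis UnCI fv.simps(5) msubst.simps(5))
next
  case (Forall x \<Phi>)
  have "msubst (\<theta>(x := Var x)) \<Phi> = msubst (\<theta>'(x := Var x)) \<Phi>"
    by (rule Forall.IH) (use Forall.prems in auto)
  then show ?case by simp
next
  case (Exists x \<Phi>)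
  have "msubst (\<theta>(x := Var x)) \<Phi> = msubst (\<theta>'(x := Var x)) \<Phi>"
    by (rule Exists.IH) (use Exists.prems in auto)
  then show ?case by simp
next
  case (SNeg \<Phi>)
  then show ?case by (metis fv.simps(6) msubst.simps(6))
next
  case (Box \<Phi>)
  then show ?case by (metis fv.simps(7) msubst.simps(7))
next
  case (Dia \<Phi>)
  then show ?case by (metis fv.simps(8) msubst.simps(8))
qed simp

lemma subst_tm_Var [simp]: "subst_tm Var t = t"
  by (cases t) auto

lemma msubst_Var [simp]: "msubst Var \<Phi> = \<Phi>"
  by (induction \<Phi>) (auto simp: map_idI)

lemma finite_fv_tm [simp]: "finite (fv_tm t)"
  by (cases t) auto

lemma fv_tm_map_tm [simp]: "fv_tm (map_tm f t) = fv_tm t"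
  by (cases t) auto

lemma msubst_closed: "fv \<Phi> = {} \<Longrightarrow> msubst \<theta> \<Phi> = \<Phi>"
  using msubst_cong[of \<Phi> \<theta> Var] by simp

lemma subst_notin_fv: "x \<notin> fv \<Phi> \<Longrightarrow> subst \<Phi> x t = \<Phi>"
  unfolding subst_def by (subst msubst_cong[of \<Phi> _ Var]) auto

lemma subst_simps [simp]:
  "subst (Atom P ts) x t = Atom P (map (subst_tm (Var(x := t))) ts)"
  "subst \<^bold>\<bottom> x t = \<^bold>\<bottom>"
  "subst (\<Phi> \<^bold>\<rightarrow> \<Psi>) x t = subst \<Phi> x t \<^bold>\<rightarrow> subst \<Psi> x t"
  "subst (\<Phi> \<^bold>\<and> \<Psi>) x t = subst \<Phi> x t \<^bold>\<and> subst \<Psi> x t"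
  "subst (\<Phi> \<^bold>\<or> \<Psi>) x t = subst \<Phi> x t \<^bold>\<or> subst \<Psi> x t"
  "subst (\<^bold>\<sim> \<Phi>) x t = \<^bold>\<sim> subst \<Phi> x t"
  "subst (\<^bold>\<box> \<Phi>) x t = \<^bold>\<box> subst \<Phi> x t"
  "subst (\<^bold>\<diamond> \<Phi>) x t = \<^bold>\<diamond> subst \<Phi> x t"
  "subst (Forall y \<Phi>) x t = Forall y (if x = y then \<Phi> else subst \<Phi> x t)"
  "subst (Exists y \<Phi>) x t = Exists y (if x = y then \<Phi> else subst \<Phi> x t)"
  by (auto simp: subst_def intro!: msubst_cong)

lemma is_form_msubst: "is_form \<sigma> \<Phi> \<Longrightarrow> (\<And>x. is_term \<sigma> (\<theta> x)) \<Longrightarrow> is_form \<sigma> (msubst \<theta> \<Phi>)"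
proof (induction \<Phi> arbitrary: \<theta>)
  case (Atom P ts)
  have "is_term \<sigma> (subst_tm \<theta> t)" if "t \<in> set ts" for t
    using Atom that by (cases t) auto
  then show ?case using Atom by auto
qed auto

lemma subst_Form: "\<Phi> \<in> Form \<sigma> \<Longrightarrow> is_term \<sigma> t \<Longrightarrow> subst \<Phi> x t \<in> Form \<sigma>"
  by (auto simp: Form_def subst_def intro!: is_form_msubst)

lemma finite_fv: "finite (fv \<Phi>)"
  by (induction \<Phi>) auto

lemma free_for_Const [simp]: "free_for (Const c) x \<Phi>"
  by (induction \<Phi>) auto

lemma free_for_self [simp]: "free_for (Var x) x \<Phi>"
  by (induction \<Phi>) auto

lemma subst_self [simp]: "subst \<Phi> x (Var x) = \<Phi>"
  by (simp add: subst_def)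

lemma axioms_Form: "\<Phi> \<in> QBK_axioms \<sigma> \<Longrightarrow> \<Phi> \<in> Form \<sigma>"
  by (induction rule: QBK_axioms.induct) (auto simp: subst_Form)

text \<open>The two calculi have the same rules, so one set of cases covers derivations inside
  \<open>QBK\<close> and those above it. The nested induction is done here once and for all.\<close>

lemma QBKs_induct [consumes 1, case_names Ax Barcan MP MB MD BR1 BR2]:
  assumes "\<Phi> \<in> QBKs \<sigma>"
    and ax: "\<And>\<Phi>. \<Phi> \<in> QBK_axioms \<sigma> \<Longrightarrow> Q \<Phi>"
    and barcan: "\<And>\<Phi> x. \<Phi> \<in> Form \<sigma> \<Longrightarrow> Q (\<^bold>\<diamond> (Exists x \<Phi>) \<^bold>\<rightarrow> Exists x (\<^bold>\<diamond> \<Phi>))"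
    and mp: "\<And>\<Phi> \<Psi>. Q \<Phi> \<Longrightarrow> Q (\<Phi> \<^bold>\<rightarrow> \<Psi>) \<Longrightarrow> Q \<Psi>"
    and mb: "\<And>\<Phi> \<Psi>. Q (\<Phi> \<^bold>\<rightarrow> \<Psi>) \<Longrightarrow> Q (\<^bold>\<box> \<Phi> \<^bold>\<rightarrow> \<^bold>\<box> \<Psi>)"
    and md: "\<And>\<Phi> \<Psi>. Q (\<Phi> \<^bold>\<rightarrow> \<Psi>) \<Longrightarrow> Q (\<^bold>\<diamond> \<Phi> \<^bold>\<rightarrow> \<^bold>\<diamond> \<Psi>)"
    and br1: "\<And>\<Phi> \<Psi> x. Q (\<Phi> \<^bold>\<rightarrow> \<Psi>) \<Longrightarrow> x \<notin> fv \<Phi> \<Longrightarrow> Q (\<Phi> \<^bold>\<rightarrow> Forall x \<Psi>)"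
    and br2: "\<And>\<Phi> \<Psi> x. Q (\<Phi> \<^bold>\<rightarrow> \<Psi>) \<Longrightarrow> x \<notin> fv \<Psi> \<Longrightarrow> Q (Exists x \<Phi> \<^bold>\<rightarrow> \<Psi>)"
  shows "Q \<Phi>"
proof -
  have base: "Q \<Psi>" if "\<Psi> \<in> QBK \<sigma>" for \<Psi>
    using that
    by (induction rule: QBK.induct) (erule ax | erule(1) mp br1 br2 | erule mb md)+
  from assms(1) show ?thesis
    by (induction rule: QBKs.induct) (erule base | erule barcan | erule(1) mp br1 br2 | erule mb md)+
qed

lemma QBKs_Form: "\<Phi> \<in> QBKs \<sigma> \<Longrightarrow> \<Phi> \<in> Form \<sigma>"
  by (induction rule: QBKs_induct) (auto simp: axioms_Form)

lemma consequences_Form: "\<Phi> \<in> consequences \<sigma> \<Gamma> \<Longrightarrow> \<Gamma> \<subseteq> Form \<sigma> \<Longrightarrow> \<Phi> \<in> Form \<sigma>"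
  by (induction rule: consequences.induct) (auto simp: QBKs_Form)

interpretation QBKs: logic \<sigma> "QBKs \<sigma>"
  by unfold_locales (auto intro: QBKs.Base QBK.Ax QBKs_Form, rule QBKs.MP)

lemma logic_consequences: "\<Gamma> \<subseteq> Form \<sigma> \<Longrightarrow> logic \<sigma> (consequences \<sigma> \<Gamma>)"
  by unfold_locales
    (auto intro: consequences.Logic QBKs.Base QBK.Ax consequences_Form, rule consequences.MP)

lemma tv_big_disj: "tv v (big_disj \<Phi>s) \<longleftrightarrow> (\<exists>\<Phi> \<in> set \<Phi>s. tv v \<Phi>)"
proof (cases \<Phi>s)
  case (Cons \<Phi> \<Psi>s)
  have "tv v (foldl Disj \<Phi> \<Psi>s) \<longleftrightarrow> tv v \<Phi> \<or> (\<exists>\<Psi> \<in> set \<Psi>s. tv v \<Psi>)"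
    by (induction \<Psi>s arbitrary: \<Phi>) auto
  then show ?thesis using Cons by simp
qed simp

lemma big_disj_Form: "set \<Phi>s \<subseteq> Form \<sigma> \<Longrightarrow> big_disj \<Phi>s \<in> Form \<sigma>"
proof (cases \<Phi>s)
  case (Cons \<Phi> \<Psi>s)
  have "\<Phi> \<in> Form \<sigma> \<Longrightarrow> set \<Psi>s \<subseteq> Form \<sigma> \<Longrightarrow> foldl Disj \<Phi> \<Psi>s \<in> Form \<sigma>"
    by (induction \<Psi>s arbitrary: \<Phi>) auto
  then show "set \<Phi>s \<subseteq> Form \<sigma> \<Longrightarrow> ?thesis" using Cons by simp
qed simp

lemma big_disj_hom:
  assumes "h \<^bold>\<bottom> = \<^bold>\<bottom>" "\<And>\<Phi> \<Psi>. h (\<Phi> \<^bold>\<or> \<Psi>) = h \<Phi> \<^bold>\<or> h \<Psi>"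
  shows "h (big_disj \<Phi>s) = big_disj (map h \<Phi>s)"
proof (cases \<Phi>s)
  case (Cons \<Phi> \<Psi>s)
  have "h (foldl Disj \<Phi> \<Psi>s) = foldl Disj (h \<Phi>) (map h \<Psi>s)"
    by (induction \<Psi>s arbitrary: \<Phi>) (auto simp: assms(2))
  then show ?thesis using Cons by simp
qed (simp add: assms(1))

subsection \<open>Environment semantics and soundness\<close>

definition str :: "('w, 'p, 'c, 'a) model \<Rightarrow> bool \<Rightarrow> 'w \<Rightarrow> ('p, 'c, 'a) struct" where
  "str \<M> b w = (if b then pos \<M> w else neg \<M> w)"

fun tval :: "('p, 'c, 'a) struct \<Rightarrow> (var \<Rightarrow> 'a) \<Rightarrow> 'c tm \<Rightarrow> 'a" where
  "tval \<AA> e (Var x) = e x"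
| "tval \<AA> e (Const c) = const_int \<AA> c"

text \<open>The sign \<open>b\<close> merges verification and falsification, so one induction treats
  both and \<open>SNeg\<close> merely flips it. The antecedent of an implication is always taken
  with sign \<open>True\<close>, so inductions must leave the sign arbitrary. Environments allow
  open formulas of \<sigma> itself to be evaluated.\<close>

primrec sat :: "('w, 'p, 'c, 'a) model \<Rightarrow> ('p, 'c) fm \<Rightarrow> bool \<Rightarrow> 'w \<Rightarrow> (var \<Rightarrow> 'a) \<Rightarrow> bool" where
  "sat \<M> (Atom P ts) b w e \<longleftrightarrow> map (tval (str \<M> b w) e) ts \<in> pred_int (str \<M> b w) P"
| "sat \<M> \<^bold>\<bottom> b w e \<longleftrightarrow> \<not> b"
| "sat \<M> (\<Phi> \<^bold>\<rightarrow> \<Psi>) b w e \<longleftrightarrow>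
     (if b then sat \<M> \<Phi> True w e \<longrightarrow> sat \<M> \<Psi> True w e else sat \<M> \<Phi> True w e \<and> sat \<M> \<Psi> False w e)"
| "sat \<M> (\<Phi> \<^bold>\<and> \<Psi>) b w e \<longleftrightarrow>
     (if b then sat \<M> \<Phi> b w e \<and> sat \<M> \<Psi> b w e else sat \<M> \<Phi> b w e \<or> sat \<M> \<Psi> b w e)"
| "sat \<M> (\<Phi> \<^bold>\<or> \<Psi>) b w e \<longleftrightarrow>
     (if b then sat \<M> \<Phi> b w e \<or> sat \<M> \<Psi> b w e else sat \<M> \<Phi> b w e \<and> sat \<M> \<Psi> b w e)"
| "sat \<M> (\<^bold>\<sim> \<Phi>) b w e \<longleftrightarrow> sat \<M> \<Phi> (\<not> b) w e"
| "sat \<M> (\<^bold>\<box> \<Phi>) b w e \<longleftrightarrow>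
     (if b then \<forall>u. (w, u) \<in> acc \<M> \<longrightarrow> sat \<M> \<Phi> b u e else \<exists>u. (w, u) \<in> acc \<M> \<and> sat \<M> \<Phi> b u e)"
| "sat \<M> (\<^bold>\<diamond> \<Phi>) b w e \<longleftrightarrow>
     (if b then \<exists>u. (w, u) \<in> acc \<M> \<and> sat \<M> \<Phi> b u e else \<forall>u. (w, u) \<in> acc \<M> \<longrightarrow> sat \<M> \<Phi> b u e)"
| "sat \<M> (Forall x \<Phi>) b w e \<longleftrightarrow>
     (if b then \<forall>a \<in> world_dom \<M> w. sat \<M> \<Phi> b w (e(x := a))
      else \<exists>a \<in> world_dom \<M> w. sat \<M> \<Phi> b w (e(x := a)))"
| "sat \<M> (Exists x \<Phi>) b w e \<longleftrightarrow>
     (if b then \<exists>a \<in> world_dom \<M> w. sat \<M> \<Phi> b w (e(x := a))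
      else \<forall>a \<in> world_dom \<M> w. sat \<M> \<Phi> b w (e(x := a)))"

lemma sat_cong: "(\<And>x. x \<in> fv \<Phi> \<Longrightarrow> e x = e' x) \<Longrightarrow> sat \<M> \<Phi> b w e = sat \<M> \<Phi> b w e'"
proof (induction \<Phi> arbitrary: b w e e')
  case (Atom P ts)
  have "tval (str \<M> b w) e t = tval (str \<M> b w) e' t" if "t \<in> set ts" for t
    using Atom[of "case t of Var x \<Rightarrow> x"] that by (cases t) force+
  then have "map (tval (str \<M> b w) e) ts = map (tval (str \<M> b w) e') ts" by simp
  then show ?case by (simp del: map_eq_conv)
next
  case (Imp \<Phi> \<Psi>)
  then have "sat \<M> \<Phi> b w e = sat \<M> \<Phi> b w e'" "sat \<M> \<Psi> b w e = sat \<M> \<Psi> b w e'" for b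
    by (metis UnCI fv.simps(3))+
  then show ?case by simp
next
  case (Conj \<Phi> \<Psi>)
  then have "sat \<M> \<Phi> b w e = sat \<M> \<Phi> b w e'" "sat \<M> \<Psi> b w e = sat \<M> \<Psi> b w e'" for b
    by (metis UnCI fv.simps(4))+
  then show ?case by simp
next
  case (Disj \<Phi> \<Psi>)
  then have "sat \<M> \<Phi> b w e = sat \<M> \<Phi> b w e'" "sat \<M> \<Psi> b w e = sat \<M> \<Psi> b w e'" for b
    by (metis UnCI fv.simps(5))+
  then show ?case by simp
next
  case (SNeg \<Phi>)
  then show ?case by (metis fv.simps(6) sat.simps(6))
next
  case (Box \<Phi>)
  then have "sat \<M> \<Phi> b u e = sat \<M> \<Phi> b u e'" for u
    by (metis fv.simps(7))
  then show ?case by (cases b) simp_all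
next
  case (Dia \<Phi>)
  then have "sat \<M> \<Phi> b u e = sat \<M> \<Phi> b u e'" for u
    by (metis fv.simps(8))
  then show ?case by (cases b) simp_all
next
  case (Forall x \<Phi>)
  have "sat \<M> \<Phi> b w (e(x := a)) = sat \<M> \<Phi> b w (e'(x := a))" for a
    by (rule Forall.IH) (use Forall.prems in auto)
  then show ?case by (cases b) simp_all
next
  case (Exists x \<Phi>)
  have "sat \<M> \<Phi> b w (e(x := a)) = sat \<M> \<Phi> b w (e'(x := a))" for a
    by (rule Exists.IH) (use Exists.prems in auto)
  then show ?case by (cases b) simp_all
qed auto

section \<open>Soundness in a fixed model with a common domain\<close>

context
  fixes \<sigma> :: "('p, 'c) signature" and \<M> :: "('w, 'p, 'c, 'a) model"
  assumes model: "QBKs_model \<sigma> \<M>"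
begin

lemma acc_worlds: "(w, u) \<in> acc \<M> \<Longrightarrow> w \<in> worlds \<M> \<and> u \<in> worlds \<M>"
  using model by (auto simp: QBKs_model_def QBK_model_def)

lemma acc_world_dom: "(w, u) \<in> acc \<M> \<Longrightarrow> world_dom \<M> u = world_dom \<M> w"
  using model acc_worlds by (auto simp: QBKs_model_def)

lemma tval_str:
  "w \<in> worlds \<M> \<Longrightarrow> is_term \<sigma> t \<Longrightarrow> tval (str \<M> b w) e t = tval (pos \<M> w) e t"
  using model by (cases t) (auto simp: QBKs_model_def QBK_model_def str_def)

lemma tval_acc:
  "(w, u) \<in> acc \<M> \<Longrightarrow> is_term \<sigma> t \<Longrightarrow> tval (pos \<M> u) e t = tval (pos \<M> w) e t"
  using model by (cases t) (fastforce simp: QBKs_model_def QBK_model_def)+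

lemma tval_world_dom:
  "w \<in> worlds \<M> \<Longrightarrow> is_term \<sigma> t \<Longrightarrow> range e \<subseteq> world_dom \<M> w \<Longrightarrow> tval (pos \<M> w) e t \<in> world_dom \<M> w"
  using model by (cases t) (auto simp: QBKs_model_def QBK_model_def is_struct_def world_dom_def)

text \<open>Terms are rigid: the two structures at a world, and those at accessible worlds, agree on
  constants. So the value computed in \<open>pos\<close> at \<open>w\<close> serves both signs and
  survives a step along \<open>acc\<close>. Under a binder, \<open>free_for\<close> keeps the value
  of \<open>t\<close> unchanged.\<close>

lemma sat_subst:
  assumes "w \<in> worlds \<M>" "is_form \<sigma> \<Phi>" "is_term \<sigma> t" "free_for t x \<Phi>"
  shows "sat \<M> (subst \<Phi> x t) b w e = sat \<M> \<Phi> b w (e(x := tval (pos \<M> w) e t))"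
  using assms
proof (induction \<Phi> arbitrary: b w e)
  case (Atom P ts)
  have "tval (str \<M> b w) e (subst_tm (Var(x := t)) s) = tval (str \<M> b w) (e(x := tval (pos \<M> w) e t)) s"
    for s using tval_str Atom.prems by (cases s) auto
  then have "map (tval (str \<M> b w) e \<circ> subst_tm (Var(x := t))) ts = map (tval (str \<M> b w) (e(x := tval (pos \<M> w) e t))) ts" by simp
  then show ?case unfolding subst_simps sat.simps map_map by metis
next
  case (Box \<Phi>)
  have "sat \<M> (subst \<Phi> x t) b u e = sat \<M> \<Phi> b u (e(x := tval (pos \<M> w) e t))" if "(w, u) \<in> acc \<M>" for u
    using Box.IH[of u b e] Box.prems acc_worlds[OF that] tval_acc[OF that, of t] by (simp del: fun_upd_apply)
  then show ?case by (cases b) (auto simp del: fun_upd_apply)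
next
  case (Dia \<Phi>)
  have "sat \<M> (subst \<Phi> x t) b u e = sat \<M> \<Phi> b u (e(x := tval (pos \<M> w) e t))" if "(w, u) \<in> acc \<M>" for u
    using Dia.IH[of u b e] Dia.prems acc_worlds[OF that] tval_acc[OF that, of t] by (simp del: fun_upd_apply)
  then show ?case by (cases b) (auto simp del: fun_upd_apply)
next
  case (Forall y \<Phi>)
  show ?case
  proof (cases "x \<in> fv (Forall y \<Phi>)")
    case False
    then show ?thesis by (subst subst_notin_fv) (auto intro!: sat_cong simp del: sat.simps)
  next
    case True
    have "tval (pos \<M> w) (e(y := a)) t = tval (pos \<M> w) e t" for a
      using Forall.prems True by (cases t) auto
    moreover have "x \<noteq> y" using True by auto
    ultimately have "sat \<M> (subst \<Phi> x t) b w (e(y := a)) = sat \<M> \<Phi> b w (e(x := tval (pos \<M> w) e t, y := a))" for a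
      using Forall.IH[of w b "e(y := a)"] Forall.prems True
      by (simp add: fun_upd_twist[of x y] del: fun_upd_apply)
    then show ?thesis using \<open>x \<noteq> y\<close> by (cases b) (simp_all del: fun_upd_apply)
  qed
next
  case (Exists y \<Phi>)
  show ?case
  proof (cases "x \<in> fv (Exists y \<Phi>)")
    case False
    then show ?thesis by (subst subst_notin_fv) (auto intro!: sat_cong simp del: sat.simps)
  next
    case True
    have "tval (pos \<M> w) (e(y := a)) t = tval (pos \<M> w) e t" for a
      using Exists.prems True by (cases t) auto
    moreover have "x \<noteq> y" using True by auto
    ultimately have "sat \<M> (subst \<Phi> x t) b w (e(y := a)) = sat \<M> \<Phi> b w (e(x := tval (pos \<M> w) e t, y := a))" for a
      using Exists.IH[of w b "e(y := a)"] Exists.prems True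
      by (simp add: fun_upd_twist[of x y] del: fun_upd_apply)
    then show ?thesis using \<open>x \<noteq> y\<close> by (cases b) (simp_all del: fun_upd_apply)
  qed
qed auto

text \<open>Most axioms merely restate clauses of \<open>sat\<close>. The two instantiation axioms
  use that the value of a term lies in the domain, which the condition on the range of
  \<open>e\<close> ensures.\<close>

lemma sat_axioms:
  assumes "\<Phi> \<in> QBK_axioms \<sigma>" "w \<in> worlds \<M>" "range e \<subseteq> world_dom \<M> w"
  shows "sat \<M> \<Phi> True w e"
  using assms(1)
proof cases
  case (Q1 \<Phi> t x)
  then show ?thesis using assms(2,3) by (auto simp: sat_subst Form_def tval_world_dom)
next
  case (Q2 \<Phi> t x)
  then show ?thesis using assms(2,3) tval_world_dom by (auto simp: sat_subst Form_def)
qed auto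

lemma sat_QBKs:
  assumes "\<Phi> \<in> QBKs \<sigma>" "w \<in> worlds \<M>" "range e \<subseteq> world_dom \<M> w"
  shows "sat \<M> \<Phi> True w e"
  using assms
proof (induction arbitrary: w e rule: QBKs_induct)
  case (Ax \<Phi>)
  then show ?case by (rule sat_axioms)
next
  case (Barcan \<Phi> x)
  \<comment> \<open>The element found at the successor is available at \<open>w\<close> because the
    domains coincide.\<close>
  then show ?case using acc_world_dom by fastforce
next
  case (MP \<Phi> \<Psi>)
  then show ?case by auto
next
  case (MB \<Phi> \<Psi>)
  \<comment> \<open>The environment still takes its values in the domain of the successor, so the
    induction hypothesis applies there.\<close>
  have "sat \<M> (\<Phi> \<^bold>\<rightarrow> \<Psi>) True u e" if "(w, u) \<in> acc \<M>" for u
    by (rule MB.IH) (use MB.prems acc_world_dom[OF that] acc_worlds[OF that] in auto)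
  then show ?case by auto
next
  case (MD \<Phi> \<Psi>)
  have "sat \<M> (\<Phi> \<^bold>\<rightarrow> \<Psi>) True u e" if "(w, u) \<in> acc \<M>" for u
    by (rule MD.IH) (use MD.prems acc_world_dom[OF that] acc_worlds[OF that] in auto)
  then show ?case by auto
next
  case (BR1 \<Phi> \<Psi> x)
  have "sat \<M> \<Phi> True w (e(x := a)) = sat \<M> \<Phi> True w e" for a
    by (rule sat_cong) (use BR1 in auto)
  moreover have "range (e(x := a)) \<subseteq> world_dom \<M> w" if "a \<in> world_dom \<M> w" for a
    using BR1.prems that by auto
  then have "sat \<M> (\<Phi> \<^bold>\<rightarrow> \<Psi>) True w (e(x := a))" if "a \<in> world_dom \<M> w" for a
    using BR1.IH BR1.prems(1) that by blast
  ultimately show ?case by auto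
next
  case (BR2 \<Phi> \<Psi> x)
  have "sat \<M> \<Psi> True w (e(x := a)) = sat \<M> \<Psi> True w e" for a
    by (rule sat_cong) (use BR2 in auto)
  moreover have "range (e(x := a)) \<subseteq> world_dom \<M> w" if "a \<in> world_dom \<M> w" for a
    using BR2.prems that by auto
  then have "sat \<M> (\<Phi> \<^bold>\<rightarrow> \<Psi>) True w (e(x := a))" if "a \<in> world_dom \<M> w" for a
    using BR2.IH BR2.prems(1) that by blast
  ultimately show ?case by auto
qed

text \<open>The world can stay fixed, since no modal rule acts on premises. The quantifier rules
  change the environment, which is why the premises are assumed under every environment.\<close>

lemma sat_consequences:
  assumes "\<Phi> \<in> consequences \<sigma> \<Gamma>" and w: "w \<in> worlds \<M>"
    and \<Gamma>: "\<And>\<Phi> e. \<Phi> \<in> \<Gamma> \<Longrightarrow> range e \<subseteq> world_dom \<M> w \<Longrightarrow> sat \<M> \<Phi> True w e"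
    and "range e \<subseteq> world_dom \<M> w"
  shows "sat \<M> \<Phi> True w e"
  using assms(1,4)
proof (induction arbitrary: e rule: consequences.induct)
  case (Prem \<Phi>)
  then show ?case by (rule \<Gamma>)
next
  case (Logic \<Phi>)
  then show ?case using w sat_QBKs by blast
next
  case (MP \<Phi> \<Psi>)
  then show ?case by auto
next
  case (BR1 \<Phi> \<Psi> x)
  have "sat \<M> \<Phi> True w (e(x := a)) = sat \<M> \<Phi> True w e" for a
    by (rule sat_cong) (use BR1 in auto)
  moreover have "range (e(x := a)) \<subseteq> world_dom \<M> w" if "a \<in> world_dom \<M> w" for a
    using BR1.prems that by auto
  then have "sat \<M> (\<Phi> \<^bold>\<rightarrow> \<Psi>) True w (e(x := a))" if "a \<in> world_dom \<M> w" for a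
    using BR1.IH that by blast
  ultimately show ?case by auto
next
  case (BR2 \<Phi> \<Psi> x)
  have "sat \<M> \<Psi> True w (e(x := a)) = sat \<M> \<Psi> True w e" for a
    by (rule sat_cong) (use BR2 in auto)
  moreover have "range (e(x := a)) \<subseteq> world_dom \<M> w" if "a \<in> world_dom \<M> w" for a
    using BR2.prems that by auto
  then have "sat \<M> (\<Phi> \<^bold>\<rightarrow> \<Psi>) True w (e(x := a))" if "a \<in> world_dom \<M> w" for a
    using BR2.IH that by blast
  ultimately show ?case by auto
qed

end

lemma sat_big_disj: "sat \<M> (big_disj \<Phi>s) True w e \<longleftrightarrow> (\<exists>\<Phi> \<in> set \<Phi>s. sat \<M> \<Phi> True w e)"
proof (cases \<Phi>s)
  case (Cons \<Phi> \<Psi>s)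
  have "sat \<M> (foldl Disj \<Phi> \<Psi>s) True w e \<longleftrightarrow> sat \<M> \<Phi> True w e \<or> (\<exists>\<Psi> \<in> set \<Psi>s. sat \<M> \<Psi> True w e)"
    by (induction \<Psi>s arbitrary: \<Phi>) auto
  then show ?thesis using Cons by simp
qed simp

section \<open>Ground sentences versus environments\<close>

lemma lift_simps [simp]:
  "lift (Atom P ts) = Atom P (map (map_tm Inl) ts)"
  "lift \<^bold>\<bottom> = \<^bold>\<bottom>"
  "lift (\<Phi> \<^bold>\<rightarrow> \<Psi>) = lift \<Phi> \<^bold>\<rightarrow> lift \<Psi>"
  "lift (\<Phi> \<^bold>\<and> \<Psi>) = lift \<Phi> \<^bold>\<and> lift \<Psi>"
  "lift (\<Phi> \<^bold>\<or> \<Psi>) = lift \<Phi> \<^bold>\<or> lift \<Psi>"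
  "lift (\<^bold>\<sim> \<Phi>) = \<^bold>\<sim> lift \<Phi>"
  "lift (\<^bold>\<box> \<Phi>) = \<^bold>\<box> lift \<Phi>"
  "lift (\<^bold>\<diamond> \<Phi>) = \<^bold>\<diamond> lift \<Phi>"
  "lift (Forall x \<Phi>) = Forall x (lift \<Phi>)"
  "lift (Exists x \<Phi>) = Exists x (lift \<Phi>)"
  by (auto simp: lift_def)

lemma fv_lift [simp]: "fv (lift \<Phi>) = fv \<Phi>"
  by (induction \<Phi>) auto

text \<open>Letting \<theta> leave variables in place carries the induction under a binder, where
  one more variable becomes fixed. All other images are constants, so nothing is captured.\<close>

lemma subst_msubst_Const:
  assumes "\<And>y. \<theta> y = Var y \<or> (\<exists>c. \<theta> y = Const c)"
  shows "msubst (Var(x := Const k)) (msubst (\<theta>(x := Var x)) \<Phi>) = msubst (\<theta>(x := Const k)) \<Phi>"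
  using assms
proof (induction \<Phi> arbitrary: \<theta>)
  case (Atom P ts)
  have "subst_tm (Var(x := Const k)) (subst_tm (\<theta>(x := Var x)) t) = subst_tm (\<theta>(x := Const k)) t" for t
    using Atom[of "case t of Var y \<Rightarrow> y"] by (cases t) (auto split: tm.splits)
  then have "subst_tm (Var(x := Const k)) \<circ> subst_tm (\<theta>(x := Var x)) = subst_tm (\<theta>(x := Const k))"
    by (simp add: fun_eq_iff del: fun_upd_apply)
  then show ?case unfolding msubst.simps map_map by metis
next
  case (Forall y \<Phi>)
  show ?case
  proof (cases "x = y")
    case False
    have "\<And>z. (\<theta>(y := Var y)) z = Var z \<or> (\<exists>c. (\<theta>(y := Var y)) z = Const c)"
      using Forall.prems by auto
    moreover have "(Var(x := Const k))(y := Var y) = (Var(x := Const k))" using False by auto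
    ultimately show ?thesis using Forall.IH[of "\<theta>(y := Var y)"] False
      by (simp add: fun_upd_twist[of x y] del: fun_upd_apply)
  qed (simp del: fun_upd_apply)
next
  case (Exists y \<Phi>)
  show ?case
  proof (cases "x = y")
    case False
    have "\<And>z. (\<theta>(y := Var y)) z = Var z \<or> (\<exists>c. (\<theta>(y := Var y)) z = Const c)"
      using Exists.prems by auto
    moreover have "(Var(x := Const k))(y := Var y) = (Var(x := Const k))" using False by auto
    ultimately show ?thesis using Exists.IH[of "\<theta>(y := Var y)"] False
      by (simp add: fun_upd_twist[of x y] del: fun_upd_apply)
  qed (simp del: fun_upd_apply)
qed auto

lemma subst_msubst_ground:
  "subst (msubst ((Const \<circ> \<rho>)(x := Var x)) \<Phi>) x (Const k) = msubst (Const \<circ> \<rho>(x := k)) \<Phi>"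
  using subst_msubst_Const[of "Const \<circ> \<rho>" x k \<Phi>] by (simp add: subst_def fun_upd_comp)

text \<open>The environment on the right gives each variable the element denoted by the constant
  that \<rho> assigns to it. Both signs are proved jointly because implication and
  \<open>SNeg\<close> mix them.\<close>

lemma verifies_iff_sat:
  assumes "QBKs_model \<sigma> \<M>" "w \<in> worlds \<M>" "is_form \<sigma> \<Phi>" "ground_subst \<sigma> (world_dom \<M> w) \<rho>"
  shows "(verifies \<M> w (msubst (Const \<circ> \<rho>) (lift \<Phi>)) \<longleftrightarrow> sat \<M> \<Phi> True w (tm_val (pos \<M> w) \<circ> Const \<circ> \<rho>)) \<and>
    (falsifies \<M> w (msubst (Const \<circ> \<rho>) (lift \<Phi>)) \<longleftrightarrow> sat \<M> \<Phi> False w (tm_val (pos \<M> w) \<circ> Const \<circ> \<rho>))"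
  using assms(2-)
proof (induction \<Phi> arbitrary: w \<rho>)
  case (Atom P ts)
  have const: "const_int (neg \<M> w) c = const_int (pos \<M> w) c" if "c \<in> consts_of \<sigma>" for c
    using assms(1) Atom.prems(1) that by (auto simp: QBKs_model_def QBK_model_def)
  have \<rho>: "tm_val (neg \<M> w) (Const (\<rho> x)) = tm_val (pos \<M> w) (Const (\<rho> x))" for x
    using Atom.prems(3) const by (cases "\<rho> x") (auto simp: ground_subst_def expand_def dest!: spec[of _ x])
  have "tm_val (str \<M> b w) (subst_tm (Const \<circ> \<rho>) (map_tm Inl t)) =
      tval (str \<M> b w) (tm_val (pos \<M> w) \<circ> Const \<circ> \<rho>) t" if "t \<in> set ts" for t b
    using Atom.prems(2) that \<rho> const by (cases t) (auto simp: str_def)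
  then have "map (tm_val (str \<M> b w) \<circ> (subst_tm (Const \<circ> \<rho>) \<circ> map_tm Inl)) ts =
      map (tval (str \<M> b w) (tm_val (pos \<M> w) \<circ> Const \<circ> \<rho>)) ts" for b
    by simp
  from this[of True] this[of False] show ?case
    unfolding lift_simps msubst.simps map_map verifies.simps falsifies.simps sat.simps
    by (simp only: str_def if_True if_False)
next
  case (Box \<Phi>)
  let ?e = "tm_val (pos \<M> w) \<circ> Const \<circ> \<rho>"
  \<comment> \<open>Constants keep their interpretation along \<open>acc\<close>, so \<rho> induces
    the same environment at a successor.\<close>
  have e: "tm_val (pos \<M> u) \<circ> Const \<circ> \<rho> = ?e" if "(w, u) \<in> acc \<M>" for u
  proof
    fix x
    show "(tm_val (pos \<M> u) \<circ> Const \<circ> \<rho>) x = ?e x"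
      using Box.prems(3) assms(1) that
      by (cases "\<rho> x") (fastforce simp: ground_subst_def expand_def QBKs_model_def QBK_model_def dest!: spec[of _ x])+
  qed
  have "(verifies \<M> u (msubst (Const \<circ> \<rho>) (lift \<Phi>)) \<longleftrightarrow> sat \<M> \<Phi> True u ?e) \<and>
      (falsifies \<M> u (msubst (Const \<circ> \<rho>) (lift \<Phi>)) \<longleftrightarrow> sat \<M> \<Phi> False u ?e)" if "(w, u) \<in> acc \<M>" for u
    using Box.IH[of u \<rho>] Box.prems acc_worlds[OF assms(1) that] acc_world_dom[OF assms(1) that] e[OF that]
    by (simp del: comp_apply)
  then show ?case by (auto simp del: comp_apply)
next
  case (Dia \<Phi>)
  let ?e = "tm_val (pos \<M> w) \<circ> Const \<circ> \<rho>"
  have e: "tm_val (pos \<M> u) \<circ> Const \<circ> \<rho> = ?e" if "(w, u) \<in> acc \<M>" for u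
  proof
    fix x
    show "(tm_val (pos \<M> u) \<circ> Const \<circ> \<rho>) x = ?e x"
      using Dia.prems(3) assms(1) that
      by (cases "\<rho> x") (fastforce simp: ground_subst_def expand_def QBKs_model_def QBK_model_def dest!: spec[of _ x])+
  qed
  have "(verifies \<M> u (msubst (Const \<circ> \<rho>) (lift \<Phi>)) \<longleftrightarrow> sat \<M> \<Phi> True u ?e) \<and>
      (falsifies \<M> u (msubst (Const \<circ> \<rho>) (lift \<Phi>)) \<longleftrightarrow> sat \<M> \<Phi> False u ?e)" if "(w, u) \<in> acc \<M>" for u
    using Dia.IH[of u \<rho>] Dia.prems acc_worlds[OF assms(1) that] acc_world_dom[OF assms(1) that] e[OF that]
    by (simp del: comp_apply)
  then show ?case by (auto simp del: comp_apply)
next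
  case (Forall x \<Phi>)
  have "ground_subst \<sigma> (world_dom \<M> w) (\<rho>(x := Inr a))" if "a \<in> world_dom \<M> w" for a
    using Forall.prems that by (auto simp: ground_subst_def expand_def)
  moreover have "tm_val (pos \<M> w) \<circ> Const \<circ> \<rho>(x := Inr a) = (tm_val (pos \<M> w) \<circ> Const \<circ> \<rho>)(x := a)" for a
    by auto
  ultimately show ?case using Forall.IH[of w "\<rho>(x := Inr _)"] Forall.prems
    by (auto simp: subst_msubst_ground simp del: comp_apply fun_upd_apply)
next
  case (Exists x \<Phi>)
  have "ground_subst \<sigma> (world_dom \<M> w) (\<rho>(x := Inr a))" if "a \<in> world_dom \<M> w" for a
    using Exists.prems that by (auto simp: ground_subst_def expand_def)
  moreover have "tm_val (pos \<M> w) \<circ> Const \<circ> \<rho>(x := Inr a) = (tm_val (pos \<M> w) \<circ> Const \<circ> \<rho>)(x := a)" for a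
    by auto
  ultimately show ?case using Exists.IH[of w "\<rho>(x := Inr _)"] Exists.prems
    by (auto simp: subst_msubst_ground simp del: comp_apply fun_upd_apply)
qed auto

lemma soundness:
  fixes \<sigma> :: "('p, 'c) signature"
  assumes "\<Gamma> \<subseteq> Sent \<sigma>" "\<Delta> \<subseteq> Form \<sigma>" "derives \<sigma> \<Gamma> \<Delta>"
  shows "entails TYPE('w) TYPE('a) \<sigma> \<Gamma> \<Delta>"
  unfolding entails_def
proof (intro allI impI)
  fix \<M> :: "('w, 'p, 'c, 'a) model" and w \<rho>
  assume M: "QBKs_model \<sigma> \<M>" and w: "w \<in> worlds \<M>" and \<rho>: "ground_subst \<sigma> (world_dom \<M> w) \<rho>"
    and \<Gamma>: "\<forall>\<Phi> \<in> \<Gamma>. verifies \<M> w (lift \<Phi>)"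
  let ?e = "tm_val (pos \<M> w) \<circ> Const \<circ> \<rho>"
  obtain \<Phi>s where \<Phi>s: "set \<Phi>s \<subseteq> \<Delta>" "big_disj \<Phi>s \<in> consequences \<sigma> \<Gamma>"
    using assms(3) by (auto simp: derives_def Disjs_def)
  \<comment> \<open>Premises are closed, so their truth under \<open>?e\<close> passes to every
    environment, as \<open>sat_consequences\<close> requires.\<close>
  have "sat \<M> \<Phi> True w e" if "\<Phi> \<in> \<Gamma>" for \<Phi> e
  proof -
    have \<Phi>: "fv \<Phi> = {}" "is_form \<sigma> \<Phi>" using that assms(1) by (auto simp: Sent_def Form_def)
    then have "sat \<M> \<Phi> True w ?e"
      using verifies_iff_sat[OF M w \<Phi>(2) \<rho>] \<Gamma> that by (simp add: msubst_closed)
    then show ?thesis using sat_cong[of \<Phi> e ?e \<M> True w] \<Phi> by simp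
  qed
  moreover have "?e x \<in> world_dom \<M> w" for x
  proof -
    have "\<rho> x \<in> Inl ` consts_of \<sigma> \<union> Inr ` world_dom \<M> w"
      using \<rho> by (simp add: ground_subst_def expand_def)
    moreover have "const_int (pos \<M> w) c \<in> world_dom \<M> w" if "c \<in> consts_of \<sigma>" for c
      using tval_world_dom[OF M w, of "Const c" "\<lambda>_. SOME a. a \<in> world_dom \<M> w"] that w M
      by (auto simp: QBKs_model_def QBK_model_def is_struct_def world_dom_def)
    ultimately show ?thesis by auto
  qed
  then have "range ?e \<subseteq> world_dom \<M> w" by blast
  ultimately have "sat \<M> (big_disj \<Phi>s) True w ?e"
    using sat_consequences[OF M \<Phi>s(2) w] by blast
  then obtain \<Psi> where "\<Psi> \<in> set \<Phi>s" "sat \<M> \<Psi> True w ?e" by (auto simp: sat_big_disj)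
  moreover from this \<Phi>s(1) assms(2) have "is_form \<sigma> \<Psi>" by (auto simp: Form_def)
  ultimately show "\<exists>\<Psi> \<in> \<Delta>. verifies \<M> w (msubst (Const \<circ> \<rho>) (lift \<Psi>))"
    using verifies_iff_sat[OF M w _ \<rho>] \<Phi>s(1) by blast
qed

subsection \<open>Replacing constants by fresh variables\<close>

fun repl_tm :: "('d \<Rightarrow> 'c tm) \<Rightarrow> 'd tm \<Rightarrow> 'c tm" where
  "repl_tm f (Var x) = Var x"
| "repl_tm f (Const c) = f c"

text \<open>Source and target constants have different types, because one use removes all new
  constants and returns from \<open>'c + nat\<close> to \<open>'c\<close>.\<close>

primrec repl :: "('d \<Rightarrow> 'c tm) \<Rightarrow> ('p, 'd) fm \<Rightarrow> ('p, 'c) fm" where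
  "repl f (Atom P ts) = Atom P (map (repl_tm f) ts)"
| "repl f \<^bold>\<bottom> = \<^bold>\<bottom>"
| "repl f (\<Phi> \<^bold>\<rightarrow> \<Psi>) = repl f \<Phi> \<^bold>\<rightarrow> repl f \<Psi>"
| "repl f (\<Phi> \<^bold>\<and> \<Psi>) = repl f \<Phi> \<^bold>\<and> repl f \<Psi>"
| "repl f (\<Phi> \<^bold>\<or> \<Psi>) = repl f \<Phi> \<^bold>\<or> repl f \<Psi>"
| "repl f (\<^bold>\<sim> \<Phi>) = \<^bold>\<sim> repl f \<Phi>"
| "repl f (\<^bold>\<box> \<Phi>) = \<^bold>\<box> repl f \<Phi>"
| "repl f (\<^bold>\<diamond> \<Phi>) = \<^bold>\<diamond> repl f \<Phi>"
| "repl f (Forall x \<Phi>) = Forall x (repl f \<Phi>)"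
| "repl f (Exists x \<Phi>) = Exists x (repl f \<Phi>)"

primrec allvars :: "('p, 'c) fm \<Rightarrow> var set" where
  "allvars (Atom P ts) = (\<Union>t \<in> set ts. fv_tm t)"
| "allvars \<^bold>\<bottom> = {}"
| "allvars (\<Phi> \<^bold>\<rightarrow> \<Psi>) = allvars \<Phi> \<union> allvars \<Psi>"
| "allvars (\<Phi> \<^bold>\<and> \<Psi>) = allvars \<Phi> \<union> allvars \<Psi>"
| "allvars (\<Phi> \<^bold>\<or> \<Psi>) = allvars \<Phi> \<union> allvars \<Psi>"
| "allvars (\<^bold>\<sim> \<Phi>) = allvars \<Phi>"
| "allvars (\<^bold>\<box> \<Phi>) = allvars \<Phi>"
| "allvars (\<^bold>\<diamond> \<Phi>) = allvars \<Phi>"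
| "allvars (Forall x \<Phi>) = insert x (allvars \<Phi>)"
| "allvars (Exists x \<Phi>) = insert x (allvars \<Phi>)"

lemma finite_allvars: "finite (allvars \<Phi>)"
  by (induction \<Phi>) auto

lemma fv_allvars: "fv \<Phi> \<subseteq> allvars \<Phi>"
  by (induction \<Phi>) auto

text \<open>Where \<open>f\<close> undoes \<open>i\<close> on the constants of \<Phi>, only the
  terms put in by \<theta> are affected. With \<open>i = Inl\<close> this cancels a
  \<open>lift\<close>; with the identity it describes formulas that avoid the replaced
  constants.\<close>

lemma repl_msubst_map:
  "(\<And>c. c \<in> set2_fm \<Phi> \<Longrightarrow> f (i c) = Const c) \<Longrightarrow>
    repl f (msubst \<theta> (map_fm id i \<Phi>)) = msubst (repl_tm f \<circ> \<theta>) \<Phi>"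
proof (induction \<Phi> arbitrary: \<theta>)
  case (Atom P ts)
  have "repl_tm f (subst_tm \<theta> (map_tm i t)) = subst_tm (repl_tm f \<circ> \<theta>) t" if "t \<in> set ts" for t
    using Atom[of "case t of Const c \<Rightarrow> c"] that by (cases t) force+
  then show ?case by (simp del: comp_apply) (simp add: comp_def)
next
  case (Forall x \<Phi>)
  have "repl_tm f \<circ> \<theta>(x := Var x) = (repl_tm f \<circ> \<theta>)(x := Var x)" by (simp add: fun_upd_comp)
  then show ?case using Forall.IH[of "\<theta>(x := Var x)"] Forall.prems
    by (simp del: comp_apply fun_upd_apply)
next
  case (Exists x \<Phi>)
  have "repl_tm f \<circ> \<theta>(x := Var x) = (repl_tm f \<circ> \<theta>)(x := Var x)" by (simp add: fun_upd_comp)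
  then show ?case using Exists.IH[of "\<theta>(x := Var x)"] Exists.prems
    by (simp del: comp_apply fun_upd_apply)
qed (simp_all del: comp_apply)

lemma repl_msubst:
  "(\<And>c. c \<in> set2_fm \<Phi> \<Longrightarrow> f c = Const c) \<Longrightarrow> repl f (msubst \<theta> \<Phi>) = msubst (repl_tm f \<circ> \<theta>) \<Phi>"
  using repl_msubst_map[of \<Phi> f id] by (simp add: fm.map_id)

lemma repl_fresh: "(\<And>c. c \<in> set2_fm \<Phi> \<Longrightarrow> f c = Const c) \<Longrightarrow> repl f \<Phi> = \<Phi>"
proof -
  have "repl_tm f \<circ> Var = Var" by auto
  then show "(\<And>c. c \<in> set2_fm \<Phi> \<Longrightarrow> f c = Const c) \<Longrightarrow> ?thesis"
    using repl_msubst[of \<Phi> f Var] by (simp del: comp_apply)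
qed

lemma fv_repl: "fv (repl f \<Phi>) \<subseteq> fv \<Phi> \<union> (\<Union>c. fv_tm (f c))"
proof (induction \<Phi>)
  case (Atom P ts)
  have "fv_tm (repl_tm f t) \<subseteq> fv_tm t \<union> (\<Union>c. fv_tm (f c))" for t
    by (cases t) auto
  then show ?case by fastforce
qed auto

lemma subst_tm_notin: "x \<notin> fv_tm s \<Longrightarrow> subst_tm (Var(x := t)) s = s"
  by (cases s) auto

lemma repl_subst:
  "(\<And>c. x \<notin> fv_tm (f c)) \<Longrightarrow> repl f (subst \<Phi> x t) = subst (repl f \<Phi>) x (repl_tm f t)"
proof (induction \<Phi>)
  case (Atom P ts)
  have "repl_tm f (subst_tm (Var(x := t)) s) = subst_tm (Var(x := repl_tm f t)) (repl_tm f s)" for s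
    using Atom by (cases s) (auto simp: subst_tm_notin)
  then show ?case by (simp del: fun_upd_apply)
qed (simp_all del: fun_upd_apply)

lemma free_for_repl:
  "free_for t x \<Phi> \<Longrightarrow> (\<And>c. fv_tm (f c) \<inter> insert x (allvars \<Phi>) = {}) \<Longrightarrow>
    free_for (repl_tm f t) x (repl f \<Phi>)"
proof (induction \<Phi>)
  case (Forall y \<Phi>)
  show ?case
  proof (cases "x \<in> fv (Forall y \<Phi>)")
    case True
    then have "y \<notin> fv_tm (repl_tm f t)" using Forall.prems by (cases t) auto
    then show ?thesis using Forall True by auto
  next
    case False
    then have "x \<notin> fv (repl f (Forall y \<Phi>))"
      using fv_repl[of f "Forall y \<Phi>"] Forall.prems by blast
    then show ?thesis by auto
  qed
next
  case (Exists y \<Phi>)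
  show ?case
  proof (cases "x \<in> fv (Exists y \<Phi>)")
    case True
    then have "y \<notin> fv_tm (repl_tm f t)" using Exists.prems by (cases t) auto
    then show ?thesis using Exists True by auto
  next
    case False
    then have "x \<notin> fv (repl f (Exists y \<Phi>))"
      using fv_repl[of f "Exists y \<Phi>"] Exists.prems by blast
    then show ?thesis by auto
  qed
next
  case (Imp \<Phi> \<Psi>)
  then show ?case by (simp add: Int_Un_distrib)
next
  case (Conj \<Phi> \<Psi>)
  then show ?case by (simp add: Int_Un_distrib)
next
  case (Disj \<Phi> \<Psi>)
  then show ?case by (simp add: Int_Un_distrib)
qed auto

section \<open>Derivations under replacement of constants\<close>

text \<open>\<open>K\<close> is meant to hold the variables of one derivation that replacements must
  avoid: those of its instantiation axioms and those bound by its quantifier rules. Being finite, it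
  leaves fresh variables.\<close>

definition renaming :: "('p, 'd) signature \<Rightarrow> ('p, 'c) signature \<Rightarrow> var set \<Rightarrow> ('d \<Rightarrow> 'c tm) \<Rightarrow> bool" where
  "renaming \<sigma>\<^sub>1 \<sigma>\<^sub>2 K f \<longleftrightarrow>
    (\<forall>c \<in> consts_of \<sigma>\<^sub>1. is_term \<sigma>\<^sub>2 (f c)) \<and> (\<forall>c. fv_tm (f c) \<inter> K = {})"

lemma renaming_mono: "renaming \<sigma>\<^sub>1 \<sigma>\<^sub>2 K f \<Longrightarrow> K' \<subseteq> K \<Longrightarrow> renaming \<sigma>\<^sub>1 \<sigma>\<^sub>2 K' f"
  unfolding renaming_def by blast

context
  fixes \<sigma>\<^sub>1 :: "('p, 'd) signature" and \<sigma>\<^sub>2 :: "('p, 'c) signature"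
  assumes sig: "preds \<sigma>\<^sub>1 = preds \<sigma>\<^sub>2" "arity \<sigma>\<^sub>1 = arity \<sigma>\<^sub>2"
begin

lemma is_term_repl: "renaming \<sigma>\<^sub>1 \<sigma>\<^sub>2 K f \<Longrightarrow> is_term \<sigma>\<^sub>1 t \<Longrightarrow> is_term \<sigma>\<^sub>2 (repl_tm f t)"
  by (cases t) (auto simp: renaming_def)

lemma repl_Form: "renaming \<sigma>\<^sub>1 \<sigma>\<^sub>2 K f \<Longrightarrow> \<Phi> \<in> Form \<sigma>\<^sub>1 \<Longrightarrow> repl f \<Phi> \<in> Form \<sigma>\<^sub>2"
  by (induction \<Phi>) (auto simp: Form_def sig intro: is_term_repl)

text \<open>Only \<open>Q1\<close> and \<open>Q2\<close> constrain \<open>K\<close>: when the new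
  variables miss those of the instance, \<open>free_for\<close> is preserved and \<open>repl\<close>
  commutes with \<open>subst\<close>.\<close>

lemma repl_axioms:
  assumes "\<Phi> \<in> QBK_axioms \<sigma>\<^sub>1"
  shows "\<exists>K. finite K \<and> (\<forall>f. renaming \<sigma>\<^sub>1 \<sigma>\<^sub>2 K f \<longrightarrow> repl f \<Phi> \<in> QBK_axioms \<sigma>\<^sub>2)"
  using assms
proof cases
  case (Q1 \<Phi>' t x)
  have "repl f \<Phi> \<in> QBK_axioms \<sigma>\<^sub>2" if "renaming \<sigma>\<^sub>1 \<sigma>\<^sub>2 (insert x (allvars \<Phi>')) f" for f
  proof -
    have "\<And>c. fv_tm (f c) \<inter> insert x (allvars \<Phi>') = {}" using that by (simp add: renaming_def)
    moreover from this have "\<And>c. x \<notin> fv_tm (f c)" by blast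
    ultimately show ?thesis
      using Q1 that by (auto simp: repl_subst intro!: QBK_axioms.Q1 repl_Form is_term_repl free_for_repl)
  qed
  then show ?thesis using finite_allvars[of \<Phi>'] by (intro exI[of _ "insert x (allvars \<Phi>')"]) simp
next
  case (Q2 \<Phi>' t x)
  have "repl f \<Phi> \<in> QBK_axioms \<sigma>\<^sub>2" if "renaming \<sigma>\<^sub>1 \<sigma>\<^sub>2 (insert x (allvars \<Phi>')) f" for f
  proof -
    have "\<And>c. fv_tm (f c) \<inter> insert x (allvars \<Phi>') = {}" using that by (simp add: renaming_def)
    moreover from this have "\<And>c. x \<notin> fv_tm (f c)" by blast
    ultimately show ?thesis
      using Q2 that by (auto simp: repl_subst intro!: QBK_axioms.Q2 repl_Form is_term_repl free_for_repl)
  qed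
  then show ?thesis using finite_allvars[of \<Phi>'] by (intro exI[of _ "insert x (allvars \<Phi>')"]) simp
qed (auto intro!: exI[of _ "{}"] QBK_axioms.intros repl_Form)

text \<open>\<open>R\<close> is a further condition on \<open>f\<close>, later that the premises are
  mapped into the new premises. Carrying it along lets the lemma serve both \<open>QBKs\<close> and
  \<open>consequences\<close>.\<close>

lemma repl_MP:
  assumes "\<exists>K. finite K \<and> (\<forall>f. renaming \<sigma>\<^sub>1 \<sigma>\<^sub>2 K f \<and> R f \<longrightarrow> repl f \<Phi> \<in> X)"
    and "\<exists>K. finite K \<and> (\<forall>f. renaming \<sigma>\<^sub>1 \<sigma>\<^sub>2 K f \<and> R f \<longrightarrow> repl f (\<Phi> \<^bold>\<rightarrow> \<Psi>) \<in> X)"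
    and mp: "\<And>\<Phi> \<Psi>. \<Phi> \<in> X \<Longrightarrow> \<Phi> \<^bold>\<rightarrow> \<Psi> \<in> X \<Longrightarrow> \<Psi> \<in> X"
  shows "\<exists>K. finite K \<and> (\<forall>f. renaming \<sigma>\<^sub>1 \<sigma>\<^sub>2 K f \<and> R f \<longrightarrow> repl f \<Psi> \<in> X)"
proof -
  obtain K where K: "finite K" "\<And>f. renaming \<sigma>\<^sub>1 \<sigma>\<^sub>2 K f \<Longrightarrow> R f \<Longrightarrow> repl f \<Phi> \<in> X"
    using assms(1) by blast
  obtain K' where K': "finite K'"
    "\<And>f. renaming \<sigma>\<^sub>1 \<sigma>\<^sub>2 K' f \<Longrightarrow> R f \<Longrightarrow> repl f (\<Phi> \<^bold>\<rightarrow> \<Psi>) \<in> X"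
    using assms(2) by blast
  have "repl f \<Psi> \<in> X" if "renaming \<sigma>\<^sub>1 \<sigma>\<^sub>2 (K \<union> K') f" "R f" for f
    using mp[OF K(2)[of f] K'(2)[of f, simplified]] that renaming_mono[OF that(1)] by blast
  then show ?thesis using K(1) K'(1) by (intro exI[of _ "K \<union> K'"]) simp
qed

lemma repl_notin_fv: "renaming \<sigma>\<^sub>1 \<sigma>\<^sub>2 (insert x K) f \<Longrightarrow> x \<notin> fv \<Phi> \<Longrightarrow> x \<notin> fv (repl f \<Phi>)"
  using fv_repl[of f \<Phi>] unfolding renaming_def by blast

text \<open>Adding \<open>x\<close> to \<open>K\<close> protects the side condition of
  \<open>BR1\<close> and \<open>BR2\<close>; for the modal rules any \<open>x\<close> will
  do.\<close>

lemma repl_rule: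
  assumes "\<exists>K. finite K \<and> (\<forall>f. renaming \<sigma>\<^sub>1 \<sigma>\<^sub>2 K f \<and> R f \<longrightarrow> repl f \<Phi> \<in> X)"
    and "\<And>f K. renaming \<sigma>\<^sub>1 \<sigma>\<^sub>2 (insert x K) f \<Longrightarrow> repl f \<Phi> \<in> X \<Longrightarrow> repl f \<Psi> \<in> X"
  shows "\<exists>K. finite K \<and> (\<forall>f. renaming \<sigma>\<^sub>1 \<sigma>\<^sub>2 K f \<and> R f \<longrightarrow> repl f \<Psi> \<in> X)"
proof -
  obtain K where "finite K" "\<forall>f. renaming \<sigma>\<^sub>1 \<sigma>\<^sub>2 K f \<and> R f \<longrightarrow> repl f \<Phi> \<in> X"
    using assms(1) by blast
  then show ?thesis
    using assms(2) renaming_mono[of _ _ "insert x K" _ K] by (intro exI[of _ "insert x K"]) blast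
qed

lemma repl_QBKs:
  assumes "\<Phi> \<in> QBKs \<sigma>\<^sub>1"
  shows "\<exists>K. finite K \<and> (\<forall>f. renaming \<sigma>\<^sub>1 \<sigma>\<^sub>2 K f \<and> R f \<longrightarrow> repl f \<Phi> \<in> QBKs \<sigma>\<^sub>2)"
  using assms
proof (induction rule: QBKs_induct)
  case (Ax \<Phi>)
  then show ?case using repl_axioms[of \<Phi>] QBKs.axioms by blast
next
  case (Barcan \<Phi> x)
  then show ?case by (auto intro!: exI[of _ "{}"] QBKs.Barcan repl_Form)
next
  case (MP \<Phi> \<Psi>)
  then show ?case by (rule repl_MP) (rule QBKs.MP)
next
  case (MB \<Phi> \<Psi>)
  then show ?case by (rule repl_rule) (simp add: QBKs.MB)
next
  case (MD \<Phi> \<Psi>)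
  then show ?case by (rule repl_rule) (simp add: QBKs.MD)
next
  case (BR1 \<Phi> \<Psi> x)
  from BR1(1) show ?case by (rule repl_rule[where x = x]) (simp add: QBKs.BR1 repl_notin_fv BR1(2))
next
  case (BR2 \<Phi> \<Psi> x)
  from BR2(1) show ?case by (rule repl_rule[where x = x]) (simp add: QBKs.BR2 repl_notin_fv BR2(2))
qed

text \<open>\<open>K\<close> is fixed before \<open>f\<close>, so the variables introduced by
  \<open>f\<close> can be chosen fresh for the given derivation.\<close>

lemma repl_consequences:
  assumes "\<Phi> \<in> consequences \<sigma>\<^sub>1 \<Gamma>\<^sub>1"
  shows "\<exists>K. finite K \<and>
    (\<forall>f. renaming \<sigma>\<^sub>1 \<sigma>\<^sub>2 K f \<and> repl f ` \<Gamma>\<^sub>1 \<subseteq> \<Gamma>\<^sub>2 \<longrightarrow> repl f \<Phi> \<in> consequences \<sigma>\<^sub>2 \<Gamma>\<^sub>2)"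
  using assms
proof (induction rule: consequences.induct)
  case (Prem \<Phi>)
  then show ?case by (auto intro!: exI[of _ "{}"] consequences.Prem)
next
  case (Logic \<Phi>)
  from repl_QBKs[OF this, of "\<lambda>f. repl f ` \<Gamma>\<^sub>1 \<subseteq> \<Gamma>\<^sub>2"]
  show ?case by (blast intro: consequences.Logic)
next
  case (MP \<Phi> \<Psi>)
  from MP.IH show ?case by (rule repl_MP) (rule consequences.MP)
next
  case (BR1 \<Phi> \<Psi> x)
  from BR1.IH show ?case
    by (rule repl_rule[where x = x]) (simp add: consequences.BR1 repl_notin_fv BR1.hyps)
next
  case (BR2 \<Phi> \<Psi> x)
  from BR2.IH show ?case
    by (rule repl_rule[where x = x]) (simp add: consequences.BR2 repl_notin_fv BR2.hyps)
qed

end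

section \<open>Undoing a renaming of variables\<close>

lemma fv_msubst: "fv (msubst \<theta> \<Phi>) \<subseteq> (\<Union>x \<in> fv \<Phi>. fv_tm (\<theta> x))"
proof (induction \<Phi> arbitrary: \<theta>)
  case (Atom P ts)
  have "fv_tm (subst_tm \<theta> t) \<subseteq> (\<Union>x \<in> fv_tm t. fv_tm (\<theta> x))" for t
    by (cases t) auto
  then show ?case by fastforce
next
  case (Forall x \<Phi>)
  have "y \<in> (\<Union>z \<in> fv \<Phi> - {x}. fv_tm (\<theta> z))"
    if y: "y \<in> fv (msubst (\<theta>(x := Var x)) \<Phi>)" "y \<noteq> x" for y
  proof -
    obtain z where "z \<in> fv \<Phi>" "y \<in> fv_tm ((\<theta>(x := Var x)) z)"
      using y(1) Forall[of "\<theta>(x := Var x)"] by blast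
    then show ?thesis using y(2) by (auto split: if_splits)
  qed
  then show ?case by auto
next
  case (Exists x \<Phi>)
  have "y \<in> (\<Union>z \<in> fv \<Phi> - {x}. fv_tm (\<theta> z))"
    if y: "y \<in> fv (msubst (\<theta>(x := Var x)) \<Phi>)" "y \<noteq> x" for y
  proof -
    obtain z where "z \<in> fv \<Phi>" "y \<in> fv_tm ((\<theta>(x := Var x)) z)"
      using y(1) Exists[of "\<theta>(x := Var x)"] by blast
    then show ?thesis using y(2) by (auto split: if_splits)
  qed
  then show ?case by auto
qed (simp; blast)+

text \<open>As \<open>y\<close> is new, it occurs in \<open>msubst \<theta> \<Phi>\<close> only
  where \<open>x\<close> was free in \<Phi>, hence never in the scope of a binder of
  \<open>x\<close>. Putting \<open>x\<close> back therefore captures nothing.\<close>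

lemma msubst_rename_back:
  assumes "y \<notin> allvars \<Phi>" "\<And>z. z \<in> fv \<Phi> \<Longrightarrow> z \<noteq> x \<Longrightarrow> y \<notin> fv_tm (\<theta> z)" "\<theta> x = Var y"
  shows "free_for (Var x) y (msubst \<theta> \<Phi>) \<and> subst (msubst \<theta> \<Phi>) y (Var x) = msubst (\<theta>(x := Var x)) \<Phi>"
  using assms
proof (induction \<Phi> arbitrary: \<theta>)
  case (Atom P ts)
  have "subst_tm (Var(y := Var x)) (subst_tm \<theta> t) = subst_tm (\<theta>(x := Var x)) t" if "t \<in> set ts" for t
    using Atom(2)[of "case t of Var z \<Rightarrow> z"] Atom(3) that by (cases t) (force simp: subst_tm_notin)+
  then show ?case by (simp del: fun_upd_apply)
next
  case (Forall z \<Phi>)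
  show ?case
  proof (cases "z = x")
    case True
    have "y \<notin> fv (msubst (\<theta>(x := Var x)) \<Phi>)"
      using fv_msubst[of "\<theta>(x := Var x)" \<Phi>] Forall.prems True by (auto split: if_splits dest!: subsetD)
    then show ?thesis using True Forall.prems by (simp add: subst_notin_fv del: fun_upd_apply)
  next
    case False
    have "free_for (Var x) y (msubst (\<theta>(z := Var z)) \<Phi>) \<and>
        subst (msubst (\<theta>(z := Var z)) \<Phi>) y (Var x) = msubst (\<theta>(z := Var z, x := Var x)) \<Phi>"
      by (rule Forall.IH) (use Forall.prems False in auto)
    then show ?thesis using False Forall.prems by (simp add: fun_upd_twist[of x z] del: fun_upd_apply)
  qed
next
  case (Exists z \<Phi>)
  show ?case
  proof (cases "z = x")
    case True
    have "y \<notin> fv (msubst (\<theta>(x := Var x)) \<Phi>)"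
      using fv_msubst[of "\<theta>(x := Var x)" \<Phi>] Exists.prems True by (auto split: if_splits dest!: subsetD)
    then show ?thesis using True Exists.prems by (simp add: subst_notin_fv del: fun_upd_apply)
  next
    case False
    have "free_for (Var x) y (msubst (\<theta>(z := Var z)) \<Phi>) \<and>
        subst (msubst (\<theta>(z := Var z)) \<Phi>) y (Var x) = msubst (\<theta>(z := Var z, x := Var x)) \<Phi>"
      by (rule Exists.IH) (use Exists.prems False in auto)
    then show ?thesis using False Exists.prems by (simp add: fun_upd_twist[of x z] del: fun_upd_apply)
  qed
qed (simp_all del: fun_upd_apply)

text \<open>Generalise by \<open>BR1\<close>, then instantiate by \<open>Q1\<close>. The trivial
  closed antecedent is there because \<open>BR1\<close> introduces \<open>Forall\<close> only behind
  an implication.\<close>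

lemma consequences_subst:
  assumes "\<Phi> \<in> consequences \<sigma> \<Gamma>" "\<Gamma> \<subseteq> Form \<sigma>" "is_term \<sigma> t" "free_for t x \<Phi>"
  shows "subst \<Phi> x t \<in> consequences \<sigma> \<Gamma>"
proof -
  interpret C: logic \<sigma> "consequences \<sigma> \<Gamma>" by (rule logic_consequences) fact
  have F: "\<Phi> \<in> Form \<sigma>" using assms by (auto intro: consequences_Form)
  let ?T = "\<^bold>\<bottom> \<^bold>\<rightarrow> \<^bold>\<bottom> :: ('a, 'b) fm"
  have "?T \<^bold>\<rightarrow> \<Phi> \<in> consequences \<sigma> \<Gamma>"
    by (rule C.tautological_consequence[of "[\<Phi>]"]) (use assms F in auto)
  then have "?T \<^bold>\<rightarrow> Forall x \<Phi> \<in> consequences \<sigma> \<Gamma>" by (rule consequences.BR1) simp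
  moreover have "Forall x \<Phi> \<^bold>\<rightarrow> subst \<Phi> x t \<in> consequences \<sigma> \<Gamma>"
    using assms F C.axioms by (auto intro: QBK_axioms.Q1)
  ultimately show ?thesis
    by (intro C.tautological_consequence[of "[?T \<^bold>\<rightarrow> Forall x \<Phi>, Forall x \<Phi> \<^bold>\<rightarrow> subst \<Phi> x t]"])
      (use assms F in \<open>auto simp: subst_Form\<close>)
qed

text \<open>The simultaneous renaming is undone one variable at a time; as \<open>g\<close> is
  injective, \<open>g x\<close> stands for no other variable of \<open>X\<close>.\<close>

lemma consequences_rename_back:
  fixes \<Phi> :: "('p, 'c) fm"
  assumes "finite X" "\<Gamma> \<subseteq> Form \<sigma>" "inj_on g X" "\<And>x. x \<in> X \<Longrightarrow> g x \<notin> allvars \<Phi>"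
    and "msubst (\<lambda>x. if x \<in> X then Var (g x) else Var x) \<Phi> \<in> consequences \<sigma> \<Gamma>"
  shows "\<Phi> \<in> consequences \<sigma> \<Gamma>"
  using assms
proof (induction X rule: finite_induct)
  case empty
  then show ?case by simp
next
  case (insert x X)
  let ?\<theta> = "\<lambda>z. if z \<in> insert x X then Var (g z) else Var z :: 'c tm"
  have "g x \<notin> fv_tm (?\<theta> z)" if "z \<in> fv \<Phi>" "z \<noteq> x" for z
    using that insert.prems(2,3) insert.hyps fv_allvars[of \<Phi>] by (auto simp: inj_on_def)
  then have "free_for (Var x) (g x) (msubst ?\<theta> \<Phi>)"
    "subst (msubst ?\<theta> \<Phi>) (g x) (Var x) = msubst (?\<theta>(x := Var x)) \<Phi>"
    using msubst_rename_back[of "g x" \<Phi> x ?\<theta>] insert.prems(3) by auto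
  then have "msubst (?\<theta>(x := Var x)) \<Phi> \<in> consequences \<sigma> \<Gamma>"
    using consequences_subst[OF insert.prems(4,1), of "Var x" "g x"] by simp
  moreover have "?\<theta>(x := Var x) = (\<lambda>z. if z \<in> X then Var (g z) else Var z)"
    using insert.hyps by auto
  ultimately have "msubst (\<lambda>z. if z \<in> X then Var (g z) else Var z) \<Phi> \<in> consequences \<sigma> \<Gamma>"
    by (simp only:)
  then show ?case using insert.IH insert.prems by simp
qed

subsection \<open>Saturated theories\<close>

lemma Sent_simps [simp]:
  "\<^bold>\<bottom> \<in> Sent \<sigma>"
  "\<Phi> \<^bold>\<rightarrow> \<Psi> \<in> Sent \<sigma> \<longleftrightarrow> \<Phi> \<in> Sent \<sigma> \<and> \<Psi> \<in> Sent \<sigma>"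
  "\<Phi> \<^bold>\<and> \<Psi> \<in> Sent \<sigma> \<longleftrightarrow> \<Phi> \<in> Sent \<sigma> \<and> \<Psi> \<in> Sent \<sigma>"
  "\<Phi> \<^bold>\<or> \<Psi> \<in> Sent \<sigma> \<longleftrightarrow> \<Phi> \<in> Sent \<sigma> \<and> \<Psi> \<in> Sent \<sigma>"
  "\<^bold>\<sim> \<Phi> \<in> Sent \<sigma> \<longleftrightarrow> \<Phi> \<in> Sent \<sigma>"
  "\<^bold>\<box> \<Phi> \<in> Sent \<sigma> \<longleftrightarrow> \<Phi> \<in> Sent \<sigma>"
  "\<^bold>\<diamond> \<Phi> \<in> Sent \<sigma> \<longleftrightarrow> \<Phi> \<in> Sent \<sigma>"
  by (auto simp: Sent_def)

lemma Sent_Form: "\<Phi> \<in> Sent \<sigma> \<Longrightarrow> \<Phi> \<in> Form \<sigma>"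
  by (simp add: Sent_def)

lemma Sent_Quant:
  "Forall x \<Phi> \<in> Sent \<sigma> \<longleftrightarrow> \<Phi> \<in> Form \<sigma> \<and> fv \<Phi> \<subseteq> {x}"
  "Exists x \<Phi> \<in> Sent \<sigma> \<longleftrightarrow> \<Phi> \<in> Form \<sigma> \<and> fv \<Phi> \<subseteq> {x}"
  by (auto simp: Sent_def)

lemma subst_Sent:
  assumes "\<Phi> \<in> Form \<sigma>" "fv \<Phi> \<subseteq> {x}" "c \<in> consts_of \<sigma>"
  shows "subst \<Phi> x (Const c) \<in> Sent \<sigma>"
proof -
  have "fv (subst \<Phi> x (Const c)) = {}"
    using fv_msubst[of "Var(x := Const c)" \<Phi>] assms(2) by (fastforce simp: subst_def)
  then show ?thesis using assms by (simp add: Sent_def subst_Form)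
qed

section \<open>Countability of the language\<close>

instance tm :: (countable) countable
  by countable_datatype

instance fm :: (countable, countable) countable
  by countable_datatype

lemma Form_symbols: "is_form \<sigma> \<Phi> \<Longrightarrow> set1_fm \<Phi> \<subseteq> preds \<sigma> \<and> set2_fm \<Phi> \<subseteq> consts_of \<sigma>"
proof (induction \<Phi>)
  case (Atom P ts)
  have "set_tm t \<subseteq> consts_of \<sigma>" if "t \<in> set ts" for t
    using Atom that by (cases t) auto
  then show ?case using Atom by auto
qed auto

text \<open>The types of symbols may be uncountable, so the \<open>countable\<close> instances do
  not apply to \<sigma>-formulas themselves. The symbols of \<sigma> are first coded by numbers, and
  this is injective on formulas built from them.\<close>

lemma countable_Form:
  assumes "countable_signature \<sigma>"
  shows "countable (Form \<sigma>)"
proof (rule countableI')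
  let ?f = "to_nat_on (preds \<sigma>)" and ?g = "to_nat_on (consts_of \<sigma>)"
  have "inj_on ?f (preds \<sigma>)" "inj_on ?g (consts_of \<sigma>)"
    using assms by (auto simp: countable_signature_def)
  then have f: "?f p = ?f q \<Longrightarrow> p \<in> preds \<sigma> \<Longrightarrow> q \<in> preds \<sigma> \<Longrightarrow> p = q"
    and g: "?g c = ?g d \<Longrightarrow> c \<in> consts_of \<sigma> \<Longrightarrow> d \<in> consts_of \<sigma> \<Longrightarrow> c = d" for p q c d
    by (simp_all add: inj_on_eq_iff)
  have inj: "inj_on (map_fm ?f ?g) (Form \<sigma>)"
  proof (rule inj_onI)
    fix \<Phi> \<Psi> assume "\<Phi> \<in> Form \<sigma>" "\<Psi> \<in> Form \<sigma>" and eq: "map_fm ?f ?g \<Phi> = map_fm ?f ?g \<Psi>"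
    then have "set1_fm \<Phi> \<subseteq> preds \<sigma>" "set2_fm \<Phi> \<subseteq> consts_of \<sigma>"
      "set1_fm \<Psi> \<subseteq> preds \<sigma>" "set2_fm \<Psi> \<subseteq> consts_of \<sigma>"
      using Form_symbols[of \<sigma>] by (auto simp: Form_def)
    then show "\<Phi> = \<Psi>"
      by (intro fm.inj_map_strong[OF f g eq]) auto
  qed
  show "inj_on (to_nat \<circ> map_fm ?f ?g) (Form \<sigma>)"
    using inj by (rule comp_inj_on) auto
qed

text \<open>Closure is expressed by conjunctions and one-premise implications provable in
  \<open>QBKs\<close>, so no quantifier rule ever acts on members of \<open>T\<close>. The premises
  \<Gamma> do not appear; they enter only through the choice of the root theory.\<close>

definition saturated :: "('p, 'c) signature \<Rightarrow> ('p, 'c) fm set \<Rightarrow> bool" where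
  "saturated \<sigma> T \<longleftrightarrow> T \<subseteq> Sent \<sigma> \<and> \<^bold>\<bottom> \<notin> T \<and>
    (\<forall>\<Phi> \<in> T. \<forall>\<Psi> \<in> T. \<Phi> \<^bold>\<and> \<Psi> \<in> T) \<and>
    (\<forall>\<Phi> \<in> T. \<forall>\<Psi> \<in> Sent \<sigma>. \<Phi> \<^bold>\<rightarrow> \<Psi> \<in> QBKs \<sigma> \<longrightarrow> \<Psi> \<in> T) \<and>
    (\<forall>\<Phi> \<in> Sent \<sigma>. \<Phi> \<in> T \<or> \<^bold>\<not> \<Phi> \<in> T) \<and>
    (\<forall>x \<Phi>. Exists x \<Phi> \<in> T \<longrightarrow> (\<exists>c \<in> consts_of \<sigma>. subst \<Phi> x (Const c) \<in> T))"

section \<open>Building a saturated theory along an enumeration\<close>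

text \<open>What a Henkin construction with a fixed set of constants asks of a consistency property.
  \<open>witness\<close> does not say whether the constant is fresh: at the root it will be, at a
  successor it is inherited from the predecessor.\<close>

locale acceptance =
  fixes \<sigma> :: "('p, 'c) signature" and P :: "('p, 'c) fm \<Rightarrow> bool"
  assumes countable: "countable (Sent \<sigma>)"
    and mono: "\<lbrakk>P \<Phi>; \<Phi> \<in> Sent \<sigma>; \<Psi> \<in> Sent \<sigma>; \<Phi> \<^bold>\<rightarrow> \<Psi> \<in> QBKs \<sigma>\<rbrakk> \<Longrightarrow> P \<Psi>"
    and split: "\<lbrakk>P \<Phi>; \<Phi> \<in> Sent \<sigma>; \<Psi> \<in> Sent \<sigma>\<rbrakk> \<Longrightarrow> P (\<Phi> \<^bold>\<and> \<Psi>) \<or> P (\<Phi> \<^bold>\<and> \<^bold>\<not> \<Psi>)"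
    and witness: "\<lbrakk>P (Exists x \<Theta>); Exists x \<Theta> \<in> Sent \<sigma>\<rbrakk> \<Longrightarrow> \<exists>c \<in> consts_of \<sigma>. P (subst \<Theta> x (Const c))"
    and consistent: "\<not> P \<^bold>\<bottom>"
begin

text \<open>The witness clause belongs to the affirmative alternative: an existential sentence is
  accepted together with an instance, in the same step.\<close>

definition decides :: "('p, 'c) fm \<Rightarrow> ('p, 'c) fm \<Rightarrow> bool" where
  "decides \<Phi> \<Psi> \<longleftrightarrow> \<Phi> \<^bold>\<rightarrow> \<^bold>\<not> \<Psi> \<in> QBKs \<sigma> \<or> \<Phi> \<^bold>\<rightarrow> \<Psi> \<in> QBKs \<sigma> \<and>
    (\<forall>x \<Theta>. \<Psi> = Exists x \<Theta> \<longrightarrow> (\<exists>c \<in> consts_of \<sigma>. \<Phi> \<^bold>\<rightarrow> subst \<Theta> x (Const c) \<in> QBKs \<sigma>))"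

lemma extend_step:
  assumes "P \<Phi>" "\<Phi> \<in> Sent \<sigma>" "\<Psi> \<in> Sent \<sigma>"
  shows "\<exists>\<Phi>' \<in> Sent \<sigma>. P \<Phi>' \<and> \<Phi>' \<^bold>\<rightarrow> \<Phi> \<in> QBKs \<sigma> \<and> decides \<Phi>' \<Psi>"
proof -
  have F: "\<Phi> \<in> Form \<sigma>" "\<Psi> \<in> Form \<sigma>" using assms by (auto simp: Sent_Form)
  consider "P (\<Phi> \<^bold>\<and> \<^bold>\<not> \<Psi>)" | "P (\<Phi> \<^bold>\<and> \<Psi>)" "\<nexists>x \<Theta>. \<Psi> = Exists x \<Theta>"
    | x \<Theta> where "P (\<Phi> \<^bold>\<and> \<Psi>)" "\<Psi> = Exists x \<Theta>"
    using split[OF assms] by blast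
  then show ?thesis
  proof cases
    case 1
    have "(\<Phi> \<^bold>\<and> \<^bold>\<not> \<Psi>) \<^bold>\<rightarrow> \<Phi> \<in> QBKs \<sigma>" "(\<Phi> \<^bold>\<and> \<^bold>\<not> \<Psi>) \<^bold>\<rightarrow> \<^bold>\<not> \<Psi> \<in> QBKs \<sigma>"
      using F by (auto intro!: QBKs.tautology)
    then show ?thesis using 1 assms by (intro bexI[of _ "\<Phi> \<^bold>\<and> \<^bold>\<not> \<Psi>"]) (auto simp: decides_def)
  next
    case 2
    have "(\<Phi> \<^bold>\<and> \<Psi>) \<^bold>\<rightarrow> \<Phi> \<in> QBKs \<sigma>" "(\<Phi> \<^bold>\<and> \<Psi>) \<^bold>\<rightarrow> \<Psi> \<in> QBKs \<sigma>"
      using F by (auto intro!: QBKs.tautology)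
    then show ?thesis using 2 assms by (intro bexI[of _ "\<Phi> \<^bold>\<and> \<Psi>"]) (auto simp: decides_def)
  next
    case 3
    have \<Theta>: "\<Theta> \<in> Form \<sigma>" "fv \<Theta> \<subseteq> {x}" using assms(3) 3 by (auto simp: Sent_Quant)
    have \<Phi>: "fv \<Phi> = {}" using assms(2) by (simp add: Sent_def)
    \<comment> \<open>The witness must be compatible with \<Phi>, not just with \<Theta>, so \<Phi>
      is moved under the quantifier before \<open>witness\<close> is applied. Being closed, it is
      untouched by the substitution.\<close>
    let ?E = "Exists x (\<Phi> \<^bold>\<and> \<Theta>)"
    have E: "?E \<in> Sent \<sigma>" using \<Theta> \<Phi> F by (simp add: Sent_Quant)
    have "subst (\<Phi> \<^bold>\<and> \<Theta>) x (Var x) \<^bold>\<rightarrow> ?E \<in> QBKs \<sigma>"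
      using F \<Theta> by (intro QBKs.axioms[THEN subsetD] QBK_axioms.Q2) auto
    then have "\<Phi> \<^bold>\<and> \<Theta> \<^bold>\<rightarrow> ?E \<in> QBKs \<sigma>" by (simp only: subst_self)
    then have "\<Theta> \<^bold>\<rightarrow> (\<Phi> \<^bold>\<rightarrow> ?E) \<in> QBKs \<sigma>"
      by (intro QBKs.tautological_consequence[of "[\<Phi> \<^bold>\<and> \<Theta> \<^bold>\<rightarrow> ?E]"]) (use F \<Theta> in auto)
    then have "\<Psi> \<^bold>\<rightarrow> (\<Phi> \<^bold>\<rightarrow> ?E) \<in> QBKs \<sigma>"
      unfolding 3 by (rule QBKs.BR2) (use \<Phi> in auto)
    then have "\<Phi> \<^bold>\<and> \<Psi> \<^bold>\<rightarrow> ?E \<in> QBKs \<sigma>"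
      by (intro QBKs.tautological_consequence[of "[\<Psi> \<^bold>\<rightarrow> (\<Phi> \<^bold>\<rightarrow> ?E)]"]) (use F \<Theta> in auto)
    then have "P ?E" using mono[of "\<Phi> \<^bold>\<and> \<Psi>" ?E] 3 assms E by simp
    then obtain c where c: "c \<in> consts_of \<sigma>" "P (subst (\<Phi> \<^bold>\<and> \<Theta>) x (Const c))"
      using witness E by blast
    let ?\<Theta> = "subst \<Theta> x (Const c)"
    have \<Theta>c: "?\<Theta> \<in> Sent \<sigma>" using subst_Sent[OF \<Theta> c(1)] .
    have P: "P (\<Phi> \<^bold>\<and> ?\<Theta>)" using c \<Phi> by (simp add: subst_notin_fv)
    have "?\<Theta> \<^bold>\<rightarrow> \<Psi> \<in> QBKs \<sigma>"
      unfolding 3 using \<Theta> c by (intro QBKs.axioms[THEN subsetD] QBK_axioms.Q2) auto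
    then have "(\<Phi> \<^bold>\<and> ?\<Theta>) \<^bold>\<rightarrow> \<Psi> \<in> QBKs \<sigma>"
      by (intro QBKs.tautological_consequence[of "[?\<Theta> \<^bold>\<rightarrow> \<Psi>]"]) (use F Sent_Form[OF \<Theta>c] in auto)
    moreover have "(\<Phi> \<^bold>\<and> ?\<Theta>) \<^bold>\<rightarrow> \<Phi> \<in> QBKs \<sigma>" "(\<Phi> \<^bold>\<and> ?\<Theta>) \<^bold>\<rightarrow> ?\<Theta> \<in> QBKs \<sigma>"
      using F Sent_Form[OF \<Theta>c] by (auto intro!: QBKs.tautology)
    ultimately show ?thesis using P assms \<Theta>c c(1) 3
      by (intro bexI[of _ "\<Phi> \<^bold>\<and> ?\<Theta>"]) (auto simp: decides_def)
  qed
qed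

theorem saturated_extension:
  assumes "P \<Theta>\<^sub>0" "\<Theta>\<^sub>0 \<in> Sent \<sigma>"
  shows "\<exists>T. saturated \<sigma> T \<and> \<Theta>\<^sub>0 \<in> T \<and> (\<forall>\<Phi> \<in> T. P \<Phi>)"
proof -
  define s where "s = from_nat_into (Sent \<sigma>)"
  have ne: "Sent \<sigma> \<noteq> {}" using Sent_simps(1) by blast
  have s: "s n \<in> Sent \<sigma>" for n unfolding s_def using ne by (rule from_nat_into)
  have s_surj: "\<exists>n. \<Phi> = s n" if "\<Phi> \<in> Sent \<sigma>" for \<Phi>
    using that range_from_nat_into[OF ne countable] by (auto simp: s_def)
  \<comment> \<open>Dependent choice provides an invariant for each stage; the starting value is put
    into it as a condition at \<open>n = 0\<close>.\<close>
  have "\<exists>t. \<forall>n. (t n \<in> Sent \<sigma> \<and> P (t n) \<and> (n = 0 \<longrightarrow> t n = \<Theta>\<^sub>0)) \<and>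
      t (Suc n) \<^bold>\<rightarrow> t n \<in> QBKs \<sigma> \<and> decides (t (Suc n)) (s n)"
  proof (rule dependent_nat_choice)
    show "\<exists>x. x \<in> Sent \<sigma> \<and> P x \<and> (0 = (0 :: nat) \<longrightarrow> x = \<Theta>\<^sub>0)" using assms by simp
    show "\<exists>y. (y \<in> Sent \<sigma> \<and> P y \<and> (Suc n = 0 \<longrightarrow> y = \<Theta>\<^sub>0)) \<and> y \<^bold>\<rightarrow> x \<in> QBKs \<sigma> \<and> decides y (s n)"
      if "x \<in> Sent \<sigma> \<and> P x \<and> (n = 0 \<longrightarrow> x = \<Theta>\<^sub>0)" for x n
      using extend_step[of x "s n"] that s by auto
  qed
  then obtain t where t: "\<And>n. t n \<in> Sent \<sigma>" "\<And>n. P (t n)" "t 0 = \<Theta>\<^sub>0"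
    "\<And>n. t (Suc n) \<^bold>\<rightarrow> t n \<in> QBKs \<sigma>" "\<And>n. decides (t (Suc n)) (s n)" by metis
  note tF = t(1)[THEN Sent_Form]
  have trans: "a \<^bold>\<rightarrow> c \<in> QBKs \<sigma>" if "a \<^bold>\<rightarrow> b \<in> QBKs \<sigma>" "b \<^bold>\<rightarrow> c \<in> QBKs \<sigma>" for a b c
    using QBKs.tautological_consequence[of "[a \<^bold>\<rightarrow> b, b \<^bold>\<rightarrow> c]" \<sigma> "a \<^bold>\<rightarrow> c"] that that[THEN QBKs_Form]
    by auto
  have chain: "t n \<^bold>\<rightarrow> t m \<in> QBKs \<sigma>" if "m \<le> n" for m n
    using that
  proof (induction n rule: dec_induct)
    case base
    show ?case using tF by (auto intro: QBKs.tautology)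
  next
    case (step n)
    then show ?case using trans t(4) by blast
  qed
  \<comment> \<open>The stages form a chain, so any two members are implied by a common stage, and
    by \<open>mono\<close> every member satisfies \<open>P\<close>.\<close>
  define T where "T = {\<Phi> \<in> Sent \<sigma>. \<exists>n. t n \<^bold>\<rightarrow> \<Phi> \<in> QBKs \<sigma>}"
  have TP: "P \<Phi>" if "\<Phi> \<in> T" for \<Phi>
    using that mono t(1,2) by (auto simp: T_def)
  have "\<Phi> \<^bold>\<and> \<Psi> \<in> T" if "\<Phi> \<in> T" "\<Psi> \<in> T" for \<Phi> \<Psi>
  proof -
    obtain m n where "t m \<^bold>\<rightarrow> \<Phi> \<in> QBKs \<sigma>" "t n \<^bold>\<rightarrow> \<Psi> \<in> QBKs \<sigma>" using \<open>\<Phi> \<in> T\<close> \<open>\<Psi> \<in> T\<close> by (auto simp: T_def)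
    then have "t (max m n) \<^bold>\<rightarrow> \<Phi> \<in> QBKs \<sigma>" "t (max m n) \<^bold>\<rightarrow> \<Psi> \<in> QBKs \<sigma>"
      using chain trans by (meson max.cobounded1 max.cobounded2)+
    then have "t (max m n) \<^bold>\<rightarrow> \<Phi> \<^bold>\<and> \<Psi> \<in> QBKs \<sigma>"
      by (intro QBKs.tautological_consequence[of "[t (max m n) \<^bold>\<rightarrow> \<Phi>, t (max m n) \<^bold>\<rightarrow> \<Psi>]"])
        (auto dest: QBKs_Form)
    then show ?thesis using that by (auto simp: T_def)
  qed
  moreover have "\<Psi> \<in> T" if "\<Phi> \<in> T" "\<Psi> \<in> Sent \<sigma>" "\<Phi> \<^bold>\<rightarrow> \<Psi> \<in> QBKs \<sigma>" for \<Phi> \<Psi>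
    using that trans by (auto simp: T_def)
  moreover have "\<Phi> \<in> T \<or> \<^bold>\<not> \<Phi> \<in> T" if "\<Phi> \<in> Sent \<sigma>" for \<Phi>
    using that s_surj[OF that] t(5) by (auto simp: T_def decides_def)
  moreover have "\<exists>c \<in> consts_of \<sigma>. subst \<Phi> x (Const c) \<in> T" if E: "Exists x \<Phi> \<in> T" for x \<Phi>
  proof -
    have ES: "Exists x \<Phi> \<in> Sent \<sigma>" using E by (simp add: T_def)
    obtain m where m: "t m \<^bold>\<rightarrow> Exists x \<Phi> \<in> QBKs \<sigma>" using E by (auto simp: T_def)
    obtain n where n: "Exists x \<Phi> = s n" using s_surj[OF ES] by blast
    \<comment> \<open>Step \<open>n\<close> decided this very sentence. A negative verdict would
      contradict stage \<open>m\<close> at the maximum of the two stages, so the affirmative one,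
      with its witness, was reached.\<close>
    have "t (Suc n) \<^bold>\<rightarrow> \<^bold>\<not> Exists x \<Phi> \<notin> QBKs \<sigma>"
    proof
      assume A: "t (Suc n) \<^bold>\<rightarrow> \<^bold>\<not> Exists x \<Phi> \<in> QBKs \<sigma>"
      let ?k = "max m (Suc n)"
      have "t ?k \<^bold>\<rightarrow> Exists x \<Phi> \<in> QBKs \<sigma>" "t ?k \<^bold>\<rightarrow> \<^bold>\<not> Exists x \<Phi> \<in> QBKs \<sigma>"
        using m A chain trans by (meson max.cobounded1 max.cobounded2)+
      then have "t ?k \<^bold>\<rightarrow> \<^bold>\<bottom> \<in> QBKs \<sigma>"
        by (intro QBKs.tautological_consequence[of "[t ?k \<^bold>\<rightarrow> Exists x \<Phi>, t ?k \<^bold>\<rightarrow> \<^bold>\<not> Exists x \<Phi>]"])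
          (auto simp: tF)
      then show False using mono[of "t ?k" "\<^bold>\<bottom>"] t(1,2) consistent by simp
    qed
    then obtain c where "c \<in> consts_of \<sigma>" "t (Suc n) \<^bold>\<rightarrow> subst \<Phi> x (Const c) \<in> QBKs \<sigma>"
      using t(5)[of n] unfolding decides_def n[symmetric] by blast
    moreover from this ES have "subst \<Phi> x (Const c) \<in> Sent \<sigma>" by (auto simp: Sent_Quant intro: subst_Sent)
    ultimately show ?thesis by (auto simp: T_def)
  qed
  moreover have "\<^bold>\<bottom> \<notin> T" using TP consistent by blast
  ultimately have "saturated \<sigma> T"
    unfolding saturated_def by (auto simp: T_def)
  moreover have "\<Theta>\<^sub>0 \<in> T" using chain[of 0 0] t(3) assms(2) by (auto simp: T_def)
  ultimately show ?thesis using TP by blast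
qed

end

section \<open>Membership in saturated theories\<close>

locale saturated_theory =
  fixes \<sigma> :: "('p, 'c) signature" and T :: "('p, 'c) fm set"
  assumes sat: "saturated \<sigma> T"
begin

lemma sentences: "T \<subseteq> Sent \<sigma>"
  and bot: "\<^bold>\<bottom> \<notin> T"
  and Conj: "\<Phi> \<in> T \<Longrightarrow> \<Psi> \<in> T \<Longrightarrow> \<Phi> \<^bold>\<and> \<Psi> \<in> T"
  and closed: "\<Phi> \<in> T \<Longrightarrow> \<Phi> \<^bold>\<rightarrow> \<Psi> \<in> QBKs \<sigma> \<Longrightarrow> \<Psi> \<in> Sent \<sigma> \<Longrightarrow> \<Psi> \<in> T"
  and complete: "\<Phi> \<in> Sent \<sigma> \<Longrightarrow> \<Phi> \<in> T \<or> \<^bold>\<not> \<Phi> \<in> T"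
  and witness: "Exists x \<Theta> \<in> T \<Longrightarrow> \<exists>c \<in> consts_of \<sigma>. subst \<Theta> x (Const c) \<in> T"
  using sat by (auto simp: saturated_def)

lemma theorem_in:
  assumes "\<Phi> \<in> QBKs \<sigma>" "\<Phi> \<in> Sent \<sigma>" shows "\<Phi> \<in> T"
proof (rule ccontr)
  assume "\<Phi> \<notin> T"
  then have "\<^bold>\<not> \<Phi> \<in> T" using complete assms by blast
  moreover have "\<^bold>\<not> \<Phi> \<^bold>\<rightarrow> \<^bold>\<bottom> \<in> QBKs \<sigma>"
    by (rule QBKs.tautological_consequence[of "[\<Phi>]"]) (use assms QBKs_Form in auto)
  ultimately show False using closed bot by auto
qed

lemma Imp_iff:
  assumes "\<Phi> \<in> Sent \<sigma>" "\<Psi> \<in> Sent \<sigma>"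
  shows "\<Phi> \<^bold>\<rightarrow> \<Psi> \<in> T \<longleftrightarrow> (\<Phi> \<in> T \<longrightarrow> \<Psi> \<in> T)"
proof
  note F = assms[THEN Sent_Form]
  show "\<Phi> \<in> T \<longrightarrow> \<Psi> \<in> T" if "\<Phi> \<^bold>\<rightarrow> \<Psi> \<in> T"
  proof
    assume "\<Phi> \<in> T"
    then have "(\<Phi> \<^bold>\<rightarrow> \<Psi>) \<^bold>\<and> \<Phi> \<in> T" using that Conj by blast
    moreover have "(\<Phi> \<^bold>\<rightarrow> \<Psi>) \<^bold>\<and> \<Phi> \<^bold>\<rightarrow> \<Psi> \<in> QBKs \<sigma>" using F by (auto intro!: QBKs.tautology)
    ultimately show "\<Psi> \<in> T" using closed assms by blast
  qed
  assume "\<Phi> \<in> T \<longrightarrow> \<Psi> \<in> T"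
  then consider "\<^bold>\<not> \<Phi> \<in> T" | "\<Psi> \<in> T" using complete assms by blast
  then show "\<Phi> \<^bold>\<rightarrow> \<Psi> \<in> T"
  proof cases
    case 1
    moreover have "\<^bold>\<not> \<Phi> \<^bold>\<rightarrow> \<Phi> \<^bold>\<rightarrow> \<Psi> \<in> QBKs \<sigma>" using F by (auto intro!: QBKs.tautology)
    ultimately show ?thesis using closed assms by simp
  next
    case 2
    moreover have "\<Psi> \<^bold>\<rightarrow> \<Phi> \<^bold>\<rightarrow> \<Psi> \<in> QBKs \<sigma>" using F by (auto intro!: QBKs.tautology)
    ultimately show ?thesis using closed assms by simp
  qed
qed

lemma Neg_iff: "\<Phi> \<in> Sent \<sigma> \<Longrightarrow> \<^bold>\<not> \<Phi> \<in> T \<longleftrightarrow> \<Phi> \<notin> T"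
  using Imp_iff[of \<Phi> "\<^bold>\<bottom>"] bot by simp

lemma closed_iff: "(\<Phi> \<^bold>\<leftrightarrow> \<Psi>) \<in> QBKs \<sigma> \<Longrightarrow> \<Phi> \<in> Sent \<sigma> \<Longrightarrow> \<Psi> \<in> Sent \<sigma> \<Longrightarrow> \<Phi> \<in> T \<longleftrightarrow> \<Psi> \<in> T"
proof -
  assume A: "(\<Phi> \<^bold>\<leftrightarrow> \<Psi>) \<in> QBKs \<sigma>" "\<Phi> \<in> Sent \<sigma>" "\<Psi> \<in> Sent \<sigma>"
  have "\<Phi> \<^bold>\<rightarrow> \<Psi> \<in> QBKs \<sigma>" "\<Psi> \<^bold>\<rightarrow> \<Phi> \<in> QBKs \<sigma>"
    by (rule QBKs.tautological_consequence[of "[\<Phi> \<^bold>\<leftrightarrow> \<Psi>]"], use QBKs_Form[OF A(1)] A(1) in auto)+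
  then show ?thesis using closed A by blast
qed

lemma Conj_iff:
  assumes "\<Phi> \<in> Sent \<sigma>" "\<Psi> \<in> Sent \<sigma>"
  shows "\<Phi> \<^bold>\<and> \<Psi> \<in> T \<longleftrightarrow> \<Phi> \<in> T \<and> \<Psi> \<in> T"
proof -
  have "(\<Phi> \<^bold>\<and> \<Psi>) \<^bold>\<rightarrow> \<Phi> \<in> QBKs \<sigma>" "(\<Phi> \<^bold>\<and> \<Psi>) \<^bold>\<rightarrow> \<Psi> \<in> QBKs \<sigma>"
    using assms[THEN Sent_Form] by (auto intro!: QBKs.tautology)
  then show ?thesis using closed assms Conj by blast
qed

lemma Disj_iff:
  assumes "\<Phi> \<in> Sent \<sigma>" "\<Psi> \<in> Sent \<sigma>"
  shows "\<Phi> \<^bold>\<or> \<Psi> \<in> T \<longleftrightarrow> \<Phi> \<in> T \<or> \<Psi> \<in> T"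
proof -
  have "(\<Phi> \<^bold>\<or> \<Psi>) \<^bold>\<leftrightarrow> (\<^bold>\<not> \<Phi> \<^bold>\<rightarrow> \<Psi>) \<in> QBKs \<sigma>"
    using assms[THEN Sent_Form] by (auto intro!: QBKs.tautology)
  from closed_iff[OF this] show ?thesis using assms Imp_iff[of "\<^bold>\<not> \<Phi>" \<Psi>] Neg_iff by auto
qed

lemma SNeg_SNeg_iff: "\<Phi> \<in> Sent \<sigma> \<Longrightarrow> \<^bold>\<sim> (\<^bold>\<sim> \<Phi>) \<in> T \<longleftrightarrow> \<Phi> \<in> T"
  using closed_iff[OF QBKs.axioms[THEN subsetD, OF QBK_axioms.SN1]] by (simp add: Sent_Form)

lemma SNeg_bot: "\<^bold>\<sim> \<^bold>\<bottom> \<in> T"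
  using theorem_in[OF QBKs.axioms[THEN subsetD, OF QBK_axioms.SN5]] by simp

lemma SNeg_iffs:
  assumes "\<Phi> \<in> Sent \<sigma>" "\<Psi> \<in> Sent \<sigma>"
  shows "\<^bold>\<sim> (\<Phi> \<^bold>\<rightarrow> \<Psi>) \<in> T \<longleftrightarrow> \<Phi> \<in> T \<and> \<^bold>\<sim> \<Psi> \<in> T"
    and "\<^bold>\<sim> (\<Phi> \<^bold>\<or> \<Psi>) \<in> T \<longleftrightarrow> \<^bold>\<sim> \<Phi> \<in> T \<and> \<^bold>\<sim> \<Psi> \<in> T"
    and "\<^bold>\<sim> (\<Phi> \<^bold>\<and> \<Psi>) \<in> T \<longleftrightarrow> \<^bold>\<sim> \<Phi> \<in> T \<or> \<^bold>\<sim> \<Psi> \<in> T"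
proof -
  note F = assms[THEN Sent_Form] and ax = QBKs.axioms[THEN subsetD]
  show "\<^bold>\<sim> (\<Phi> \<^bold>\<rightarrow> \<Psi>) \<in> T \<longleftrightarrow> \<Phi> \<in> T \<and> \<^bold>\<sim> \<Psi> \<in> T"
    using closed_iff[OF ax[OF QBK_axioms.SN2]] F assms by (simp add: Conj_iff)
  show "\<^bold>\<sim> (\<Phi> \<^bold>\<or> \<Psi>) \<in> T \<longleftrightarrow> \<^bold>\<sim> \<Phi> \<in> T \<and> \<^bold>\<sim> \<Psi> \<in> T"
    using closed_iff[OF ax[OF QBK_axioms.SN3]] F assms by (simp add: Conj_iff)
  show "\<^bold>\<sim> (\<Phi> \<^bold>\<and> \<Psi>) \<in> T \<longleftrightarrow> \<^bold>\<sim> \<Phi> \<in> T \<or> \<^bold>\<sim> \<Psi> \<in> T"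
    using closed_iff[OF ax[OF QBK_axioms.SN4]] F assms by (simp add: Disj_iff)
qed

lemma modal_iffs:
  assumes "\<Phi> \<in> Sent \<sigma>"
  shows "\<^bold>\<box> \<Phi> \<in> T \<longleftrightarrow> \<^bold>\<diamond> (\<^bold>\<not> \<Phi>) \<notin> T"
    and "\<^bold>\<diamond> \<Phi> \<in> T \<longleftrightarrow> \<^bold>\<box> (\<^bold>\<not> \<Phi>) \<notin> T"
    and "\<^bold>\<sim> (\<^bold>\<box> \<Phi>) \<in> T \<longleftrightarrow> \<^bold>\<diamond> (\<^bold>\<sim> \<Phi>) \<in> T"
    and "\<^bold>\<sim> (\<^bold>\<diamond> \<Phi>) \<in> T \<longleftrightarrow> \<^bold>\<box> (\<^bold>\<sim> \<Phi>) \<in> T"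
proof -
  note F = assms[THEN Sent_Form] and ax = QBKs.axioms[THEN subsetD]
  show "\<^bold>\<box> \<Phi> \<in> T \<longleftrightarrow> \<^bold>\<diamond> (\<^bold>\<not> \<Phi>) \<notin> T"
    using closed_iff[OF ax[OF QBK_axioms.M3[OF F]]] assms Neg_iff[of "\<^bold>\<box> \<Phi>"] by auto
  show "\<^bold>\<diamond> \<Phi> \<in> T \<longleftrightarrow> \<^bold>\<box> (\<^bold>\<not> \<Phi>) \<notin> T"
    using closed_iff[OF ax[OF QBK_axioms.M4[OF F]]] assms Neg_iff[of "\<^bold>\<diamond> \<Phi>"] by auto
  \<comment> \<open>\<open>SNeg\<close> does not respect \<open>Iff\<close>; the equivalence under
    \<open>SNeg\<close> comes from the second half of the strong equivalence
    \<open>M5\<close>.\<close>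
  have "\<^bold>\<sim> (\<^bold>\<box> \<Phi>) \<^bold>\<leftrightarrow> \<^bold>\<sim> (\<^bold>\<sim> (\<^bold>\<diamond> (\<^bold>\<sim> \<Phi>))) \<in> QBKs \<sigma>"
    by (rule QBKs.tautological_consequence[of "[\<^bold>\<box> \<Phi> \<^bold>\<Leftrightarrow> \<^bold>\<sim> (\<^bold>\<diamond> (\<^bold>\<sim> \<Phi>))]"])
      (use ax[OF QBK_axioms.M5] F in auto)
  from closed_iff[OF this] show "\<^bold>\<sim> (\<^bold>\<box> \<Phi>) \<in> T \<longleftrightarrow> \<^bold>\<diamond> (\<^bold>\<sim> \<Phi>) \<in> T"
    using assms SNeg_SNeg_iff[of "\<^bold>\<diamond> (\<^bold>\<sim> \<Phi>)"] by simp
  have "\<^bold>\<sim> (\<^bold>\<diamond> \<Phi>) \<^bold>\<leftrightarrow> \<^bold>\<sim> (\<^bold>\<sim> (\<^bold>\<box> (\<^bold>\<sim> \<Phi>))) \<in> QBKs \<sigma>"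
    by (rule QBKs.tautological_consequence[of "[\<^bold>\<diamond> \<Phi> \<^bold>\<Leftrightarrow> \<^bold>\<sim> (\<^bold>\<box> (\<^bold>\<sim> \<Phi>))]"])
      (use ax[OF QBK_axioms.M6] F in auto)
  from closed_iff[OF this] show "\<^bold>\<sim> (\<^bold>\<diamond> \<Phi>) \<in> T \<longleftrightarrow> \<^bold>\<box> (\<^bold>\<sim> \<Phi>) \<in> T"
    using assms SNeg_SNeg_iff[of "\<^bold>\<box> (\<^bold>\<sim> \<Phi>)"] by simp
qed

lemma Exists_iff:
  assumes "Exists x \<Theta> \<in> Sent \<sigma>"
  shows "Exists x \<Theta> \<in> T \<longleftrightarrow> (\<exists>c \<in> consts_of \<sigma>. subst \<Theta> x (Const c) \<in> T)"
proof
  assume "\<exists>c \<in> consts_of \<sigma>. subst \<Theta> x (Const c) \<in> T"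
  then obtain c where c: "c \<in> consts_of \<sigma>" "subst \<Theta> x (Const c) \<in> T" by blast
  have "subst \<Theta> x (Const c) \<^bold>\<rightarrow> Exists x \<Theta> \<in> QBKs \<sigma>"
    using c assms by (intro QBKs.axioms[THEN subsetD] QBK_axioms.Q2) (auto simp: Sent_Quant)
  then show "Exists x \<Theta> \<in> T" using c closed assms by blast
qed (rule witness)

lemma Forall_iff:
  assumes "Forall x \<Theta> \<in> Sent \<sigma>"
  shows "Forall x \<Theta> \<in> T \<longleftrightarrow> (\<forall>c \<in> consts_of \<sigma>. subst \<Theta> x (Const c) \<in> T)"
proof
  have \<Theta>: "\<Theta> \<in> Form \<sigma>" "fv \<Theta> \<subseteq> {x}" using assms by (auto simp: Sent_Quant)
  {
    assume A: "Forall x \<Theta> \<in> T"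
    show "\<forall>c \<in> consts_of \<sigma>. subst \<Theta> x (Const c) \<in> T"
    proof
      fix c assume c: "c \<in> consts_of \<sigma>"
      then have "Forall x \<Theta> \<^bold>\<rightarrow> subst \<Theta> x (Const c) \<in> QBKs \<sigma>"
        using \<Theta> by (intro QBKs.axioms[THEN subsetD] QBK_axioms.Q1) auto
      then show "subst \<Theta> x (Const c) \<in> T" using A closed subst_Sent[OF \<Theta> c] by blast
    qed
  next
    assume A: "\<forall>c \<in> consts_of \<sigma>. subst \<Theta> x (Const c) \<in> T"
    \<comment> \<open>Saturation supplies witnesses for existential sentences only, so a failure of
      the universal sentence is expressed as \<open>?E\<close>, which would have a witness.\<close>
    let ?E = "Exists x (\<^bold>\<not> \<Theta>)"
    have E: "?E \<in> Sent \<sigma>" using \<Theta> by (simp add: Sent_Quant)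
    have "subst (\<^bold>\<not> \<Theta>) x (Const c) \<notin> T" if "c \<in> consts_of \<sigma>" for c
      using Neg_iff[OF subst_Sent[OF \<Theta> that]] A that by simp
    then have "?E \<notin> T" using Exists_iff[OF E] by blast
    then have nE: "\<^bold>\<not> ?E \<in> T" using E complete by blast
    have "subst (\<^bold>\<not> \<Theta>) x (Var x) \<^bold>\<rightarrow> ?E \<in> QBKs \<sigma>"
      using \<Theta> by (intro QBKs.axioms[THEN subsetD] QBK_axioms.Q2) auto
    then have "\<^bold>\<not> \<Theta> \<^bold>\<rightarrow> ?E \<in> QBKs \<sigma>" by (simp only: subst_self)
    then have "\<^bold>\<not> ?E \<^bold>\<rightarrow> \<Theta> \<in> QBKs \<sigma>"
      by (intro QBKs.tautological_consequence[of "[\<^bold>\<not> \<Theta> \<^bold>\<rightarrow> ?E]"]) (use \<Theta> in auto)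
    then have "\<^bold>\<not> ?E \<^bold>\<rightarrow> Forall x \<Theta> \<in> QBKs \<sigma>" by (rule QBKs.BR1) simp
    then show "Forall x \<Theta> \<in> T" using nE closed assms by blast
  }
qed

lemma SNeg_Quant_iffs:
  assumes "Exists x \<Theta> \<in> Sent \<sigma>"
  shows "\<^bold>\<sim> (Exists x \<Theta>) \<in> T \<longleftrightarrow> (\<forall>c \<in> consts_of \<sigma>. \<^bold>\<sim> subst \<Theta> x (Const c) \<in> T)"
    and "\<^bold>\<sim> (Forall x \<Theta>) \<in> T \<longleftrightarrow> (\<exists>c \<in> consts_of \<sigma>. \<^bold>\<sim> subst \<Theta> x (Const c) \<in> T)"
proof -
  have \<Theta>: "\<Theta> \<in> Form \<sigma>" "fv \<Theta> \<subseteq> {x}" using assms by (auto simp: Sent_Quant)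
  note ax = QBKs.axioms[THEN subsetD]
  show "\<^bold>\<sim> (Exists x \<Theta>) \<in> T \<longleftrightarrow> (\<forall>c \<in> consts_of \<sigma>. \<^bold>\<sim> subst \<Theta> x (Const c) \<in> T)"
    using closed_iff[OF ax[OF QBK_axioms.Q4[OF \<Theta>(1), of x]]] Forall_iff[of x "\<^bold>\<sim> \<Theta>"] \<Theta>
    by (simp add: Sent_Quant)
  show "\<^bold>\<sim> (Forall x \<Theta>) \<in> T \<longleftrightarrow> (\<exists>c \<in> consts_of \<sigma>. \<^bold>\<sim> subst \<Theta> x (Const c) \<in> T)"
    using closed_iff[OF ax[OF QBK_axioms.Q3[OF \<Theta>(1), of x]]] Exists_iff[of x "\<^bold>\<sim> \<Theta>"] \<Theta>
    by (simp add: Sent_Quant)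
qed

text \<open>The existence lemma of modal canonical models. Its last conjunct is the accessibility
  condition of the model built later.\<close>

lemma successor:
  assumes "countable (Sent \<sigma>)" "\<^bold>\<diamond> \<Phi> \<in> T" "\<Phi> \<in> Sent \<sigma>"
  shows "\<exists>T'. saturated \<sigma> T' \<and> \<Phi> \<in> T' \<and> (\<forall>\<Psi> \<in> T'. \<^bold>\<diamond> \<Psi> \<in> T)"
proof -
  have "acceptance \<sigma> (\<lambda>\<Phi>. \<^bold>\<diamond> \<Phi> \<in> T)"
  proof
    show "countable (Sent \<sigma>)" by fact
    show "\<^bold>\<diamond> \<Psi> \<in> T" if "\<^bold>\<diamond> \<Phi> \<in> T" "\<Phi> \<in> Sent \<sigma>" "\<Psi> \<in> Sent \<sigma>" "\<Phi> \<^bold>\<rightarrow> \<Psi> \<in> QBKs \<sigma>" for \<Phi> \<Psi>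
      using closed[OF that(1) QBKs.MD[OF that(4)]] that(3) by simp
    show "\<^bold>\<diamond> \<^bold>\<bottom> \<notin> T"
    proof -
      \<comment> \<open>This instance of \<open>M2\<close> is literally \<open>Box\<close> of a
        negated falsum, so \<open>M4\<close> rules out \<open>Dia\<close> of falsum.\<close>
      have "\<^bold>\<box> (\<^bold>\<bottom> \<^bold>\<rightarrow> \<^bold>\<bottom>) \<in> T"
        by (rule theorem_in) (auto intro!: QBKs.axioms[THEN subsetD] QBK_axioms.M2)
      then show ?thesis using modal_iffs(2)[of "\<^bold>\<bottom>"] by simp
    qed
    \<comment> \<open>Distribution of \<open>Dia\<close> over disjunction, by duality: if both cases
      were impossible, \<open>M1\<close> would join their boxed negations, which exclude \<Phi>
      itself.\<close>
    show "\<^bold>\<diamond> (\<Phi> \<^bold>\<and> \<Psi>) \<in> T \<or> \<^bold>\<diamond> (\<Phi> \<^bold>\<and> \<^bold>\<not> \<Psi>) \<in> T"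
      if "\<^bold>\<diamond> \<Phi> \<in> T" "\<Phi> \<in> Sent \<sigma>" "\<Psi> \<in> Sent \<sigma>" for \<Phi> \<Psi>
    proof (rule ccontr)
      assume *: "\<not> ?thesis"
      note F = that(2,3)[THEN Sent_Form]
      let ?A = "\<^bold>\<not> (\<Phi> \<^bold>\<and> \<Psi>)" and ?B = "\<^bold>\<not> (\<Phi> \<^bold>\<and> \<^bold>\<not> \<Psi>)"
      have "\<^bold>\<box> ?A \<in> T" "\<^bold>\<box> ?B \<in> T"
        using * that modal_iffs(2)[of "\<Phi> \<^bold>\<and> \<Psi>"] modal_iffs(2)[of "\<Phi> \<^bold>\<and> \<^bold>\<not> \<Psi>"] by auto
      then have "\<^bold>\<box> ?A \<^bold>\<and> \<^bold>\<box> ?B \<in> T" by (rule Conj)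
      moreover have "\<^bold>\<box> ?A \<^bold>\<and> \<^bold>\<box> ?B \<^bold>\<rightarrow> \<^bold>\<box> (?A \<^bold>\<and> ?B) \<in> QBKs \<sigma>"
        using F by (intro QBKs.axioms[THEN subsetD] QBK_axioms.M1) auto
      ultimately have "\<^bold>\<box> (?A \<^bold>\<and> ?B) \<in> T" by (rule closed) (use that in simp)
      moreover have "?A \<^bold>\<and> ?B \<^bold>\<rightarrow> \<^bold>\<not> \<Phi> \<in> QBKs \<sigma>" using F by (auto intro!: QBKs.tautology)
      then have "\<^bold>\<box> (?A \<^bold>\<and> ?B) \<^bold>\<rightarrow> \<^bold>\<box> (\<^bold>\<not> \<Phi>) \<in> QBKs \<sigma>" by (rule QBKs.MB)
      ultimately have "\<^bold>\<box> (\<^bold>\<not> \<Phi>) \<in> T" by (rule closed) (use that in simp)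
      then show False using modal_iffs(2)[OF that(2)] that(1) by simp
    qed
    show "\<exists>c \<in> consts_of \<sigma>. \<^bold>\<diamond> subst \<Theta> x (Const c) \<in> T"
      if "\<^bold>\<diamond> Exists x \<Theta> \<in> T" "Exists x \<Theta> \<in> Sent \<sigma>" for x \<Theta>
    proof -
      have "\<^bold>\<diamond> (Exists x \<Theta>) \<^bold>\<rightarrow> Exists x (\<^bold>\<diamond> \<Theta>) \<in> QBKs \<sigma>" "Exists x (\<^bold>\<diamond> \<Theta>) \<in> Sent \<sigma>"
        using that(2) by (auto simp: Sent_Quant intro: QBKs.Barcan)
      then have "Exists x (\<^bold>\<diamond> \<Theta>) \<in> T" using that closed by blast
      from witness[OF this] show ?thesis by simp
    qed
  qed
  then interpret acceptance \<sigma> "\<lambda>\<Phi>. \<^bold>\<diamond> \<Phi> \<in> T" .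
  show ?thesis using saturated_extension assms by blast
qed

end

subsection \<open>The canonical model\<close>

lemma Inr_expand: "Inr a \<in> consts_of (expand \<sigma> A) \<longleftrightarrow> a \<in> A"
  by (auto simp: expand_def)

lemma lift_Form: "\<Phi> \<in> Form \<sigma> \<Longrightarrow> lift \<Phi> \<in> Form (expand \<sigma> A)"
proof (induction \<Phi>)
  case (Atom P ts)
  have "is_term (expand \<sigma> A) (map_tm Inl t)" if "t \<in> set ts" for t
    using Atom that by (cases t) (auto simp: Form_def expand_def)
  then show ?case using Atom by (auto simp: Form_def expand_def)
qed auto

lemma lift_Sent: "\<Phi> \<in> Sent \<sigma> \<Longrightarrow> lift \<Phi> \<in> Sent (expand \<sigma> A)"
  by (simp add: Sent_def lift_Form)

lemma ground_Sent:
  assumes "\<Phi> \<in> Form \<sigma>" "\<And>x. \<rho> x \<in> consts_of (expand \<sigma> A)"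
  shows "msubst (Const \<circ> \<rho>) (lift \<Phi>) \<in> Sent (expand \<sigma> A)"
proof -
  have "fv (msubst (Const \<circ> \<rho>) (lift \<Phi>)) = {}"
    using fv_msubst[of "Const \<circ> \<rho>" "lift \<Phi>"] by simp
  moreover have "is_form (expand \<sigma> A) (msubst (Const \<circ> \<rho>) (lift \<Phi>))"
    using lift_Form[OF assms(1)] assms(2) by (intro is_form_msubst) (auto simp: Form_def)
  ultimately show ?thesis by (simp add: Sent_def Form_def)
qed

lemma set2_fm_lift: "set2_fm (lift \<Phi>) \<subseteq> range Inl"
  by (auto simp: lift_def fm.set_map)

lemma set2_fm_msubst: "set2_fm (msubst \<theta> \<Phi>) \<subseteq> set2_fm \<Phi> \<union> (\<Union>x. set_tm (\<theta> x))"
proof (induction \<Phi> arbitrary: \<theta>)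
  case (Atom P ts)
  have "set_tm (subst_tm \<theta> t) \<subseteq> set_tm t \<union> (\<Union>x. set_tm (\<theta> x))" for t
    by (cases t) auto
  then show ?case by fastforce
next
  case (Forall x \<Phi>)
  have "(\<Union>z. set_tm ((\<theta>(x := Var x)) z)) \<subseteq> (\<Union>z. set_tm (\<theta> z))"
    by (auto split: if_splits)
  from order_trans[OF Forall[of "\<theta>(x := Var x)"] Un_mono[OF order_refl this]]
  show ?case by (simp del: fun_upd_apply)
next
  case (Exists x \<Phi>)
  have "(\<Union>z. set_tm ((\<theta>(x := Var x)) z)) \<subseteq> (\<Union>z. set_tm (\<theta> z))"
    by (auto split: if_splits)
  from order_trans[OF Exists[of "\<theta>(x := Var x)"] Un_mono[OF order_refl this]]
  show ?case by (simp del: fun_upd_apply)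
qed (simp; blast)+

lemma finite_set2_fm: "finite (set2_fm \<Phi>)"
proof -
  have "finite (set_tm t)" for t :: "'b tm" by (cases t) auto
  then show ?thesis by (induction \<Phi>) auto
qed

section \<open>The theory at the root\<close>

context
  fixes \<sigma> :: "('p, 'c) signature" and \<Gamma> \<Delta> :: "('p, 'c) fm set"
  assumes \<Gamma>: "\<Gamma> \<subseteq> Sent \<sigma>" and \<Delta>: "\<Delta> \<subseteq> Form \<sigma>"
begin

private abbreviation (input) "\<sigma>' \<equiv> expand \<sigma> (UNIV :: nat set)"
private abbreviation (input) "\<Gamma>' \<equiv> lift ` \<Gamma> :: ('p, 'c + nat) fm set"

text \<open>
  The even new constants name the free variables of \<open>\<Delta>\<close>; the odd ones remain as fresh witnesses.
\<close>

private definition inst :: "('p, 'c) fm \<Rightarrow> ('p, 'c + nat) fm" where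
  "inst \<Psi> = msubst (Const \<circ> (\<lambda>x. Inr (2 * x))) (lift \<Psi>)"

text \<open>The lists stand for finite subsets of \<Delta>. The empty list makes acceptable
  sentences consistent with \<Gamma>, even when \<Delta> is empty.\<close>

private definition acceptable :: "('p, 'c + nat) fm \<Rightarrow> bool" where
  "acceptable \<Theta> \<longleftrightarrow>
    (\<forall>\<Psi>s. set \<Psi>s \<subseteq> \<Delta> \<longrightarrow> \<Theta> \<^bold>\<rightarrow> inst (big_disj \<Psi>s) \<notin> consequences \<sigma>' \<Gamma>')"

private lemma inst_big_disj: "inst (big_disj \<Psi>s) = big_disj (map inst \<Psi>s)"
  by (rule big_disj_hom) (simp_all add: inst_def)

private lemma \<Gamma>'_Form: "\<Gamma>' \<subseteq> Form \<sigma>'"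
  using \<Gamma> lift_Sent Sent_Form by blast

private lemma inst_Sent: "\<Psi> \<in> Form \<sigma> \<Longrightarrow> inst \<Psi> \<in> Sent \<sigma>'"
  unfolding inst_def by (rule ground_Sent) (auto simp: expand_def)

private lemma inst_disj_Sent: "set \<Psi>s \<subseteq> \<Delta> \<Longrightarrow> inst (big_disj \<Psi>s) \<in> Sent \<sigma>'"
  using \<Delta> by (intro inst_Sent big_disj_Form) auto

private lemma tv_inst_disj: "tv v (inst (big_disj \<Psi>s)) \<longleftrightarrow> (\<exists>\<Psi> \<in> set \<Psi>s. tv v (inst \<Psi>))"
  by (simp add: inst_big_disj tv_big_disj)

interpretation C: logic \<sigma>' "consequences \<sigma>' \<Gamma>'"
  by (rule logic_consequences[OF \<Gamma>'_Form])

private lemma acceptable_witness: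
  assumes "acceptable (Exists x \<Theta>)" "Exists x \<Theta> \<in> Sent \<sigma>'"
  shows "\<exists>c \<in> consts_of \<sigma>'. acceptable (subst \<Theta> x (Const c))"
proof (rule ccontr)
  assume *: "\<not> ?thesis"
  \<comment> \<open>Only finitely many constants occur in \<Theta>. The premises contain no new
    constant and \<open>inst\<close> uses even ones only, so an odd constant missing from \<Theta>
    is fresh for the whole implication apart from the instance itself.\<close>
  have "infinite (range (\<lambda>n. Inr (2 * n + 1) :: 'c + nat))"
    by (rule range_inj_infinite) (auto simp: inj_on_def)
  then have "\<not> range (\<lambda>n. Inr (2 * n + 1) :: 'c + nat) \<subseteq> set2_fm \<Theta>"
    using finite_subset[OF _ finite_set2_fm[of \<Theta>]] by metis
  then obtain n where n: "Inr (2 * n + 1) \<notin> set2_fm \<Theta>" by auto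
  define c :: "'c + nat" where "c = Inr (2 * n + 1)"
  have "c \<in> consts_of \<sigma>'" by (simp add: c_def expand_def)
  with * obtain \<Psi>s where \<Psi>s: "set \<Psi>s \<subseteq> \<Delta>"
    and der: "subst \<Theta> x (Const c) \<^bold>\<rightarrow> inst (big_disj \<Psi>s) \<in> consequences \<sigma>' \<Gamma>'"
    unfolding acceptable_def by blast
  let ?D = "inst (big_disj \<Psi>s)"
  have D: "?D \<in> Sent \<sigma>'" using inst_disj_Sent \<Psi>s .
  obtain K where K: "finite K" "\<And>f. renaming \<sigma>' \<sigma>' K f \<Longrightarrow> repl f ` \<Gamma>' \<subseteq> \<Gamma>' \<Longrightarrow>
      repl f (subst \<Theta> x (Const c) \<^bold>\<rightarrow> ?D) \<in> consequences \<sigma>' \<Gamma>'"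
    using repl_consequences[OF refl refl der, of \<Gamma>'] by metis
  obtain y where y: "y \<notin> K \<union> allvars (\<Theta> \<^bold>\<rightarrow> ?D)"
    using ex_new_if_finite[OF infinite_UNIV_nat] K(1) finite_allvars by (metis finite_Un)
  define f :: "'c + nat \<Rightarrow> ('c + nat) tm" where "f = Const(c := Var y)"
  have f_Const: "f d = Const d" if "d \<noteq> c" for d using that by (simp add: f_def)
  have "renaming \<sigma>' \<sigma>' K f"
    using y by (auto simp: renaming_def f_def)
  moreover have "repl f (lift \<gamma>) = lift \<gamma>" for \<gamma> :: "('p, 'c) fm"
    by (rule repl_fresh) (use set2_fm_lift[of \<gamma>] in \<open>auto simp: f_def c_def\<close>)
  then have "repl f ` \<Gamma>' \<subseteq> \<Gamma>'" by auto
  ultimately have "repl f (subst \<Theta> x (Const c)) \<^bold>\<rightarrow> repl f ?D \<in> consequences \<sigma>' \<Gamma>'"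
    using K(2) by simp
  moreover have "repl f ?D = ?D"
  proof (rule repl_fresh)
    fix d assume "d \<in> set2_fm ?D"
    then have "d \<in> range Inl \<union> (\<Union>x. {Inr (2 * x)})"
      using set2_fm_msubst[of "Const \<circ> (\<lambda>x. Inr (2 * x))" "lift (big_disj \<Psi>s) :: ('p, 'c + nat) fm"]
        set2_fm_lift[of "big_disj \<Psi>s"] by (fastforce simp: inst_def)
    then have "d \<noteq> c" unfolding c_def by auto presburger
    then show "f d = Const d" by (rule f_Const)
  qed
  moreover have "repl f (subst \<Theta> x (Const c)) = msubst (Var(x := Var y)) \<Theta>"
  proof -
    have "repl_tm f \<circ> Var(x := Const c) = Var(x := Var y)" by (auto simp: f_def)
    then show ?thesis
      using repl_msubst[of \<Theta> f "Var(x := Const c)"] n f_Const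
      by (metis c_def subst_def)
  qed
  moreover have "msubst \<theta> ?D = ?D" for \<theta> using D by (simp add: Sent_def msubst_closed)
  ultimately have "msubst (Var(x := Var y)) (\<Theta> \<^bold>\<rightarrow> ?D) \<in> consequences \<sigma>' \<Gamma>'" by simp
  moreover have "Var(x := Var y) = (\<lambda>z. if z \<in> {x} then Var y else Var z :: ('c + nat) tm)" by auto
  ultimately have "msubst (\<lambda>z. if z \<in> {x} then Var y else Var z) (\<Theta> \<^bold>\<rightarrow> ?D) \<in> consequences \<sigma>' \<Gamma>'"
    by (simp only:)
  \<comment> \<open>With \<open>y\<close> turned back into the bound variable \<open>x\<close>,
    \<open>BR2\<close> becomes applicable, as \<open>?D\<close> is closed.\<close>
  then have "\<Theta> \<^bold>\<rightarrow> ?D \<in> consequences \<sigma>' \<Gamma>'"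
    using consequences_rename_back[of "{x}" \<Gamma>' \<sigma>' "\<lambda>_. y" "\<Theta> \<^bold>\<rightarrow> ?D"] \<Gamma>'_Form y by auto
  then have "Exists x \<Theta> \<^bold>\<rightarrow> ?D \<in> consequences \<sigma>' \<Gamma>'"
    by (rule consequences.BR2) (use D in \<open>simp add: Sent_def\<close>)
  then show False using assms(1) \<Psi>s unfolding acceptable_def by blast
qed

text \<open>Conservativity of the new constants: a derivation over the expanded signature becomes
  one over \<sigma> when they turn into fresh variables, which are then renamed to the variables
  that the constants stood for.\<close>

private lemma acceptable_top:
  assumes "\<not> derives \<sigma> \<Gamma> \<Delta>"
  shows "acceptable (\<^bold>\<bottom> \<^bold>\<rightarrow> \<^bold>\<bottom>)"
  unfolding acceptable_def
proof (intro allI impI notI)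
  fix \<Psi>s assume \<Psi>s: "set \<Psi>s \<subseteq> \<Delta>"
    and der: "(\<^bold>\<bottom> \<^bold>\<rightarrow> \<^bold>\<bottom>) \<^bold>\<rightarrow> inst (big_disj \<Psi>s) \<in> consequences \<sigma>' \<Gamma>'"
  let ?B = "big_disj \<Psi>s"
  have "inst ?B \<in> consequences \<sigma>' \<Gamma>'"
    by (rule C.tautological_consequence[of "[(\<^bold>\<bottom> \<^bold>\<rightarrow> \<^bold>\<bottom>) \<^bold>\<rightarrow> inst ?B]"])
      (use der inst_disj_Sent[OF \<Psi>s] Sent_Form in auto)
  moreover have "preds \<sigma>' = preds \<sigma>" "arity \<sigma>' = arity \<sigma>" by (simp_all add: expand_def)
  ultimately obtain K where K: "finite K" "\<And>f. renaming \<sigma>' \<sigma> K f \<Longrightarrow> repl f ` \<Gamma>' \<subseteq> \<Gamma> \<Longrightarrow>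
      repl f (inst ?B) \<in> consequences \<sigma> \<Gamma>"
    using repl_consequences[of \<sigma>' \<sigma> "inst ?B" \<Gamma>' \<Gamma>] by metis
  have "finite (K \<union> allvars ?B)" using K(1) finite_allvars by simp
  then obtain m where m: "\<And>k. k \<in> K \<union> allvars ?B \<Longrightarrow> k < m"
    unfolding finite_nat_set_iff_bounded by blast
  \<comment> \<open>The shift by \<open>m\<close> moves the variables beyond \<open>K\<close> and
    those of \<open>?B\<close>. Halving sends the constant \<open>2 * x\<close> to the variable
    \<open>m + x\<close>; odd constants do not occur in \<open>inst ?B\<close>, so they may share
    these variables.\<close>
  define f :: "'c + nat \<Rightarrow> 'c tm" where "f = case_sum Const (\<lambda>n. Var (m + n div 2))"
  have "renaming \<sigma>' \<sigma> K f"
    unfolding renaming_def f_def using m by (fastforce simp: expand_def split: sum.splits)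
  moreover have "repl f (msubst \<theta> (lift \<gamma>)) = msubst (repl_tm f \<circ> \<theta>) \<gamma>" for \<gamma> :: "('p, 'c) fm" and \<theta>
    unfolding lift_def by (rule repl_msubst_map) (simp add: f_def)
  note repl_lift = this
  have "repl_tm f \<circ> Var = Var" by auto
  then have "repl f (lift \<gamma>) = \<gamma>" for \<gamma> :: "('p, 'c) fm"
    using repl_lift[of Var \<gamma>] by (simp del: comp_apply)
  then have "repl f ` \<Gamma>' \<subseteq> \<Gamma>" by auto
  ultimately have "repl f (inst ?B) \<in> consequences \<sigma> \<Gamma>" using K(2) by blast
  moreover have "repl f (inst ?B) = msubst (\<lambda>x. if x \<in> fv ?B then Var (m + x) else Var x) ?B"
    unfolding inst_def repl_lift by (rule msubst_cong) (simp add: f_def)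
  ultimately have "?B \<in> consequences \<sigma> \<Gamma>"
    using consequences_rename_back[of "fv ?B" \<Gamma> \<sigma> "\<lambda>x. m + x" ?B] \<Gamma> m Sent_Form finite_fv
    by (force simp: inj_on_def)
  then show False using assms \<Psi>s unfolding derives_def Disjs_def by blast
qed

lemma root_theory:
  assumes "countable (Sent \<sigma>')" "\<not> derives \<sigma> \<Gamma> \<Delta>"
  shows "\<exists>T. saturated \<sigma>' T \<and> lift ` \<Gamma> \<subseteq> T \<and>
    (\<forall>\<Psi> \<in> \<Delta>. msubst (Const \<circ> (\<lambda>x. Inr (2 * x))) (lift \<Psi>) \<notin> T)"
proof -
  interpret acceptance \<sigma>' acceptable
  proof
    show "countable (Sent \<sigma>')" by fact
    show "acceptable \<Psi>"
      if "acceptable \<Phi>" "\<Phi> \<in> Sent \<sigma>'" "\<Psi> \<in> Sent \<sigma>'" "\<Phi> \<^bold>\<rightarrow> \<Psi> \<in> QBKs \<sigma>'" for \<Phi> \<Psi>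
      unfolding acceptable_def
    proof (intro allI impI notI)
      fix \<Psi>s assume \<Psi>s: "set \<Psi>s \<subseteq> \<Delta>" and "\<Psi> \<^bold>\<rightarrow> inst (big_disj \<Psi>s) \<in> consequences \<sigma>' \<Gamma>'"
      then have "\<Phi> \<^bold>\<rightarrow> inst (big_disj \<Psi>s) \<in> consequences \<sigma>' \<Gamma>'"
        by (intro C.tautological_consequence[of "[\<Phi> \<^bold>\<rightarrow> \<Psi>, \<Psi> \<^bold>\<rightarrow> inst (big_disj \<Psi>s)]"])
          (use that inst_disj_Sent[OF \<Psi>s] Sent_Form in \<open>auto intro: consequences.Logic\<close>)
      then show False using that(1) \<Psi>s unfolding acceptable_def by blast
    qed
    show "acceptable (\<Phi> \<^bold>\<and> \<Psi>) \<or> acceptable (\<Phi> \<^bold>\<and> \<^bold>\<not> \<Psi>)"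
      if A: "acceptable \<Phi>" "\<Phi> \<in> Sent \<sigma>'" "\<Psi> \<in> Sent \<sigma>'" for \<Phi> \<Psi>
    proof (rule ccontr)
      assume "\<not> ?thesis"
      then obtain xs ys where xs: "set xs \<subseteq> \<Delta>" "set ys \<subseteq> \<Delta>"
        "\<Phi> \<^bold>\<and> \<Psi> \<^bold>\<rightarrow> inst (big_disj xs) \<in> consequences \<sigma>' \<Gamma>'"
        "\<Phi> \<^bold>\<and> \<^bold>\<not> \<Psi> \<^bold>\<rightarrow> inst (big_disj ys) \<in> consequences \<sigma>' \<Gamma>'"
        unfolding acceptable_def by blast
      \<comment> \<open>One disjunction for both cases: the concatenated list covers the disjuncts
        of each.\<close>
      have D: "inst (big_disj (xs @ ys)) \<in> Form \<sigma>'"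
        using inst_disj_Sent[of "xs @ ys"] xs Sent_Form by simp
      have "\<Phi> \<^bold>\<rightarrow> inst (big_disj (xs @ ys)) \<in> consequences \<sigma>' \<Gamma>'"
        by (rule C.tautological_consequence[of "[\<Phi> \<^bold>\<and> \<Psi> \<^bold>\<rightarrow> inst (big_disj xs),
              \<Phi> \<^bold>\<and> \<^bold>\<not> \<Psi> \<^bold>\<rightarrow> inst (big_disj ys)]"])
          (use A D xs in \<open>auto simp: tv_inst_disj Sent_Form\<close>)
      then show False using A(1) xs unfolding acceptable_def by (metis Un_least set_append)
    qed
    show "\<not> acceptable \<^bold>\<bottom>"
    proof -
      have "\<^bold>\<bottom> \<^bold>\<rightarrow> inst (big_disj []) \<in> consequences \<sigma>' \<Gamma>'"
        using inst_disj_Sent[of "[]"] Sent_Form by (intro C.tautology) auto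
      then show ?thesis unfolding acceptable_def by (metis empty_subsetI list.set(1))
    qed
  qed (rule acceptable_witness)
  obtain T where T: "saturated \<sigma>' T" "\<And>\<Phi>. \<Phi> \<in> T \<Longrightarrow> acceptable \<Phi>"
    using saturated_extension[OF acceptable_top[OF assms(2)]] by auto
  interpret T: saturated_theory \<sigma>' T by unfold_locales fact
  \<comment> \<open>The construction starts from a trivial sentence, so premises get in through
    completeness of \<open>T\<close>: the negation of one would imply the empty disjunction.\<close>
  have "lift \<gamma> \<in> T" if "\<gamma> \<in> \<Gamma>" for \<gamma>
  proof (rule ccontr)
    have S: "lift \<gamma> \<in> Sent \<sigma>'" using that \<Gamma> lift_Sent by blast
    assume "lift \<gamma> \<notin> T"
    then have "\<^bold>\<not> lift \<gamma> \<in> T" using T.complete S by blast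
    moreover have "\<^bold>\<not> lift \<gamma> \<^bold>\<rightarrow> inst (big_disj []) \<in> consequences \<sigma>' \<Gamma>'"
      by (rule C.tautological_consequence[of "[lift \<gamma>]"])
        (use that S inst_disj_Sent[of "[]"] in \<open>auto simp: Sent_Form intro: consequences.Prem\<close>)
    ultimately show False using T(2) unfolding acceptable_def by (metis empty_subsetI list.set(1))
  qed
  moreover have "inst \<Psi> \<notin> T" if "\<Psi> \<in> \<Delta>" for \<Psi>
  proof
    assume "inst \<Psi> \<in> T"
    moreover have "inst \<Psi> \<^bold>\<rightarrow> inst (big_disj [\<Psi>]) \<in> consequences \<sigma>' \<Gamma>'"
      using inst_Sent[of \<Psi>] that \<Delta> Sent_Form by (intro C.tautology) auto
    moreover have "set [\<Psi>] \<subseteq> \<Delta>" using that by simp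
    ultimately show False using T(2) unfolding acceptable_def by blast
  qed
  ultimately show ?thesis using T(1) unfolding inst_def by blast
qed

end

section \<open>A countable tree of theories\<close>

text \<open>Nodes are finite lists of sentence numbers: \<open>n # l\<close> is the child of
  \<open>l\<close> that realises sentence number \<open>n\<close>. There are countably many such
  lists, so they embed into any infinite type.\<close>

lemma world_tree:
  fixes T\<^sub>0 :: "('p, 'c) fm set"
  assumes "countable (Sent \<sigma>)" "saturated \<sigma> T\<^sub>0" "infinite (UNIV :: 'w set)"
  shows "\<exists>(W :: 'w set) th w\<^sub>0. w\<^sub>0 \<in> W \<and> th w\<^sub>0 = T\<^sub>0 \<and> (\<forall>w \<in> W. saturated \<sigma> (th w)) \<and>
    (\<forall>w \<in> W. \<forall>\<Phi>. \<^bold>\<diamond> \<Phi> \<in> th w \<longrightarrow> (\<exists>u \<in> W. \<Phi> \<in> th u \<and> (\<forall>\<Psi> \<in> th u. \<^bold>\<diamond> \<Psi> \<in> th w)))"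
proof -
  define s where "s = from_nat_into (Sent \<sigma>)"
  define succ where "succ T \<Phi> = (SOME T'. saturated \<sigma> T' \<and> \<Phi> \<in> T' \<and> (\<forall>\<Psi> \<in> T'. \<^bold>\<diamond> \<Psi> \<in> T))" for T \<Phi>
  have succ: "saturated \<sigma> (succ T \<Phi>) \<and> \<Phi> \<in> succ T \<Phi> \<and> (\<forall>\<Psi> \<in> succ T \<Phi>. \<^bold>\<diamond> \<Psi> \<in> T)"
    if "saturated \<sigma> T" "\<^bold>\<diamond> \<Phi> \<in> T" for T \<Phi>
  proof -
    interpret saturated_theory \<sigma> T by unfold_locales fact
    have "\<Phi> \<in> Sent \<sigma>" using that(2) sentences by auto
    then show ?thesis
      unfolding succ_def using successor[OF assms(1) that(2)] by (rule_tac someI_ex) blast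
  qed
  \<comment> \<open>If the sentence is not possible at the parent, the node is filled with
    \<open>T\<^sub>0\<close>, so that every list carries a saturated theory.\<close>
  define tree where "tree = rec_list T\<^sub>0 (\<lambda>n l T. if \<^bold>\<diamond> (s n) \<in> T then succ T (s n) else T\<^sub>0)"
  have tree: "tree [] = T\<^sub>0" "tree (n # l) = (if \<^bold>\<diamond> (s n) \<in> tree l then succ (tree l) (s n) else T\<^sub>0)" for n l
    by (simp_all add: tree_def)
  have saturated: "saturated \<sigma> (tree l)" for l
    by (induction l) (auto simp: tree assms(2) succ)
  have successor: "\<exists>l'. \<Phi> \<in> tree l' \<and> (\<forall>\<Psi> \<in> tree l'. \<^bold>\<diamond> \<Psi> \<in> tree l)" if "\<^bold>\<diamond> \<Phi> \<in> tree l" for \<Phi> l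
  proof -
    have "\<^bold>\<diamond> \<Phi> \<in> Sent \<sigma>" using saturated[of l] that by (auto simp: saturated_def)
    then have "\<Phi> \<in> Sent \<sigma>" by simp
    then obtain n where "\<Phi> = s n"
      using range_from_nat_into[OF _ assms(1)] unfolding s_def by blast
    then show ?thesis using succ[OF saturated that] that by (intro exI[of _ "n # l"]) (auto simp: tree)
  qed
  obtain f :: "nat \<Rightarrow> 'w" where "inj f" using infinite_countable_subset[OF assms(3)] by blast
  define g where "g = (f \<circ> to_nat :: nat list \<Rightarrow> 'w)"
  have "inj g" unfolding g_def using \<open>inj f\<close> by (intro inj_compose) auto
  then have [simp]: "inv g (g l) = l" for l by (rule inv_f_f)
  show ?thesis
    by (rule exI[of _ "range g"], rule exI[of _ "tree \<circ> inv g"], rule exI[of _ "g []"])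
      (auto simp: tree saturated dest!: successor)
qed

section \<open>The model and its truth lemma\<close>

text \<open>\<open>h\<close> turns constants of the expanded signature into individuals. Its
  injectivity on \<open>D\<close> allows atoms to be recovered from tuples of individuals.\<close>

locale canonical_model =
  fixes \<sigma> :: "('p, 'c) signature" and W :: "'w set" and th :: "'w \<Rightarrow> ('p, 'c + nat) fm set"
    and h :: "'c + nat \<Rightarrow> 'a" and D :: "('c + nat) set" and \<sigma>' :: "('p, 'c + nat) signature"
  defines "\<sigma>' \<equiv> expand \<sigma> (UNIV :: nat set)" and "D \<equiv> consts_of \<sigma>'"
  assumes saturated: "w \<in> W \<Longrightarrow> saturated \<sigma>' (th w)"
    and successor: "w \<in> W \<Longrightarrow> \<^bold>\<diamond> \<Phi> \<in> th w \<Longrightarrow> \<exists>u \<in> W. \<Phi> \<in> th u \<and> (\<forall>\<Psi> \<in> th u. \<^bold>\<diamond> \<Psi> \<in> th w)"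
    and inj: "inj_on h D"
    and nonempty: "W \<noteq> {}"
begin

text \<open>\<open>F\<close> selects the sign: with the identity the relations are extensions, with
  \<open>SNeg\<close> they are anti-extensions.\<close>

definition canon_struct :: "(('p, 'c + nat) fm \<Rightarrow> ('p, 'c + nat) fm) \<Rightarrow> 'w \<Rightarrow> ('p, 'c, 'a) struct" where
  "canon_struct F w = \<lparr>univ = h ` D,
    pred_int = (\<lambda>P. {map h ks |ks. set ks \<subseteq> D \<and> length ks = arity \<sigma> P \<and> F (Atom P (map Const ks)) \<in> th w}),
    const_int = h \<circ> Inl\<rparr>"

text \<open>Accessibility is the canonical relation between theories rather than the edge relation
  of the tree. Worlds on different branches may be related, which cannot falsify
  \<open>Dia_truth\<close>.\<close>

definition \<M> :: "('w, 'p, 'c, 'a) model" where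
  "\<M> = \<lparr>worlds = W, acc = {(w, u) \<in> W \<times> W. \<forall>\<Psi> \<in> th u. \<^bold>\<diamond> \<Psi> \<in> th w},
    pos = canon_struct id, neg = canon_struct SNeg\<rparr>"

lemma D_Inl: "c \<in> consts_of \<sigma> \<Longrightarrow> Inl c \<in> D" and D_Inr: "Inr n \<in> D"
  by (auto simp: D_def \<sigma>'_def expand_def)

lemma world_dom_canon: "world_dom \<M> w = h ` D"
  by (simp add: world_dom_def \<M>_def canon_struct_def)

lemma QBKs_model_canon: "QBKs_model \<sigma> \<M>"
proof -
  have "D \<noteq> {}" using D_Inr by blast
  then have "is_struct \<sigma> (canon_struct F w)" for F w
    using D_Inl by (auto simp: is_struct_def canon_struct_def intro!: imageI)
  then show ?thesis
    using nonempty by (auto simp: QBKs_model_def QBK_model_def world_dom_canon)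
      (auto simp: \<M>_def canon_struct_def)
qed

text \<open>One direction is the definition of \<open>acc\<close>, the other is
  \<open>successor\<close>.\<close>

lemma Dia_truth:
  assumes "w \<in> W"
  shows "\<^bold>\<diamond> \<Phi> \<in> th w \<longleftrightarrow> (\<exists>u. (w, u) \<in> acc \<M> \<and> \<Phi> \<in> th u)"
  using assms successor[OF assms, of \<Phi>] by (auto simp: \<M>_def)

lemma Box_truth:
  assumes "w \<in> W" "\<Phi> \<in> Sent \<sigma>'"
  shows "\<^bold>\<box> \<Phi> \<in> th w \<longleftrightarrow> (\<forall>u. (w, u) \<in> acc \<M> \<longrightarrow> \<Phi> \<in> th u)"
proof -
  have "\<^bold>\<not> \<Phi> \<in> th u \<longleftrightarrow> \<Phi> \<notin> th u" if "u \<in> W" for u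
    using that saturated_theory.Neg_iff[OF saturated_theory.intro[OF saturated]] assms(2) by blast
  moreover have "u \<in> W" if "(w, u) \<in> acc \<M>" for u using that by (auto simp: \<M>_def)
  ultimately show ?thesis
    using Dia_truth[OF assms(1), of "\<^bold>\<not> \<Phi>"]
      saturated_theory.modal_iffs(1)[OF saturated_theory.intro[OF saturated[OF assms(1)]] assms(2)]
    by blast
qed

text \<open>Every element is the image of a constant in \<open>D\<close>, so the quantifier clauses
  match the instance properties of saturated theories; the clauses for \<open>SNeg\<close> of a
  compound match the axioms that push it inwards.\<close>

lemma truth:
  assumes "w \<in> W" "\<Phi> \<in> Form \<sigma>" "\<And>x. \<rho> x \<in> D"
  shows "(sat \<M> \<Phi> True w (h \<circ> \<rho>) \<longleftrightarrow> msubst (Const \<circ> \<rho>) (lift \<Phi>) \<in> th w) \<and>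
    (sat \<M> \<Phi> False w (h \<circ> \<rho>) \<longleftrightarrow> \<^bold>\<sim> msubst (Const \<circ> \<rho>) (lift \<Phi>) \<in> th w)"
  using assms
proof (induction \<Phi> arbitrary: w \<rho>)
  case (Atom P ts)
  define k where "k t = (case t of Var x \<Rightarrow> \<rho> x | Const c \<Rightarrow> Inl c)" for t :: "'c tm"
  have "k t \<in> D" if "t \<in> set ts" for t
    using Atom.prems D_Inl that by (cases t) (force simp: k_def Form_def)+
  then have k: "set (map k ts) \<subseteq> D" "length (map k ts) = arity \<sigma> P"
    using Atom.prems by (auto simp: Form_def)
  have "subst_tm (Const \<circ> \<rho>) \<circ> map_tm Inl = Const \<circ> k"
  proof
    show "(subst_tm (Const \<circ> \<rho>) \<circ> map_tm Inl) t = (Const \<circ> k) t" for t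
      by (cases t) (simp_all add: k_def)
  qed
  then have F: "msubst (Const \<circ> \<rho>) (lift (Atom P ts)) = Atom P (map Const (map k ts))"
    by (simp only: lift_simps msubst.simps map_map)
  have "tval (canon_struct G w) (h \<circ> \<rho>) = h \<circ> k" for G
  proof
    show "tval (canon_struct G w) (h \<circ> \<rho>) t = (h \<circ> k) t" for t
      by (cases t) (simp_all add: k_def canon_struct_def)
  qed
  then have val: "map (tval (canon_struct G w) (h \<circ> \<rho>)) ts = map h (map k ts)" for G
    by (simp only: map_map)
  \<comment> \<open>Injectivity of \<open>h\<close> on \<open>D\<close> makes the tuple
    \<open>ks\<close> in the definition of \<open>pred_int\<close> unique.\<close>
  have "map h (map k ts) \<in> pred_int (canon_struct G w) P \<longleftrightarrow> G (Atom P (map Const (map k ts))) \<in> th w" for G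
  proof
    assume "map h (map k ts) \<in> pred_int (canon_struct G w) P"
    then obtain ks where ks: "set ks \<subseteq> D" "G (Atom P (map Const ks)) \<in> th w" "map h (map k ts) = map h ks"
      unfolding canon_struct_def by auto
    then have "map k ts = ks"
      using inj_on_map_eq_map[of h "map k ts" ks] inj_on_subset[OF inj] k(1) by (metis Un_least)
    then show "G (Atom P (map Const (map k ts))) \<in> th w" using ks(2) by blast
  next
    assume "G (Atom P (map Const (map k ts))) \<in> th w"
    then have "\<exists>ks. map h (map k ts) = map h ks \<and> set ks \<subseteq> D \<and> length ks = arity \<sigma> P \<and>
        G (Atom P (map Const ks)) \<in> th w"
      using k by blast
    then show "map h (map k ts) \<in> pred_int (canon_struct G w) P"
      unfolding canon_struct_def by simp
  qed
  then show ?case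
    unfolding sat.simps F str_def if_True if_False by (simp only: \<M>_def model.simps val id_apply simp_thms)
next
  case Falsum
  interpret saturated_theory \<sigma>' "th w" by unfold_locales (rule saturated, fact)
  show ?case using bot SNeg_bot by simp
next
  case (Imp \<Phi> \<Psi>)
  interpret saturated_theory \<sigma>' "th w" by unfold_locales (rule saturated, fact)
  have "msubst (Const \<circ> \<rho>) (lift \<Phi>) \<in> Sent \<sigma>'" "msubst (Const \<circ> \<rho>) (lift \<Psi>) \<in> Sent \<sigma>'"
    using Imp.prems by (auto simp: \<sigma>'_def D_def intro!: ground_Sent simp del: comp_apply)
  then show ?case using Imp.IH[of w \<rho>] Imp.prems by (simp add: Imp_iff SNeg_iffs del: comp_apply)
next
  case (Conj \<Phi> \<Psi>)
  interpret saturated_theory \<sigma>' "th w" by unfold_locales (rule saturated, fact)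
  have "msubst (Const \<circ> \<rho>) (lift \<Phi>) \<in> Sent \<sigma>'" "msubst (Const \<circ> \<rho>) (lift \<Psi>) \<in> Sent \<sigma>'"
    using Conj.prems by (auto simp: \<sigma>'_def D_def intro!: ground_Sent simp del: comp_apply)
  then show ?case using Conj.IH[of w \<rho>] Conj.prems by (simp add: Conj_iff SNeg_iffs del: comp_apply)
next
  case (Disj \<Phi> \<Psi>)
  interpret saturated_theory \<sigma>' "th w" by unfold_locales (rule saturated, fact)
  have "msubst (Const \<circ> \<rho>) (lift \<Phi>) \<in> Sent \<sigma>'" "msubst (Const \<circ> \<rho>) (lift \<Psi>) \<in> Sent \<sigma>'"
    using Disj.prems by (auto simp: \<sigma>'_def D_def intro!: ground_Sent simp del: comp_apply)
  then show ?case using Disj.IH[of w \<rho>] Disj.prems by (simp add: Disj_iff SNeg_iffs del: comp_apply)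
next
  case (SNeg \<Phi>)
  interpret saturated_theory \<sigma>' "th w" by unfold_locales (rule saturated, fact)
  have "msubst (Const \<circ> \<rho>) (lift \<Phi>) \<in> Sent \<sigma>'"
    using SNeg.prems by (auto simp: \<sigma>'_def D_def intro!: ground_Sent simp del: comp_apply)
  then show ?case using SNeg.IH[of w \<rho>] SNeg.prems by (simp add: SNeg_SNeg_iff del: comp_apply)
next
  case (Box \<Phi>)
  interpret saturated_theory \<sigma>' "th w" by unfold_locales (rule saturated, fact)
  let ?F = "msubst (Const \<circ> \<rho>) (lift \<Phi>)"
  have F: "?F \<in> Sent \<sigma>'"
    using Box.prems by (auto simp: \<sigma>'_def D_def intro!: ground_Sent simp del: comp_apply)
  have "(sat \<M> \<Phi> True u (h \<circ> \<rho>) \<longleftrightarrow> ?F \<in> th u) \<and> (sat \<M> \<Phi> False u (h \<circ> \<rho>) \<longleftrightarrow> \<^bold>\<sim> ?F \<in> th u)"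
    if "(w, u) \<in> acc \<M>" for u
    by (rule Box.IH) (use that Box.prems in \<open>auto simp: \<M>_def\<close>)
  then show ?case
    using Box_truth[OF Box.prems(1) F] Dia_truth[OF Box.prems(1), of "\<^bold>\<sim> ?F"] modal_iffs(3)[OF F]
    by (auto simp del: comp_apply)
next
  case (Dia \<Phi>)
  interpret saturated_theory \<sigma>' "th w" by unfold_locales (rule saturated, fact)
  let ?F = "msubst (Const \<circ> \<rho>) (lift \<Phi>)"
  have F: "?F \<in> Sent \<sigma>'"
    using Dia.prems by (auto simp: \<sigma>'_def D_def intro!: ground_Sent simp del: comp_apply)
  have "(sat \<M> \<Phi> True u (h \<circ> \<rho>) \<longleftrightarrow> ?F \<in> th u) \<and> (sat \<M> \<Phi> False u (h \<circ> \<rho>) \<longleftrightarrow> \<^bold>\<sim> ?F \<in> th u)"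
    if "(w, u) \<in> acc \<M>" for u
    by (rule Dia.IH) (use that Dia.prems in \<open>auto simp: \<M>_def\<close>)
  then show ?case
    using Dia_truth[OF Dia.prems(1), of ?F] Box_truth[OF Dia.prems(1), of "\<^bold>\<sim> ?F"] modal_iffs(4)[OF F] F
    by (auto simp del: comp_apply)
next
  case (Forall x \<Phi>)
  interpret saturated_theory \<sigma>' "th w" by unfold_locales (rule saturated, fact)
  let ?\<Theta> = "msubst ((Const \<circ> \<rho>)(x := Var x)) (lift \<Phi>)"
  have "msubst (Const \<circ> \<rho>) (lift (Forall x \<Phi>)) \<in> Sent \<sigma>'"
    unfolding \<sigma>'_def by (rule ground_Sent) (use Forall.prems in \<open>auto simp: D_def \<sigma>'_def\<close>)
  then have S: "Forall x ?\<Theta> \<in> Sent \<sigma>'" "Exists x ?\<Theta> \<in> Sent \<sigma>'"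
    by (simp_all add: Sent_Quant del: comp_apply fun_upd_apply)
  have upd: "(h \<circ> \<rho>)(x := h k) = h \<circ> \<rho>(x := k)" for k by auto
  have "(sat \<M> \<Phi> True w ((h \<circ> \<rho>)(x := h k)) \<longleftrightarrow> subst ?\<Theta> x (Const k) \<in> th w) \<and>
      (sat \<M> \<Phi> False w ((h \<circ> \<rho>)(x := h k)) \<longleftrightarrow> \<^bold>\<sim> subst ?\<Theta> x (Const k) \<in> th w)" if "k \<in> D" for k
    unfolding upd subst_msubst_ground by (rule Forall.IH) (use that Forall.prems in auto)
  then show ?case
    using Forall_iff[OF S(1)] SNeg_Quant_iffs(2)[OF S(2)]
    by (simp add: world_dom_canon D_def del: comp_apply fun_upd_apply)
next
  case (Exists x \<Phi>)
  interpret saturated_theory \<sigma>' "th w" by unfold_locales (rule saturated, fact)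
  let ?\<Theta> = "msubst ((Const \<circ> \<rho>)(x := Var x)) (lift \<Phi>)"
  have "msubst (Const \<circ> \<rho>) (lift (Exists x \<Phi>)) \<in> Sent \<sigma>'"
    unfolding \<sigma>'_def by (rule ground_Sent) (use Exists.prems in \<open>auto simp: D_def \<sigma>'_def\<close>)
  then have S: "Exists x ?\<Theta> \<in> Sent \<sigma>'"
    by (simp del: comp_apply fun_upd_apply)
  have upd: "(h \<circ> \<rho>)(x := h k) = h \<circ> \<rho>(x := k)" for k by auto
  have "(sat \<M> \<Phi> True w ((h \<circ> \<rho>)(x := h k)) \<longleftrightarrow> subst ?\<Theta> x (Const k) \<in> th w) \<and>
      (sat \<M> \<Phi> False w ((h \<circ> \<rho>)(x := h k)) \<longleftrightarrow> \<^bold>\<sim> subst ?\<Theta> x (Const k) \<in> th w)" if "k \<in> D" for k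
    unfolding upd subst_msubst_ground by (rule Exists.IH) (use that Exists.prems in auto)
  then show ?case
    using Exists_iff[OF S] SNeg_Quant_iffs(1)[OF S]
    by (simp add: world_dom_canon D_def del: comp_apply fun_upd_apply)
qed

text \<open>Two expansions of \<sigma> meet here: theories name individuals by
  \<open>'c + nat\<close>, the semantics by \<open>'c + 'a\<close>. A constant
  \<open>\<rho> x\<close> of the former corresponds to the name of the element
  \<open>h (\<rho> x)\<close> in the latter.\<close>

lemma verifies_iff:
  assumes "w \<in> W" "\<Phi> \<in> Form \<sigma>" "\<And>x. \<rho> x \<in> D"
  shows "verifies \<M> w (msubst (Const \<circ> (\<lambda>x. Inr (h (\<rho> x)))) (lift \<Phi>)) \<longleftrightarrow>
    msubst (Const \<circ> \<rho>) (lift \<Phi>) \<in> th w"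
proof -
  have "ground_subst \<sigma> (world_dom \<M> w) (\<lambda>x. Inr (h (\<rho> x)))"
    using assms(3) by (auto simp: ground_subst_def expand_def world_dom_canon)
  moreover have "tm_val (pos \<M> w) \<circ> Const \<circ> (\<lambda>x. Inr (h (\<rho> x))) = h \<circ> \<rho>" by auto
  moreover have "w \<in> worlds \<M>" using assms(1) by (simp add: \<M>_def)
  ultimately show ?thesis
    using verifies_iff_sat[OF QBKs_model_canon, of w \<Phi> "\<lambda>x. Inr (h (\<rho> x))"] truth[OF assms] assms(2)
    by (simp add: Form_def del: comp_apply)
qed

end

lemma completeness:
  fixes \<sigma> :: "('p, 'c) signature"
  assumes "countable_signature \<sigma>" "\<Gamma> \<subseteq> Sent \<sigma>" "\<Delta> \<subseteq> Form \<sigma>"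
    and inf: "infinite (UNIV :: 'w set)" "infinite (UNIV :: 'a set)"
    and entails: "entails TYPE('w) TYPE('a) \<sigma> \<Gamma> \<Delta>"
  shows "derives \<sigma> \<Gamma> \<Delta>"
proof (rule ccontr)
  assume not_derives: "\<not> derives \<sigma> \<Gamma> \<Delta>"
  let ?\<sigma> = "expand \<sigma> (UNIV :: nat set)"
  let ?\<rho> = "\<lambda>x. Inr (2 * x) :: 'c + nat"
  have count: "countable_signature ?\<sigma>"
    using assms(1) by (auto simp: countable_signature_def expand_def)
  then have Sent: "countable (Sent ?\<sigma>)"
    using countable_Form by (rule_tac countable_subset[of _ "Form ?\<sigma>"]) (auto simp: Sent_Form)
  obtain T where T: "saturated ?\<sigma> T" "lift ` \<Gamma> \<subseteq> T"
    "\<And>\<Psi>. \<Psi> \<in> \<Delta> \<Longrightarrow> msubst (Const \<circ> ?\<rho>) (lift \<Psi>) \<notin> T"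
    using root_theory[OF assms(2,3) Sent not_derives] by blast
  obtain W th and w\<^sub>0 :: 'w where W: "w\<^sub>0 \<in> W" "th w\<^sub>0 = T" "\<forall>w \<in> W. saturated ?\<sigma> (th w)"
    "\<forall>w \<in> W. \<forall>\<Phi>. \<^bold>\<diamond> \<Phi> \<in> th w \<longrightarrow> (\<exists>u \<in> W. \<Phi> \<in> th u \<and> (\<forall>\<Psi> \<in> th u. \<^bold>\<diamond> \<Psi> \<in> th w))"
    using world_tree[OF Sent T(1) inf(1)] by blast
  obtain f :: "nat \<Rightarrow> 'a" where "inj f" using infinite_countable_subset[OF inf(2)] by blast
  \<comment> \<open>The expanded signature is countable, so its constants are numbered and the
    numbers are injected into \<open>'a\<close>.\<close>
  then have h: "inj_on (f \<circ> to_nat_on (consts_of ?\<sigma>)) (consts_of ?\<sigma>)"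
    using count by (intro comp_inj_on) (auto simp: countable_signature_def intro: inj_on_subset)
  interpret canonical_model \<sigma> W th "f \<circ> to_nat_on (consts_of ?\<sigma>)" "consts_of ?\<sigma>" ?\<sigma>
    by unfold_locales (use W h in auto)
  let ?h = "f \<circ> to_nat_on (consts_of ?\<sigma>)"
  \<comment> \<open>The constants naming the variables of \<Delta>, now as individuals: under this
    substitution no member of \<Delta> is verified at the root.\<close>
  let ?\<rho>' = "\<lambda>x. Inr (?h (?\<rho> x)) :: 'c + 'a"
  have \<rho>: "?\<rho> x \<in> consts_of ?\<sigma>" for x by (rule D_Inr)
  note truth = verifies_iff[where \<rho> = ?\<rho>, OF W(1) _ \<rho>, unfolded W(2)]
  have "?h (?\<rho> x) \<in> world_dom \<M> w\<^sub>0" for x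
    unfolding world_dom_canon using \<rho> by (rule imageI)
  then have "ground_subst \<sigma> (world_dom \<M> w\<^sub>0) ?\<rho>'"
    by (simp add: ground_subst_def Inr_expand)
  moreover have "verifies \<M> w\<^sub>0 (lift \<Phi>)" if "\<Phi> \<in> \<Gamma>" for \<Phi>
  proof -
    have "fv (lift \<Phi> :: ('p, 'c + 'a) fm) = {}" "fv (lift \<Phi> :: ('p, 'c + nat) fm) = {}" "\<Phi> \<in> Form \<sigma>"
      using that assms(2) by (auto simp: Sent_def)
    \<comment> \<open>A lifted premise is closed over both expansions, so the substitutions on the
      two sides of \<open>truth\<close> vanish.\<close>
    then show ?thesis using truth[of \<Phi>] that T(2) by (auto simp only: msubst_closed)
  qed
  moreover have "w\<^sub>0 \<in> worlds \<M>" using W(1) by (simp add: \<M>_def)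
  ultimately obtain \<Psi> where "\<Psi> \<in> \<Delta>" "verifies \<M> w\<^sub>0 (msubst (Const \<circ> ?\<rho>') (lift \<Psi>))"
    using entails QBKs_model_canon unfolding entails_def by blast
  then show False using truth[of \<Psi>] T(3) assms(3) by blast
qed

theorem theorem23:
  fixes \<sigma> :: "('p, 'c) signature"
    and \<Gamma> \<Delta> :: "('p, 'c) fm set"
  assumes "countable_signature \<sigma>"
    and "\<Gamma> \<subseteq> Sent \<sigma>" and "\<Delta> \<subseteq> Form \<sigma>"
    and "infinite (UNIV :: 'w set)" and "infinite (UNIV :: 'a set)"
  shows "derives \<sigma> \<Gamma> \<Delta> \<longleftrightarrow> entails TYPE('w) TYPE('a) \<sigma> \<Gamma> \<Delta>"
  using soundness[OF assms(2,3)] completeness[OF assms] by blast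

end
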